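(* Let $m:[0,+\infty)\to(0,+\infty)$ be a function of class $C^1$ for which there is a constant $\mu_1>0$ with $m(\sigma)\geq\mu_1$ for every $\sigma\geq 0$, and let $\lambda>1$ be a real number. Assume that the pair $(m,\lambda)$ satisfies the heteroclinic connection assumption (defined in the context). Let $H$ be a real Hilbert space, and let $A$ be a positive self-adjoint linear operator on $H$ with dense domain for which there exists a sequence $\{e_k\}_{k\geq 0}\subseteq H$ of orthonormal vectors (not necessarily a basis) such that $$Ae_k=\lambda^{2k}e_k\qquad\forall k\geq 0.$$ Then there exist a function $f:[0,+\infty)\to H$ such that $$f\in C^0\left([0,+\infty),\mathcal{G}_{r,s}(A)\right)\qquad\forall s>1,\ \forall r>0,$$ a real number $T_\infty>0$, and a function $$u\in C^2\left([0,T_\infty),\mathcal{G}_{r,s}(A)\right)\qquad\forall s>0,\ \forall r>0,$$ which solves $$u''(t)+m\left(|A^{1/2}u(t)|^2\right)Au(t)=f(t)\qquad\forall t\in[0,T_\infty),$$ such that $$\limsup_{t\to T_\infty^-}\left(|A^{\alpha}u'(t)|^2+|A^{\alpha+1/2}u(t)|^2\right)=+\infty\qquad\forall\alpha>0,$$ and such that the limit $\lim_{t\to T_\infty^-}u'(t)$ does not exist (in $H$).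
   Context: $|\cdot|$ and $\langle\cdot,\cdot\rangle$ denote the norm and scalar product of $H$. Heteroclinic connection assumption. Let $m:[0,+\infty)\to(0,+\infty)$ be of class $C^1$ with $m(\sigma)\geq\mu_1>0$ for all $\sigma\geq0$, and let $\lambda>1$. The pair $(m,\lambda)$ satisfies the heteroclinic connection assumption if there exist two functions $v:\mathbb{R}\to\mathbb{R}$ and $w:\mathbb{R}\to\mathbb{R}$ of class $C^2$ such that: (i) $v'(0)^2+w'(0)^2+v(0)^2+w(0)^2>0$; (ii) for every $t\in\mathbb{R}$, $$v''(t)+m\left(v(t)^2+\lambda^2w(t)^2\right)v(t)=0,\qquad w''(t)+\lambda^2m\left(v(t)^2+\lambda^2w(t)^2\right)w(t)=0;$$ (iii) there exist two positive real numbers $A_0$ and $B_0$ such that $$|v'(t)|^2+|v(t)|^2\leq B_0\exp(-A_0t)\quad\forall t\geq0,\qquad |w'(t)|^2+\lambda^2|w(t)|^2\leq B_0\exp(-A_0|t|)\quad\forall t\leq0.$$ Gevrey spaces. Let $\{e_k\}_{k\geq0}$ be an orthonormal sequence in $H$ (not necessarily a basis) with $Ae_k=\lambda_k^2e_k$, where $\lambda_k>0$ (in the claim, $\lambda_k=\lambda^k$). For $r>0$ and $s>0$, a vector $u\in H$ belongs to $\mathcal{G}_{r,s}(A)$ (exponent $s$, radius $r$) if $$u=\sum_{k=0}^\infty\langle u,e_k\rangle e_k\qquad\text{and}\qquad \|u\|_{\mathcal{G}_{r,s}(A)}^2:=\sum_{k=0}^\infty\langle u,e_k\rangle^2\exp\left(r\lambda_k^{1/s}\right)<+\infty.$$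 This norm makes $\mathcal{G}_{r,s}(A)$ a Hilbert space, and regularity in time with values in $\mathcal{G}_{r,s}(A)$ is with respect to this norm. *)

theory Defs
  imports "HOL-Analysis.Analysis"
begin

text \<open>Derivatives are taken within the set, so they are one-sided at an endpoint that belongs to it.\<close>

definition C1_on :: "real set \<Rightarrow> (real \<Rightarrow> real) \<Rightarrow> (real \<Rightarrow> real) \<Rightarrow> bool" where
  "C1_on I f f1 \<longleftrightarrow>
     (\<forall>t\<in>I. (f has_real_derivative f1 t) (at t within I)) \<and> continuous_on I f1"

definition C2_on ::
  "real set \<Rightarrow> (real \<Rightarrow> real) \<Rightarrow> (real \<Rightarrow> real) \<Rightarrow> (real \<Rightarrow> real) \<Rightarrow> bool" where
  "C2_on I f f1 f2 \<longleftrightarrow> C1_on I f f1 \<and> C1_on I f1 f2"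

definition heteroclinic_connection :: "(real \<Rightarrow> real) \<Rightarrow> real \<Rightarrow> bool" where
  "heteroclinic_connection m lam \<longleftrightarrow>
     (\<exists>v v1 v2 w w1 w2.
        C2_on UNIV v v1 v2 \<and> C2_on UNIV w w1 w2 \<and>
        (v1 0)\<^sup>2 + (w1 0)\<^sup>2 + (v 0)\<^sup>2 + (w 0)\<^sup>2 > 0 \<and>
        (\<forall>t. v2 t + m ((v t)\<^sup>2 + lam\<^sup>2 * (w t)\<^sup>2) * v t = 0) \<and>
        (\<forall>t. w2 t + lam\<^sup>2 * m ((v t)\<^sup>2 + lam\<^sup>2 * (w t)\<^sup>2) * w t = 0) \<and>
        (\<exists>A0>0. \<exists>B0>0.
           (\<forall>t\<ge>0. \<bar>v1 t\<bar>\<^sup>2 + \<bar>v t\<bar>\<^sup>2 \<le> B0 * exp (- A0 * t)) \<and>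
           (\<forall>t\<le>0. \<bar>w1 t\<bar>\<^sup>2 + lam\<^sup>2 * \<bar>w t\<bar>\<^sup>2 \<le> B0 * exp (- A0 * \<bar>t\<bar>))))"

text \<open>A possibly unbounded operator is represented by its graph: \<open>(x, y) \<in> A\<close> means that \<open>x\<close> lies
  in the domain of \<open>A\<close> and \<open>A x = y\<close>. The domain is \<open>Domain A\<close>, composition is relational
  composition (\<open>A O B\<close> applies \<open>A\<close> first), iteration is \<open>A ^^ n\<close>, and the closure of the operator
  is the topological closure of the graph. The value \<open>op_app A x\<close> is meaningful only for
  \<open>x \<in> Domain A\<close>.\<close>

definition op_app :: "('a \<times> 'a) set \<Rightarrow> 'a \<Rightarrow> 'a" where
  "op_app A x = (THE y. (x, y) \<in> A)"

definition op_adjoint :: "('a::real_inner \<times> 'a) set \<Rightarrow> ('a \<times> 'a) set" where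
  "op_adjoint A = {(x, y). \<forall>(a, b)\<in>A. b \<bullet> x = a \<bullet> y}"

definition positive_self_adjoint :: "('a::real_inner \<times> 'a) set \<Rightarrow> bool" where
  "positive_self_adjoint A \<longleftrightarrow>
     subspace A \<and> single_valued A \<and> closure (Domain A) = UNIV \<and>
     op_adjoint A = A \<and> (\<forall>(x, y)\<in>A. y \<bullet> x \<ge> 0)"

text \<open>\<open>resolvent A t y\<close> is $(A + t)^{-1} y$: the vector \<open>z\<close> of the domain with \<open>A z + t z = y\<close>.\<close>

definition resolvent :: "('a::real_vector \<times> 'a) set \<Rightarrow> real \<Rightarrow> 'a \<Rightarrow> 'a" where
  "resolvent A t y = (THE z. (z, y - t *\<^sub>R z) \<in> A)"

text \<open>Fractional powers follow Balakrishnan's definition. For $0 < \theta < 1$, the operator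
  $A^\theta$ is the closure of the operator with domain that of $A$ given by
  $$A^\theta x = \frac{\sin(\pi\theta)}{\pi} \int_0^\infty t^{\theta-1} (A+t)^{-1} A x \, dt,$$
  where the (absolutely convergent) improper integral is the limit of integrals over $[1/N, N]$.
  For positive self-adjoint operators this is the power given by the spectral theorem. In general
  $A^\alpha = A^n A^{\alpha - n}$ with $n$ the integer part of $\alpha$.\<close>

definition op_frac_power :: "('a::real_normed_vector \<times> 'a) set \<Rightarrow> real \<Rightarrow> ('a \<times> 'a) set" where
  "op_frac_power A \<theta> = closure {(x, y). \<exists>w. (x, w) \<in> A \<and>
     ((\<lambda>N. (sin (pi * \<theta>) / pi) *\<^sub>R
            integral {1 / N..N} (\<lambda>t. t powr (\<theta> - 1) *\<^sub>R resolvent A t w)) \<longlongrightarrow> y) at_top}"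

definition op_power :: "('a::real_normed_vector \<times> 'a) set \<Rightarrow> real \<Rightarrow> ('a \<times> 'a) set" where
  "op_power A \<alpha> =
     (if frac \<alpha> = 0 then Id else op_frac_power A (frac \<alpha>)) O (A ^^ nat \<lfloor>\<alpha>\<rfloor>)"

text \<open>Here \<open>e\<close> is an orthonormal sequence of eigenvectors, and \<open>lv k\<close> is the square root of the
  eigenvalue of \<open>e k\<close>.\<close>

definition gevrey ::
  "(nat \<Rightarrow> 'a::real_inner) \<Rightarrow> (nat \<Rightarrow> real) \<Rightarrow> real \<Rightarrow> real \<Rightarrow> 'a set" where
  "gevrey e lv r s =
     {u. (\<lambda>k. (u \<bullet> e k) *\<^sub>R e k) sums u \<and>
         summable (\<lambda>k. (u \<bullet> e k)\<^sup>2 * exp (r * lv k powr (1 / s)))}"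

definition gevrey_norm ::
  "(nat \<Rightarrow> 'a::real_inner) \<Rightarrow> (nat \<Rightarrow> real) \<Rightarrow> real \<Rightarrow> real \<Rightarrow> 'a \<Rightarrow> real" where
  "gevrey_norm e lv r s u = sqrt (\<Sum>k. (u \<bullet> e k)\<^sup>2 * exp (r * lv k powr (1 / s)))"

definition gevrey_C0_on ::
  "(nat \<Rightarrow> 'a::real_inner) \<Rightarrow> (nat \<Rightarrow> real) \<Rightarrow> real \<Rightarrow> real \<Rightarrow> real set \<Rightarrow> (real \<Rightarrow> 'a) \<Rightarrow> bool"
where
  "gevrey_C0_on e lv r s I f \<longleftrightarrow>
     (\<forall>t\<in>I. f t \<in> gevrey e lv r s) \<and>
     (\<forall>t\<in>I. ((\<lambda>\<tau>. gevrey_norm e lv r s (f \<tau> - f t)) \<longlongrightarrow> 0) (at t within I))"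

definition gevrey_derivative_on ::
  "(nat \<Rightarrow> 'a::real_inner) \<Rightarrow> (nat \<Rightarrow> real) \<Rightarrow> real \<Rightarrow> real \<Rightarrow> real set
     \<Rightarrow> (real \<Rightarrow> 'a) \<Rightarrow> (real \<Rightarrow> 'a) \<Rightarrow> bool"
where
  "gevrey_derivative_on e lv r s I f f1 \<longleftrightarrow>
     (\<forall>t\<in>I. ((\<lambda>\<tau>. gevrey_norm e lv r s ((f \<tau> - f t) /\<^sub>R (\<tau> - t) - f1 t)) \<longlongrightarrow> 0)
              (at t within I))"

definition gevrey_C2_on ::
  "(nat \<Rightarrow> 'a::real_inner) \<Rightarrow> (nat \<Rightarrow> real) \<Rightarrow> real \<Rightarrow> real \<Rightarrow> real set
     \<Rightarrow> (real \<Rightarrow> 'a) \<Rightarrow> (real \<Rightarrow> 'a) \<Rightarrow> (real \<Rightarrow> 'a) \<Rightarrow> bool"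
where
  "gevrey_C2_on e lv r s I u u1 u2 \<longleftrightarrow>
     gevrey_C0_on e lv r s I u \<and> gevrey_C0_on e lv r s I u1 \<and> gevrey_C0_on e lv r s I u2 \<and>
     gevrey_derivative_on e lv r s I u u1 \<and> gevrey_derivative_on e lv r s I u1 u2"

end

theory Submission
  imports Defs "HOL-Library.Landau_Symbols" "HOL-Real_Asymp.Real_Asymp"
begin

text \<open>The heteroclinic solution, placed on the modes $e_n, e_{n+1}$ and rescaled as
  $U_n(t) = \lambda^{-n} (v(\lambda^n (t - c_n)) e_n + w(\lambda^n (t - c_n)) e_{n+1})$, solves the unforced
  equation exactly and moves a fixed amount $E_0$ of kinetic plus potential energy from $e_n$ to
  $e_{n+1}$, up to errors that are exponentially small in the local time. The solution $u$ follows
  $U_0, U_1, \dots$ in turn. Stage $n$ is left at a zero of $w$ with $w' > 0$, and stage $n + 1$ is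
  entered at a zero of $v$ with $v' > 0$: by conservation of energy both slopes are nearly $\sqrt{E_0}$,
  so on a window of bounded local length Gronwall's lemma keeps the two profiles of $e_{n+1}$
  exponentially close, and a cutoff glues $U_n$ to $U_{n+1}$ at the cost of an exponentially small
  residual, which is the force $f$. With local stage lengths of order $\lambda^n / (n + 1)^2$ the total
  time is finite, while $f$ still tends to $0$ in every Gevrey norm with $s > 1$. As the energy
  escapes to infinite frequency, $u'$ tends to $0$ weakly but not strongly.\<close>

section \<open>Powers of a positive self-adjoint operator on eigenvectors\<close>

text \<open>The two profiles of e_(n+1), rescaled to a common clock, solve oscillator equations of
  the same frequency up to a small error, but with unrelated phases. A common zero with slopes of
  the same sign removes the phase, and the conserved energy then fixes the slope. Sturm comparison
  with frequency sqrt \<mu>1 finds such zeros in every late interval of length 3 pi / sqrt \<mu>1,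
  so stage lengths can be prescribed up to a bounded error.

  The local lengths \<open>L n\<close> face two demands: the durations \<open>L n / lam ^ n\<close>
  must be summable, while a residual of size exp (- A0 / 2 * L n) must beat exp (r * lam powr (n /
  s)) for every r. The choice lam^n / (n + 1)^2 meets both exactly when s > 1.

  Before the blow-up time at most three modes are alive at any instant, so the Gevrey regularity of
  u concerns finite sums only; the force at the blow-up time is the one place with infinitely many
  modes in play.

  A power of A is the closure of a graph and is evaluated by a definite description, so its
  single-valuedness has to be proved before its value on eigenvectors can be used. This is what the
  resolvent theory is for.\<close>

lemma closed_subspace_orthogonal_vector:
  fixes S :: "'a::{real_inner,banach} set"
  assumes "closed S" "subspace S" "S \<noteq> UNIV"
  obtains z where "z \<noteq> 0" "\<And>x. x \<in> S \<Longrightarrow> z \<bullet> x = 0"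
proof -
  obtain y where y: "y \<notin> S" using assms(3) by auto
  have ne: "S \<noteq> {}" using subspace_0[OF assms(2)] by auto
  define d where "d = infdist y S"
  have le: "d \<le> norm (y - x)" if "x \<in> S" for x
    using infdist_le[OF that, of y] by (simp add: d_def dist_norm)
  have d0: "d \<ge> 0" by (simp add: d_def infdist_nonneg)
  have "\<exists>x\<in>S. norm (y - x) < d + 1 / Suc n" for n
    using cInf_lessD[of "dist y ` S" "d + 1 / Suc n"] ne by (auto simp: d_def infdist_notempty dist_norm)
  then obtain X where X: "\<And>n. X n \<in> S" "\<And>n. norm (y - X n) < d + 1 / Suc n" by metis
  \<comment> \<open>Parallelogram law: the midpoint of \<open>X i\<close> and \<open>X j\<close>
    lies in \<open>S\<close>, hence at distance at least \<open>d\<close> from \<open>y\<close>.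
    This makes the minimizing sequence Cauchy.\<close>
  have par: "(norm (X i - X j))\<^sup>2 \<le> 2 * (norm (y - X i))\<^sup>2 + 2 * (norm (y - X j))\<^sup>2 - 4 * d\<^sup>2" for i j
  proof -
    have "(1/2) *\<^sub>R (X i + X j) \<in> S"
      using assms(2) X(1) by (simp add: subspace_add subspace_scale)
    then have "d\<^sup>2 \<le> (norm (y - (1/2) *\<^sub>R (X i + X j)))\<^sup>2" using le d0 by (intro power_mono) auto
    also have "4 * \<dots> = (norm ((y - X i) + (y - X j)))\<^sup>2"
      by (simp add: power2_norm_eq_inner algebra_simps inner_commute)
    finally have "4 * d\<^sup>2 \<le> (norm ((y - X i) + (y - X j)))\<^sup>2" by simp
    then show ?thesis
      by (simp add: power2_norm_eq_inner algebra_simps inner_commute)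
  qed
  have lim_norm: "(\<lambda>n. norm (y - X n)) \<longlonglongrightarrow> d"
  proof (rule tendsto_sandwich[of "\<lambda>_. d" _ _ "\<lambda>n. d + 1 / Suc n"])
    show "(\<lambda>n. d + 1 / Suc n) \<longlonglongrightarrow> d"
      using tendsto_add[OF tendsto_const LIMSEQ_inverse_real_of_nat, of d] by (simp add: inverse_eq_divide)
  qed (use le X(1) less_imp_le[OF X(2)] in \<open>auto intro!: always_eventually\<close>)
  have "Cauchy X"
  proof (rule metric_CauchyI)
    fix \<epsilon> :: real assume e: "0 < \<epsilon>"
    have "(\<lambda>n. (norm (y - X n))\<^sup>2) \<longlonglongrightarrow> d\<^sup>2" using lim_norm by (intro tendsto_intros)
    then have "\<forall>\<^sub>F n in sequentially. (norm (y - X n))\<^sup>2 < d\<^sup>2 + \<epsilon>\<^sup>2 / 4"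
      using e by (intro order_tendstoD) auto
    then obtain M where M: "\<And>n. n \<ge> M \<Longrightarrow> (norm (y - X n))\<^sup>2 < d\<^sup>2 + \<epsilon>\<^sup>2 / 4"
      by (auto simp: eventually_sequentially)
    have "dist (X i) (X j) < \<epsilon>" if "i \<ge> M" "j \<ge> M" for i j
    proof -
      have "(norm (X i - X j))\<^sup>2 < \<epsilon>\<^sup>2" using par[of i j] M[OF that(1)] M[OF that(2)] by simp
      then show ?thesis using e by (simp add: dist_norm power2_less_imp_less)
    qed
    then show "\<exists>M. \<forall>i\<ge>M. \<forall>j\<ge>M. dist (X i) (X j) < \<epsilon>" by blast
  qed
  then obtain x where x: "X \<longlonglongrightarrow> x" using Cauchy_convergent convergent_def by blast
  have xS: "x \<in> S" using closed_sequentially[OF assms(1)] X(1) x by blast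
  have dx: "norm (y - x) = d"
    using LIMSEQ_unique[OF _ lim_norm] tendsto_norm[OF tendsto_diff[OF tendsto_const x]] by blast
  have orth: "(y - x) \<bullet> s = 0" if s: "s \<in> S" for s
  proof (cases "s = 0")
    case False
    \<comment> \<open>This \<open>c\<close> minimizes the distance from \<open>y\<close> to the line
      through \<open>x\<close> in direction \<open>s\<close>. As \<open>x\<close> is already
      nearest, the gain must vanish.\<close>
    define c where "c = ((y - x) \<bullet> s) / (s \<bullet> s)"
    have ss: "s \<bullet> s > 0" using False by simp
    have "x + c *\<^sub>R s \<in> S" using assms(2) xS s by (simp add: subspace_add subspace_scale)
    then have "d\<^sup>2 \<le> (norm (y - (x + c *\<^sub>R s)))\<^sup>2" using le d0 by (intro power_mono) auto
    also have "\<dots> = (norm (y - x))\<^sup>2 - 2 * c * ((y - x) \<bullet> s) + c\<^sup>2 * (s \<bullet> s)"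
      unfolding power2_norm_eq_inner by (simp add: algebra_simps inner_commute power2_eq_square[of c])
    also have "\<dots> = d\<^sup>2 - ((y - x) \<bullet> s)\<^sup>2 / (s \<bullet> s)"
      using ss unfolding dx c_def by (simp add: field_simps power2_eq_square)
    finally have "((y - x) \<bullet> s)\<^sup>2 / (s \<bullet> s) \<le> 0" by simp
    then show ?thesis using ss by (simp add: divide_le_0_iff)
  qed simp
  show ?thesis using that[of "y - x"] orth xS y by auto
qed

text \<open>With \<open>G\<close> the incomplete Beta integral, \<open>G (t / (\<mu> + t))\<close> is an antiderivative of the
  integrand.\<close>

lemma balakrishnan_integral:
  fixes \<mu> \<theta> :: real
  assumes \<mu>: "\<mu> > 0" and \<theta>: "0 < \<theta>" "\<theta> < 1"
  shows "((\<lambda>N. integral {1 / N..N} (\<lambda>t. t powr (\<theta> - 1) * (\<mu> / (\<mu> + t)))) \<longlongrightarrow>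
      \<mu> powr \<theta> * (pi / sin (pi * \<theta>))) at_top"
proof -
  define h where "h = (\<lambda>s::real. s powr (\<theta> - 1) * (1 - s) powr ((1 - \<theta>) - 1))"
  define G where "G = (\<lambda>s. integral {0..s} h)"
  have B: "(h has_integral Beta \<theta> (1 - \<theta>)) {0..1}"
    unfolding h_def using \<theta> by (intro has_integral_Beta_real) auto
  then have hint: "h integrable_on {0..1}" by blast
  have contG: "continuous_on {0..1} G" unfolding G_def by (rule indefinite_integral_continuous_1[OF hint])
  \<comment> \<open>Euler's reflection formula, transferred from complex to real arguments; the
    denominator of Beta is Gamma 1 = 1.\<close>
  have "Beta \<theta> (1 - \<theta>) = pi / sin (pi * \<theta>)"
  proof -
    have "complex_of_real (Gamma \<theta> * Gamma (1 - \<theta>)) = of_real (pi / sin (pi * \<theta>))"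
    proof -
      have "1 - of_real \<theta> = complex_of_real (1 - \<theta>)" by simp
      with Gamma_reflection_complex[of "of_real \<theta>"] show ?thesis
        by (simp only: Gamma_complex_of_real of_real_mult[symmetric] sin_of_real of_real_divide[symmetric])
    qed
    then show ?thesis unfolding of_real_eq_iff by (simp add: Beta_def)
  qed
  then have G1: "G 1 = pi / sin (pi * \<theta>)" and G0: "G 0 = 0"
    using B by (auto simp: G_def integral_unique)
  have dG: "(G has_real_derivative h s) (at s)" if s: "0 < s" "s < 1" for s
  proof -
    have "continuous (at s within {0..1} - {}) h"
      unfolding h_def using s by (intro continuous_intros) auto
    from integral_has_vector_derivative_continuous_at[OF hint _ _ this]
    have "(G has_real_derivative h s) (at s within {0..1})"
      using s by (auto simp: G_def has_real_derivative_iff_has_vector_derivative)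
    moreover have "at s within {0..1} = at s" using s by (intro at_within_interior) auto
    ultimately show ?thesis by simp
  qed
  have dH: "((\<lambda>t. \<mu> powr \<theta> * G (t / (\<mu> + t))) has_real_derivative t powr (\<theta> - 1) * (\<mu> / (\<mu> + t))) (at t)"
    if t: "t > 0" for t
  proof -
    have "((\<lambda>t. t / (\<mu> + t)) has_real_derivative \<mu> / (\<mu> + t)\<^sup>2) (at t)"
      using t \<mu> by (auto intro!: derivative_eq_intros simp: power2_eq_square divide_simps)
    from DERIV_chain2[OF dG this]
    have "((\<lambda>t. G (t / (\<mu> + t))) has_real_derivative h (t / (\<mu> + t)) * (\<mu> / (\<mu> + t)\<^sup>2)) (at t)"
      using t \<mu> by simp
    from DERIV_cmult[OF this, of "\<mu> powr \<theta>"]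
    have "((\<lambda>t. \<mu> powr \<theta> * G (t / (\<mu> + t))) has_real_derivative \<mu> powr \<theta> * (h (t / (\<mu> + t)) * (\<mu> / (\<mu> + t)\<^sup>2))) (at t)" .
    moreover have "\<mu> powr \<theta> * (h (t / (\<mu> + t)) * (\<mu> / (\<mu> + t)\<^sup>2)) = t powr (\<theta> - 1) * (\<mu> / (\<mu> + t))"
    proof -
      have 1: "1 - t / (\<mu> + t) = \<mu> / (\<mu> + t)" using t \<mu> by (simp add: field_simps)
      have 2: "(\<mu> + t) powr (\<theta> - 1) = (\<mu> + t) powr \<theta> / (\<mu> + t)" using t \<mu> by (simp add: powr_diff)
      have 3: "h (t / (\<mu> + t)) = t powr (\<theta> - 1) * (\<mu> + t) / \<mu> powr \<theta>"
        unfolding h_def 1 using t \<mu> by (simp add: powr_divide powr_minus 2 divide_simps)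
      show ?thesis unfolding 3 using t \<mu> by (simp add: divide_simps power2_eq_square)
    qed
    ultimately show ?thesis by simp
  qed
  have "integral {1 / N..N} (\<lambda>t. t powr (\<theta> - 1) * (\<mu> / (\<mu> + t))) =
      \<mu> powr \<theta> * G (N / (\<mu> + N)) - \<mu> powr \<theta> * G ((1 / N) / (\<mu> + 1 / N))" if N: "N \<ge> 1" for N
  proof -
    have "1 / N > 0" using N by simp
    then have pos: "t > 0" if "1 / N \<le> t" for t using that by linarith
    have le: "1 / N \<le> N" using N by (simp add: divide_le_eq) (metis mult_mono' mult_1 zero_le_one)
    show ?thesis
    proof (intro integral_unique fundamental_theorem_of_calculus le)
      fix t assume "t \<in> {1 / N..N}"
      then have "t > 0" using pos by simp
      from has_field_derivative_at_within[OF dH[OF this]]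
      show "((\<lambda>t. \<mu> powr \<theta> * G (t / (\<mu> + t))) has_vector_derivative t powr (\<theta> - 1) * (\<mu> / (\<mu> + t)))
          (at t within {1 / N..N})"
        by (simp add: has_real_derivative_iff_has_vector_derivative)
    qed
  qed
  then have ev: "\<forall>\<^sub>F N in at_top. \<mu> powr \<theta> * G (N / (\<mu> + N)) - \<mu> powr \<theta> * G ((1 / N) / (\<mu> + 1 / N)) =
      integral {1 / N..N} (\<lambda>t. t powr (\<theta> - 1) * (\<mu> / (\<mu> + t)))"
    by (intro eventually_mono[OF eventually_ge_at_top[of 1]]) (simp only:)
  have "((\<lambda>N. G (N / (\<mu> + N))) \<longlongrightarrow> G 1) at_top"
  proof (rule continuous_on_tendsto_compose[OF contG])
    show "((\<lambda>N. N / (\<mu> + N)) \<longlongrightarrow> 1) at_top" by real_asymp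
    show "\<forall>\<^sub>F N in at_top. N / (\<mu> + N) \<in> {0..1}"
      using eventually_gt_at_top[of 0] by eventually_elim (use \<mu> in auto)
  qed auto
  moreover have "((\<lambda>N. G ((1 / N) / (\<mu> + 1 / N))) \<longlongrightarrow> G 0) at_top"
  proof (rule continuous_on_tendsto_compose[OF contG])
    show "((\<lambda>N. (1 / N) / (\<mu> + 1 / N)) \<longlongrightarrow> 0) at_top" using \<mu> by real_asymp
    show "\<forall>\<^sub>F N in at_top. (1 / N) / (\<mu> + 1 / N) \<in> {0..1}"
      using eventually_gt_at_top[of 0]
    proof eventually_elim
      case (elim N)
      have N: "\<mu> + 1 / N > 0" "1 / N \<ge> 0" using elim \<mu> by (auto intro!: add_pos_pos)
      have "(1 / N) / (\<mu> + 1 / N) \<le> 1" unfolding divide_le_eq_1_pos[OF N(1)] using \<mu> by simp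
      moreover have "0 \<le> (1 / N) / (\<mu> + 1 / N)" by (rule divide_nonneg_pos[OF N(2) N(1)])
      ultimately show ?case by (simp only: atLeastAtMost_iff)
    qed
  qed auto
  ultimately have "((\<lambda>N. \<mu> powr \<theta> * G (N / (\<mu> + N)) - \<mu> powr \<theta> * G ((1 / N) / (\<mu> + 1 / N))) \<longlongrightarrow>
      \<mu> powr \<theta> * G 1 - \<mu> powr \<theta> * G 0) at_top"
    by (intro tendsto_intros)
  from Lim_transform_eventually[OF this ev] show ?thesis unfolding G0 G1 by simp
qed

lemma subspace_relcomp:
  fixes R :: "('a::real_vector \<times> 'b::real_vector) set" and S :: "('b \<times> 'c::real_vector) set"
  assumes R: "subspace R" and S: "subspace S"
  shows "subspace (R O S)"
proof (rule subspaceI)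
  show "0 \<in> R O S" using subspace_0[OF R] subspace_0[OF S] by (auto simp: zero_prod_def)
  fix p q assume "p \<in> R O S" "q \<in> R O S"
  then obtain x y z x' y' z' where *: "p = (x, z)" "(x, y) \<in> R" "(y, z) \<in> S"
    "q = (x', z')" "(x', y') \<in> R" "(y', z') \<in> S" by (auto elim!: relcompE)
  from subspace_add[OF R *(2,5)] subspace_add[OF S *(3,6)] show "p + q \<in> R O S"
    using *(1,4) by (auto intro: relcompI)
next
  fix c p assume "p \<in> R O S"
  then obtain x y z where *: "p = (x, z)" "(x, y) \<in> R" "(y, z) \<in> S" by (auto elim!: relcompE)
  from subspace_scale[OF R *(2), of c] subspace_scale[OF S *(3), of c] show "c *\<^sub>R p \<in> R O S"
    using *(1) by (auto intro: relcompI)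
qed

lemma subspace_closure:
  fixes S :: "'a::real_normed_vector set"
  assumes "subspace S"
  shows "subspace (closure S)"
proof (rule subspaceI)
  show "0 \<in> closure S" using subspace_0[OF assms] closure_subset by blast
  fix x y assume "x \<in> closure S" "y \<in> closure S"
  then obtain X Y where "\<And>n::nat. X n \<in> S" "X \<longlonglongrightarrow> x" "\<And>n::nat. Y n \<in> S" "Y \<longlonglongrightarrow> y"
    unfolding closure_sequential by blast
  then show "x + y \<in> closure S" unfolding closure_sequential
    using subspace_add[OF assms] tendsto_add by (intro exI[of _ "\<lambda>n. X n + Y n"]) blast
next
  fix c x assume "x \<in> closure S"
  then obtain X where "\<And>n::nat. X n \<in> S" "X \<longlonglongrightarrow> x" unfolding closure_sequential by blast
  then show "c *\<^sub>R x \<in> closure S" unfolding closure_sequential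
    using subspace_scale[OF assms] by (intro exI[of _ "\<lambda>n. c *\<^sub>R X n"]) (auto intro: tendsto_intros)
qed

lemma subspace_Id: "subspace (Id :: ('a::real_vector \<times> 'a) set)"
  by (auto simp: subspace_def zero_prod_def)

section \<open>Resolvents of a positive self-adjoint operator\<close>

context
  fixes A :: "('a::{real_inner,banach} \<times> 'a) set"
  assumes A: "positive_self_adjoint A"
begin

lemma psa_subspace: "subspace A" using A by (simp add: positive_self_adjoint_def)

lemma psa_single_valued: "(x, y) \<in> A \<Longrightarrow> (x, z) \<in> A \<Longrightarrow> y = z"
  using A by (auto simp: positive_self_adjoint_def single_valued_def)

lemma psa_dense: "closure (Domain A) = UNIV" using A by (simp add: positive_self_adjoint_def)

lemma psa_nonneg: "(x, y) \<in> A \<Longrightarrow> y \<bullet> x \<ge> 0"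
  using A by (auto simp: positive_self_adjoint_def)

text \<open>Self-adjointness as a weak test for membership in the graph. Symmetry, closedness and
  the surjectivity of A + t are all read off from it.\<close>

lemma psa_mem_iff: "(x, y) \<in> A \<longleftrightarrow> (\<forall>a b. (a, b) \<in> A \<longrightarrow> b \<bullet> x = a \<bullet> y)"
proof -
  have "op_adjoint A = A" using A by (simp add: positive_self_adjoint_def)
  then have "(x, y) \<in> A \<longleftrightarrow> (x, y) \<in> op_adjoint A" by simp
  then show ?thesis by (auto simp: op_adjoint_def)
qed

lemma psa_symmetric: "(x, a) \<in> A \<Longrightarrow> (z, b) \<in> A \<Longrightarrow> a \<bullet> z = x \<bullet> b"
  using psa_mem_iff[of z b] by blast

lemma psa_add: "(x, a) \<in> A \<Longrightarrow> (z, b) \<in> A \<Longrightarrow> (x + z, a + b) \<in> A"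
  using subspace_add[OF psa_subspace, of "(x, a)" "(z, b)"] by simp

lemma psa_scale: "(x, a) \<in> A \<Longrightarrow> (c *\<^sub>R x, c *\<^sub>R a) \<in> A"
  using subspace_scale[OF psa_subspace, of "(x, a)" c] by simp

lemma psa_diff: "(x, a) \<in> A \<Longrightarrow> (z, b) \<in> A \<Longrightarrow> (x - z, a - b) \<in> A"
  using subspace_diff[OF psa_subspace, of "(x, a)" "(z, b)"] by simp

lemma psa_closed: "X \<longlonglongrightarrow> x \<Longrightarrow> Y \<longlonglongrightarrow> y \<Longrightarrow> (\<And>n. (X n, Y n) \<in> A) \<Longrightarrow> (x, y) \<in> A"
proof -
  assume X: "X \<longlonglongrightarrow> x" "Y \<longlonglongrightarrow> y" "\<And>n. (X n, Y n) \<in> A"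
  have "b \<bullet> x = a \<bullet> y" if "(a, b) \<in> A" for a b
  proof (rule LIMSEQ_unique)
    show "(\<lambda>n. b \<bullet> X n) \<longlonglongrightarrow> b \<bullet> x" using X by (intro tendsto_intros)
    have "(\<lambda>n. a \<bullet> Y n) \<longlonglongrightarrow> a \<bullet> y" using X by (intro tendsto_intros)
    then show "(\<lambda>n. b \<bullet> X n) \<longlonglongrightarrow> a \<bullet> y" using psa_symmetric[OF that X(3)] by simp
  qed
  then show ?thesis using psa_mem_iff by blast
qed

text \<open>Pair with \<open>z\<close> and use positivity of A. The bound gives uniqueness of the
  resolvent, its norm estimate and the closed range of A + t.\<close>

lemma psa_shift_bound:
  assumes "(z, w - t *\<^sub>R z) \<in> A" "t > 0"
  shows "t * norm z \<le> norm w"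
proof -
  have "0 \<le> (w - t *\<^sub>R z) \<bullet> z" using psa_nonneg[OF assms(1)] .
  then have "t * (norm z)\<^sup>2 \<le> w \<bullet> z" by (simp add: inner_diff_left power2_norm_eq_inner)
  also have "\<dots> \<le> norm w * norm z" by (rule norm_cauchy_schwarz)
  finally show ?thesis by (cases "norm z = 0") (auto simp: power2_eq_square)
qed

text \<open>The range of A + t is a closed subspace, because the shift bound turns convergent images
  into Cauchy preimages. A nonzero vector orthogonal to it would, by self-adjointness, be an
  eigenvector with eigenvalue -t, against positivity.\<close>

lemma psa_shift_surj:
  assumes t: "t > 0"
  shows "\<exists>z. (z, w - t *\<^sub>R z) \<in> A"
proof -
  define S where "S = {w. \<exists>z. (z, w - t *\<^sub>R z) \<in> A}"
  have "subspace S"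
  proof (rule subspaceI)
    show "0 \<in> S" using subspace_0[OF psa_subspace] by (auto simp: S_def intro: exI[of _ 0] simp flip: zero_prod_def)
  next
    fix x y assume "x \<in> S" "y \<in> S"
    then obtain z z' where "(z, x - t *\<^sub>R z) \<in> A" "(z', y - t *\<^sub>R z') \<in> A" by (auto simp: S_def)
    from psa_add[OF this] show "x + y \<in> S"
      by (auto simp: S_def algebra_simps intro!: exI[of _ "z + z'"])
  next
    fix c x assume "x \<in> S"
    then obtain z where "(z, x - t *\<^sub>R z) \<in> A" by (auto simp: S_def)
    from psa_scale[OF this, of c] show "c *\<^sub>R x \<in> S"
      by (auto simp: S_def algebra_simps intro!: exI[of _ "c *\<^sub>R z"])
  qed
  moreover have "closed S"
  proof (unfold closed_sequential_limits, intro allI impI, elim conjE)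
    fix W w assume W: "\<forall>n. W n \<in> S" "W \<longlonglongrightarrow> w"
    then obtain Z where Z: "\<And>n. (Z n, W n - t *\<^sub>R Z n) \<in> A" by (auto simp: S_def) metis
    have bd: "t * norm (Z i - Z j) \<le> norm (W i - W j)" for i j
      using psa_shift_bound[of "Z i - Z j" "W i - W j" t] psa_diff[OF Z[of i] Z[of j]] t
      by (simp add: algebra_simps)
    have "Cauchy Z"
    proof (rule metric_CauchyI)
      fix \<epsilon> :: real assume "0 < \<epsilon>"
      then obtain M where M: "\<And>i j. i \<ge> M \<Longrightarrow> j \<ge> M \<Longrightarrow> dist (W i) (W j) < t * \<epsilon>"
        using LIMSEQ_imp_Cauchy[OF W(2)] t unfolding Cauchy_def by (metis mult_pos_pos)
      have "dist (Z i) (Z j) < \<epsilon>" if "i \<ge> M" "j \<ge> M" for i j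
        using order.strict_trans1[OF bd M[OF that, unfolded dist_norm]] t
        by (simp add: dist_norm)
      then show "\<exists>M. \<forall>i\<ge>M. \<forall>j\<ge>M. dist (Z i) (Z j) < \<epsilon>" by blast
    qed
    then obtain z where z: "Z \<longlonglongrightarrow> z" using Cauchy_convergent convergent_def by blast
    have "(z, w - t *\<^sub>R z) \<in> A"
      by (rule psa_closed[OF z _ Z]) (use W z in \<open>intro tendsto_intros\<close>)
    then show "w \<in> S" by (auto simp: S_def)
  qed
  moreover have False if orth: "z \<noteq> 0" "\<And>x. x \<in> S \<Longrightarrow> z \<bullet> x = 0" for z
  proof -
    have "b \<bullet> z = a \<bullet> (- t *\<^sub>R z)" if "(a, b) \<in> A" for a b
    proof -
      have "b + t *\<^sub>R a \<in> S" using that by (auto simp: S_def intro!: exI[of _ a])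
      from orth(2)[OF this] show ?thesis by (simp add: inner_add_right inner_commute)
    qed
    then have "(z, - t *\<^sub>R z) \<in> A" using psa_mem_iff by blast
    from psa_nonneg[OF this] have "z \<bullet> z \<le> 0" using t by (simp add: mult_le_0_iff)
    then show False using orth(1) by (metis inner_gt_zero_iff not_le)
  qed
  ultimately have "S = UNIV" using closed_subspace_orthogonal_vector[of S] by metis
  then show ?thesis by (auto simp: S_def)
qed

lemma resolvent_eqI: "t > 0 \<Longrightarrow> (z, w - t *\<^sub>R z) \<in> A \<Longrightarrow> resolvent A t w = z"
  unfolding resolvent_def
proof (rule the_equality)
  fix z' assume t: "t > 0" and z: "(z, w - t *\<^sub>R z) \<in> A" and z': "(z', w - t *\<^sub>R z') \<in> A"
  have "(z - z', 0 - t *\<^sub>R (z - z')) \<in> A" using psa_diff[OF z z'] by (simp add: algebra_simps)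
  from psa_shift_bound[OF this t] t show "z' = z" by (simp add: mult_le_0_iff)
qed

lemma resolvent_mem: "t > 0 \<Longrightarrow> (resolvent A t w, w - t *\<^sub>R resolvent A t w) \<in> A"
  using psa_shift_surj resolvent_eqI by metis

lemma resolvent_norm: "t > 0 \<Longrightarrow> norm (resolvent A t w) \<le> norm w / t"
  using psa_shift_bound[OF resolvent_mem] by (simp add: field_simps)

lemma resolvent_add: "t > 0 \<Longrightarrow> resolvent A t (w + w') = resolvent A t w + resolvent A t w'"
  using psa_add[OF resolvent_mem resolvent_mem, of t t w w']
  by (intro resolvent_eqI) (auto simp: algebra_simps)

lemma resolvent_scale: "t > 0 \<Longrightarrow> resolvent A t (c *\<^sub>R w) = c *\<^sub>R resolvent A t w"
  using psa_scale[OF resolvent_mem, of t c w]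
  by (intro resolvent_eqI) (auto simp: algebra_simps)

text \<open>Write A = (A + t) - t. This form stays bounded as t tends to 0, where the bound by
  \<open>norm a / t\<close> degenerates.\<close>

lemma resolvent_apply: "t > 0 \<Longrightarrow> (x, a) \<in> A \<Longrightarrow> resolvent A t a = x - t *\<^sub>R resolvent A t x"
  using psa_diff[OF _ psa_scale[OF resolvent_mem], of x a t t x]
  by (intro resolvent_eqI) (auto simp: algebra_simps)

text \<open>Symmetry of A, applied to the resolvents of \<open>a\<close> and \<open>b\<close> as
  well as to \<open>x\<close> and \<open>z\<close>. It moves the Balakrishnan integral from a
  varying vector onto a fixed one.\<close>

lemma resolvent_symmetric:
  assumes "t > 0" "(x, a) \<in> A" "(z, b) \<in> A"
  shows "resolvent A t a \<bullet> z = x \<bullet> resolvent A t b"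
proof -
  have "(a - t *\<^sub>R resolvent A t a) \<bullet> z = resolvent A t a \<bullet> b"
    using psa_symmetric[OF resolvent_mem assms(3)] assms(1) by blast
  moreover have "(b - t *\<^sub>R resolvent A t b) \<bullet> resolvent A t a = resolvent A t b \<bullet> (a - t *\<^sub>R resolvent A t a)"
    using psa_symmetric[OF resolvent_mem resolvent_mem] assms(1) by blast
  moreover have "(b - t *\<^sub>R resolvent A t b) \<bullet> x = resolvent A t b \<bullet> a"
    using psa_symmetric[OF resolvent_mem assms(2)] assms(1) by blast
  moreover have "a \<bullet> z = x \<bullet> b" using psa_symmetric assms by blast
  ultimately have "t * (resolvent A t a \<bullet> z) = t * (x \<bullet> resolvent A t b)"
    by (simp only: inner_diff_left inner_diff_right inner_commute[of z] inner_commute[of "resolvent A t b"]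
        inner_commute[of b] inner_scaleR_left inner_scaleR_right)
  then show ?thesis using assms(1) by simp
qed

text \<open>Continuity comes from the first resolvent identity together with the norm bound; it
  makes the truncated integrals exist.\<close>

lemma resolvent_continuous: "continuous_on {0<..} (\<lambda>t. resolvent A t w)"
proof (intro continuous_at_imp_continuous_on ballI)
  fix t :: real assume "t \<in> {0<..}"
  then have t: "t > 0" by simp
  have id: "resolvent A s w - resolvent A t w = (t - s) *\<^sub>R resolvent A s (resolvent A t w)"
    if s: "s > 0" for s
  proof -
    have "(resolvent A s w - resolvent A t w,
        (t - s) *\<^sub>R resolvent A t w - s *\<^sub>R (resolvent A s w - resolvent A t w)) \<in> A"
      using psa_diff[OF resolvent_mem[OF s, of w] resolvent_mem[OF t, of w]] by (simp add: algebra_simps)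
    from resolvent_eqI[OF s this] show ?thesis using s by (simp add: resolvent_scale)
  qed
  have "((\<lambda>s. resolvent A s w - resolvent A t w) \<longlongrightarrow> 0) (at t)"
  proof (rule Lim_null_comparison)
    show "((\<lambda>s. \<bar>t - s\<bar> * (norm (resolvent A t w) / s)) \<longlongrightarrow> 0) (at t)"
      using t by (auto intro!: tendsto_eq_intros)
    have "\<forall>\<^sub>F s in at t. s > 0" by (rule order_tendstoD(1)[OF tendsto_ident_at t])
    then show "\<forall>\<^sub>F s in at t. norm (resolvent A s w - resolvent A t w) \<le> \<bar>t - s\<bar> * (norm (resolvent A t w) / s)"
    proof eventually_elim
      case (elim s)
      show ?case using mult_left_mono[OF resolvent_norm[OF elim, of "resolvent A t w"], of "\<bar>t - s\<bar>"]
        by (simp add: id[OF elim])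
    qed
  qed
  then show "isCont (\<lambda>t. resolvent A t w) t" by (simp add: isCont_def LIM_zero_iff)
qed

lemma resolvent_integrable:
  assumes "0 < a"
  shows "(\<lambda>t. t powr p *\<^sub>R resolvent A t w) integrable_on {a..b}"
  using assms by (intro integrable_continuous_real continuous_intros
      continuous_on_subset[OF resolvent_continuous]) auto

text \<open>Split at t = 1. Below, the resolvent of \<open>b\<close> = A z is at most 2 |z| by
  \<open>resolvent_apply\<close>; above, it is at most |b| / t. Both weights are integrable, so the
  bound is uniform in \<open>N\<close>, which is what closability needs.\<close>

lemma truncated_integral_bound:
  assumes \<theta>: "0 < \<theta>" "\<theta> < 1" and zb: "(z, b) \<in> A" and N: "N \<ge> 1"
  shows "norm (integral {1 / N..N} (\<lambda>t. t powr (\<theta> - 1) *\<^sub>R resolvent A t b))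
      \<le> 2 * norm z / \<theta> + norm b / (1 - \<theta>)"
proof -
  let ?f = "\<lambda>t. t powr (\<theta> - 1) *\<^sub>R resolvent A t b"
  have N1: "0 < 1 / N" "1 / N \<le> 1" using N by auto
  have pos: "t > 0" if "1 / N \<le> t" for t using that N1(1) by linarith
  have "((\<lambda>t. t powr (\<theta> - 1) * (2 * norm z)) has_integral
      (1 powr \<theta> / \<theta> * (2 * norm z) - (1/N) powr \<theta> / \<theta> * (2 * norm z))) {1/N..1}"
    using \<theta> N1 pos by (intro fundamental_theorem_of_calculus)
      (auto intro!: derivative_eq_intros simp flip: has_real_derivative_iff_has_vector_derivative)
  note I1 = this
  have "norm (integral {1/N..1} ?f) \<le> integral {1/N..1} (\<lambda>t. t powr (\<theta> - 1) * (2 * norm z))"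
  proof (rule integral_norm_bound_integral)
    show "?f integrable_on {1/N..1}" using resolvent_integrable N1 by blast
    show "(\<lambda>t. t powr (\<theta> - 1) * (2 * norm z)) integrable_on {1/N..1}" using I1 by blast
    fix t assume "t \<in> {1/N..1}"
    then have t: "t > 0" using pos by auto
    have "norm (resolvent A t b) \<le> norm z + t * norm (resolvent A t z)"
      using norm_triangle_ineq4[of z "t *\<^sub>R resolvent A t z"] t by (simp add: resolvent_apply[OF t zb])
    also have "\<dots> \<le> 2 * norm z" using resolvent_norm[OF t, of z] t by (simp add: field_simps)
    finally show "norm (?f t) \<le> t powr (\<theta> - 1) * (2 * norm z)" by (simp add: mult_left_mono)
  qed
  also have "\<dots> = 1 powr \<theta> / \<theta> * (2 * norm z) - (1/N) powr \<theta> / \<theta> * (2 * norm z)"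
    using I1 by (rule integral_unique)
  also have "\<dots> \<le> 2 * norm z / \<theta>" using \<theta> by simp
  finally have 1: "norm (integral {1/N..1} ?f) \<le> 2 * norm z / \<theta>" .
  have "((\<lambda>t. t powr (\<theta> - 2) * norm b) has_integral
      (N powr (\<theta> - 1) / (\<theta> - 1) * norm b - 1 powr (\<theta> - 1) / (\<theta> - 1) * norm b)) {1..N}"
    using \<theta> N by (intro fundamental_theorem_of_calculus)
      (auto intro!: derivative_eq_intros simp flip: has_real_derivative_iff_has_vector_derivative)
  note I2 = this
  have "norm (integral {1..N} ?f) \<le> integral {1..N} (\<lambda>t. t powr (\<theta> - 2) * norm b)"
  proof (rule integral_norm_bound_integral)
    show "?f integrable_on {1..N}" using resolvent_integrable by auto
    show "(\<lambda>t. t powr (\<theta> - 2) * norm b) integrable_on {1..N}" using I2 by blast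
    fix t assume "t \<in> {1..N}"
    then have t: "t > 0" by auto
    have "norm (?f t) \<le> t powr (\<theta> - 1) * (norm b / t)"
      using mult_left_mono[OF resolvent_norm[OF t, of b], of "t powr (\<theta> - 1)"] by simp
    also have "\<dots> = t powr (\<theta> - 2) * norm b"
      using t powr_mult_base[of t "\<theta> - 2"] by (simp add: field_simps)
    finally show "norm (?f t) \<le> t powr (\<theta> - 2) * norm b" .
  qed
  also have "\<dots> = N powr (\<theta> - 1) / (\<theta> - 1) * norm b - 1 powr (\<theta> - 1) / (\<theta> - 1) * norm b"
    using I2 by (rule integral_unique)
  also have "\<dots> = (1 - N powr (\<theta> - 1)) * norm b / (1 - \<theta>)"
    using \<theta> by (simp add: divide_simps) (simp add: algebra_simps)
  also have "\<dots> \<le> norm b / (1 - \<theta>)"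
  proof (intro divide_right_mono mult_left_le_one_le)
    show "0 \<le> 1 - N powr (\<theta> - 1)" using powr_mono[of "\<theta> - 1" 0 N] \<theta> N by simp
  qed (use \<theta> in auto)
  finally have 2: "norm (integral {1..N} ?f) \<le> norm b / (1 - \<theta>)" .
  have "integral {1/N..N} ?f = integral {1/N..1} ?f + integral {1..N} ?f"
    by (rule Henstock_Kurzweil_Integration.integral_combine[symmetric]) (intro resolvent_integrable N1 N)+
  then show ?thesis using norm_triangle_ineq[of "integral {1/N..1} ?f" "integral {1..N} ?f"] 1 2
    by (simp only: order.trans[OF _ add_mono[OF 1 2]])
qed

section \<open>Balakrishnan powers: closability and action on eigenvectors\<close>

definition pre_frac :: "real \<Rightarrow> ('a \<times> 'a) set" where
  "pre_frac \<theta> = {(x, y). \<exists>w. (x, w) \<in> A \<and>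
     ((\<lambda>N. (sin (pi * \<theta>) / pi) *\<^sub>R
            integral {1 / N..N} (\<lambda>t. t powr (\<theta> - 1) *\<^sub>R resolvent A t w)) \<longlongrightarrow> y) at_top}"

lemma op_frac_power_closure: "op_frac_power A \<theta> = closure (pre_frac \<theta>)"
  by (simp add: op_frac_power_def pre_frac_def)

lemma subspace_pre_frac: "subspace (pre_frac \<theta>)"
proof (rule subspaceI)
  let ?I = "\<lambda>w N. integral {1 / N..N} (\<lambda>t. t powr (\<theta> - 1) *\<^sub>R resolvent A t w)"
  let ?c = "sin (pi * \<theta>) / pi"
  have ev: "\<forall>\<^sub>F N in at_top. (N::real) > 0" by (rule eventually_gt_at_top)
  have scale: "?I (c *\<^sub>R w) N = c *\<^sub>R ?I w N" if "N > 0" for c w N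
  proof -
    have "?I (c *\<^sub>R w) N = integral {1 / N..N} (\<lambda>t. c *\<^sub>R (t powr (\<theta> - 1) *\<^sub>R resolvent A t w))"
    proof (rule integral_cong)
      fix t assume "t \<in> {1 / N..N}"
      moreover have "1 / N > 0" using that by simp
      ultimately have "t > 0" by (simp only: atLeastAtMost_iff) linarith
      then show "t powr (\<theta> - 1) *\<^sub>R resolvent A t (c *\<^sub>R w) = c *\<^sub>R (t powr (\<theta> - 1) *\<^sub>R resolvent A t w)"
        by (simp add: resolvent_scale)
    qed
    also have "\<dots> = c *\<^sub>R ?I w N" by (rule integral_cmul)
    finally show ?thesis .
  qed
  have add: "?I (w + w') N = ?I w N + ?I w' N" if "N > 0" for w w' N
  proof -
    have "?I (w + w') N = integral {1 / N..N} (\<lambda>t. t powr (\<theta> - 1) *\<^sub>R resolvent A t w + t powr (\<theta> - 1) *\<^sub>R resolvent A t w')"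
    proof (rule integral_cong)
      fix t assume "t \<in> {1 / N..N}"
      moreover have "1 / N > 0" using that by simp
      ultimately have "t > 0" by (simp only: atLeastAtMost_iff) linarith
      then show "t powr (\<theta> - 1) *\<^sub>R resolvent A t (w + w') =
          t powr (\<theta> - 1) *\<^sub>R resolvent A t w + t powr (\<theta> - 1) *\<^sub>R resolvent A t w'"
        by (simp add: resolvent_add scaleR_add_right)
    qed
    then show ?thesis using that by (simp add: integral_add resolvent_integrable)
  qed
  have sc: "c *\<^sub>R p \<in> pre_frac \<theta>" if p: "p \<in> pre_frac \<theta>" for c p
  proof -
    obtain x y w where w: "p = (x, y)" "(x, w) \<in> A" "((\<lambda>N. ?c *\<^sub>R ?I w N) \<longlongrightarrow> y) at_top"
      using p by (auto simp: pre_frac_def)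
    have "((\<lambda>N. ?c *\<^sub>R ?I (c *\<^sub>R w) N) \<longlongrightarrow> c *\<^sub>R y) at_top"
    proof (rule Lim_transform_eventually)
      show "((\<lambda>N. c *\<^sub>R (?c *\<^sub>R ?I w N)) \<longlongrightarrow> c *\<^sub>R y) at_top" by (intro tendsto_intros w)
      show "\<forall>\<^sub>F N in at_top. c *\<^sub>R (?c *\<^sub>R ?I w N) = ?c *\<^sub>R ?I (c *\<^sub>R w) N"
        using ev by eventually_elim (subst scale, auto)
    qed
    then show ?thesis using w psa_scale by (auto simp: pre_frac_def)
  qed
  show "c *\<^sub>R p \<in> pre_frac \<theta>" if "p \<in> pre_frac \<theta>" for c p using sc that .
  show "p + q \<in> pre_frac \<theta>" if p: "p \<in> pre_frac \<theta>" and q: "q \<in> pre_frac \<theta>" for p q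
  proof -
    obtain x y w where w: "p = (x, y)" "(x, w) \<in> A" "((\<lambda>N. ?c *\<^sub>R ?I w N) \<longlongrightarrow> y) at_top"
      using p by (auto simp: pre_frac_def)
    obtain x' y' w' where w': "q = (x', y')" "(x', w') \<in> A" "((\<lambda>N. ?c *\<^sub>R ?I w' N) \<longlongrightarrow> y') at_top"
      using q by (auto simp: pre_frac_def)
    have "((\<lambda>N. ?c *\<^sub>R ?I (w + w') N) \<longlongrightarrow> y + y') at_top"
    proof (rule Lim_transform_eventually)
      show "((\<lambda>N. ?c *\<^sub>R ?I w N + ?c *\<^sub>R ?I w' N) \<longlongrightarrow> y + y') at_top" by (intro tendsto_intros w w')
      show "\<forall>\<^sub>F N in at_top. ?c *\<^sub>R ?I w N + ?c *\<^sub>R ?I w' N = ?c *\<^sub>R ?I (w + w') N"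
        using ev by eventually_elim (subst add, auto simp: scaleR_add_right)
    qed
    then show ?thesis using w(1) w'(1) psa_add[OF w(2) w'(2)] by (auto simp: pre_frac_def)
  qed
  have "(0, 0) \<in> A" using subspace_0[OF psa_subspace] by (simp add: zero_prod_def)
  moreover have "((\<lambda>N. ?c *\<^sub>R ?I 0 N) \<longlongrightarrow> 0) at_top"
  proof (rule Lim_transform_eventually)
    show "\<forall>\<^sub>F N in at_top. 0 = ?c *\<^sub>R ?I 0 N" using ev
      by eventually_elim (use scale[of _ 0 0] in simp)
  qed simp
  ultimately show "0 \<in> pre_frac \<theta>" by (auto simp: pre_frac_def zero_prod_def)
qed

text \<open>For fixed \<open>z\<close> in the domain, symmetry shifts the truncated integrals from
  the approximating vectors \<open>X n\<close> to \<open>z\<close>. Uniformly in \<open>N\<close>,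
  the pairing with \<open>z\<close> is then at most a constant times |X n|, which tends to 0. So
  \<open>y\<close> is orthogonal to a dense set.\<close>

lemma frac_power_closable:
  assumes \<theta>: "0 < \<theta>" "\<theta> < 1" and y: "(0, y) \<in> closure (pre_frac \<theta>)"
  shows "y = 0"
proof -
  let ?I = "\<lambda>w N. integral {1 / N..N} (\<lambda>t. t powr (\<theta> - 1) *\<^sub>R resolvent A t w)"
  let ?c = "sin (pi * \<theta>) / pi"
  obtain P where P: "\<And>n::nat. P n \<in> pre_frac \<theta>" "P \<longlonglongrightarrow> (0, y)"
    using y by (auto simp: closure_sequential)
  define X Y where "X = (\<lambda>n. fst (P n))" and "Y = (\<lambda>n. snd (P n))"
  have X: "X \<longlonglongrightarrow> 0" using tendsto_fst[OF P(2)] by (simp add: X_def)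
  have Y: "Y \<longlonglongrightarrow> y" using tendsto_snd[OF P(2)] by (simp add: Y_def)
  have orth: "y \<bullet> z = 0" if z: "z \<in> Domain A" for z
  proof -
    obtain b where zb: "(z, b) \<in> A" using z by auto
    define C where "C = \<bar>?c\<bar> * (2 * norm z / \<theta> + norm b / (1 - \<theta>))"
    have "norm (Y n \<bullet> z) \<le> norm (X n) * C" for n
    proof -
      obtain w where w: "(X n, w) \<in> A" "((\<lambda>N. ?c *\<^sub>R ?I w N) \<longlongrightarrow> Y n) at_top"
        using P(1)[of n] by (auto simp: pre_frac_def X_def Y_def)
      have "norm ((?c *\<^sub>R ?I w N) \<bullet> z) \<le> norm (X n) * C" if N: "N \<ge> 1" for N
      proof -
        have pos: "t > 0" if "t \<in> {1 / N..N}" for t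
        proof -
          have "1 / N > 0" using N by simp
          then show ?thesis using that by (simp only: atLeastAtMost_iff) linarith
        qed
        have int: "(\<lambda>t. t powr (\<theta> - 1) *\<^sub>R resolvent A t w) integrable_on {1 / N..N}" for w
          using N by (intro resolvent_integrable) simp
        have "?I w N \<bullet> z = integral {1 / N..N} (\<lambda>t. (t powr (\<theta> - 1) *\<^sub>R resolvent A t w) \<bullet> z)"
          using integral_linear[OF int bounded_linear_inner_left] by (simp add: o_def)
        also have "\<dots> = integral {1 / N..N} (\<lambda>t. X n \<bullet> (t powr (\<theta> - 1) *\<^sub>R resolvent A t b))"
          by (intro integral_cong) (use resolvent_symmetric[OF pos w(1) zb] in simp)
        also have "\<dots> = X n \<bullet> ?I b N"
          using integral_linear[OF int bounded_linear_inner_right] by (simp add: o_def)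
        finally have eq: "(?c *\<^sub>R ?I w N) \<bullet> z = ?c * (X n \<bullet> ?I b N)" by simp
        have "\<bar>X n \<bullet> ?I b N\<bar> \<le> norm (X n) * (2 * norm z / \<theta> + norm b / (1 - \<theta>))"
          by (rule order.trans[OF Cauchy_Schwarz_ineq2 mult_left_mono[OF truncated_integral_bound[OF \<theta> zb N]]]) simp
        then have "\<bar>?c\<bar> * \<bar>X n \<bullet> ?I b N\<bar> \<le> \<bar>?c\<bar> * (norm (X n) * (2 * norm z / \<theta> + norm b / (1 - \<theta>)))"
          by (rule mult_left_mono) simp
        then show ?thesis unfolding eq C_def by (simp add: abs_mult mult_ac)
      qed
      then have "\<forall>\<^sub>F N in at_top. norm ((?c *\<^sub>R ?I w N) \<bullet> z) \<le> norm (X n) * C"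
        by (intro eventually_mono[OF eventually_ge_at_top[of 1]]) (simp only:)
      moreover have "((\<lambda>N. norm ((?c *\<^sub>R ?I w N) \<bullet> z)) \<longlongrightarrow> norm (Y n \<bullet> z)) at_top"
        by (intro tendsto_intros w)
      ultimately show ?thesis using tendsto_upperbound trivial_limit_at_top_linorder by blast
    qed
    then have "(\<lambda>n. Y n \<bullet> z) \<longlonglongrightarrow> 0"
    proof (rule Lim_null_comparison[OF always_eventually[OF allI]])
      show "(\<lambda>n. norm (X n) * C) \<longlonglongrightarrow> 0"
        using tendsto_mult[OF tendsto_norm[OF X] tendsto_const[of C]] by simp
    qed
    moreover have "(\<lambda>n. Y n \<bullet> z) \<longlonglongrightarrow> y \<bullet> z" by (intro tendsto_intros Y)
    ultimately show ?thesis using LIMSEQ_unique by blast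
  qed
  have "y \<in> closure (Domain A)" using psa_dense by simp
  then obtain Z where Z: "\<And>n::nat. Z n \<in> Domain A" "Z \<longlonglongrightarrow> y" by (auto simp: closure_sequential)
  have "(\<lambda>n. y \<bullet> Z n) \<longlonglongrightarrow> y \<bullet> y" by (intro tendsto_intros Z)
  then have "y \<bullet> y = 0" using orth[OF Z(1)] by (simp add: LIMSEQ_const_iff)
  then show ?thesis by simp
qed

lemma resolvent_eigenvector:
  assumes "(x, \<mu> *\<^sub>R x) \<in> A" "\<mu> > 0" "t > 0"
  shows "resolvent A t (\<mu> *\<^sub>R x) = (\<mu> / (\<mu> + t)) *\<^sub>R x"
proof (rule resolvent_eqI[OF assms(3)])
  have "\<mu> - t * (\<mu> / (\<mu> + t)) = \<mu> / (\<mu> + t) * \<mu>" using assms by (simp add: field_simps)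
  then have "\<mu> *\<^sub>R x - t *\<^sub>R ((\<mu> / (\<mu> + t)) *\<^sub>R x) = (\<mu> / (\<mu> + t)) *\<^sub>R (\<mu> *\<^sub>R x)"
    by (metis scaleR_left_diff_distrib scaleR_scaleR)
  then show "((\<mu> / (\<mu> + t)) *\<^sub>R x, \<mu> *\<^sub>R x - t *\<^sub>R ((\<mu> / (\<mu> + t)) *\<^sub>R x)) \<in> A"
    using psa_scale[OF assms(1), of "\<mu> / (\<mu> + t)"] by (simp only:)
qed

text \<open>On an eigenvector the resolvent is multiplication by \<mu> / (\<mu> + t), so the vector
  integral is the scalar Balakrishnan integral times \<open>x\<close>, and the sine factors
  cancel.\<close>

lemma frac_power_eigenvector:
  assumes x: "(x, \<mu> *\<^sub>R x) \<in> A" and \<mu>: "\<mu> > 0" and \<theta>: "0 < \<theta>" "\<theta> < 1"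
  shows "(x, (\<mu> powr \<theta>) *\<^sub>R x) \<in> op_frac_power A \<theta>"
proof -
  let ?c = "sin (pi * \<theta>) / pi"
  let ?I = "\<lambda>N. integral {1 / N..N} (\<lambda>t. t powr (\<theta> - 1) *\<^sub>R resolvent A t (\<mu> *\<^sub>R x))"
  let ?J = "\<lambda>N. integral {1 / N..N} (\<lambda>t. t powr (\<theta> - 1) * (\<mu> / (\<mu> + t)))"
  have "?I N = ?J N *\<^sub>R x" if N: "N > 0" for N
  proof -
    have pos: "t > 0" if "t \<in> {1 / N..N}" for t
    proof -
      have "1 / N > 0" using N by simp
      then show ?thesis using that by (simp only: atLeastAtMost_iff) linarith
    qed
    have "(\<lambda>t. t powr (\<theta> - 1) * (\<mu> / (\<mu> + t))) integrable_on {1 / N..N}"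
      using pos \<mu> by (intro integrable_continuous_real continuous_intros) (auto dest!: pos)
    then have "?J N *\<^sub>R x = integral {1 / N..N} (\<lambda>t. (t powr (\<theta> - 1) * (\<mu> / (\<mu> + t))) *\<^sub>R x)"
      using integral_linear[OF _ bounded_linear_scaleR_left[of x], symmetric] by (simp only: o_def)
    also have "\<dots> = ?I N"
      by (intro integral_cong) (simp add: resolvent_eigenvector[OF x \<mu> pos])
    finally show ?thesis by simp
  qed
  then have ev: "\<forall>\<^sub>F N in at_top. ?c *\<^sub>R (?J N *\<^sub>R x) = ?c *\<^sub>R ?I N"
    by (intro eventually_mono[OF eventually_gt_at_top[of 0]]) (simp only:)
  have "((\<lambda>N. ?c *\<^sub>R (?J N *\<^sub>R x)) \<longlongrightarrow> ?c *\<^sub>R ((\<mu> powr \<theta> * (pi / sin (pi * \<theta>))) *\<^sub>R x)) at_top"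
    by (intro tendsto_intros balakrishnan_integral \<mu> \<theta>)
  moreover have "sin (pi * \<theta>) > 0" using \<theta> by (intro sin_gt_zero) auto
  ultimately have "((\<lambda>N. ?c *\<^sub>R (?J N *\<^sub>R x)) \<longlongrightarrow> (\<mu> powr \<theta>) *\<^sub>R x) at_top" by simp
  then have "((\<lambda>N. ?c *\<^sub>R ?I N) \<longlongrightarrow> (\<mu> powr \<theta>) *\<^sub>R x) at_top" by (rule Lim_transform_eventually[OF _ ev])
  then have "(x, (\<mu> powr \<theta>) *\<^sub>R x) \<in> pre_frac \<theta>" using x by (auto simp: pre_frac_def)
  then show ?thesis using closure_subset op_frac_power_closure by blast
qed

lemma subspace_op_frac_power: "subspace (op_frac_power A \<theta>)"
  unfolding op_frac_power_closure using subspace_pre_frac by (rule subspace_closure)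

lemma single_valued_op_frac_power:
  assumes "0 < \<theta>" "\<theta> < 1" "(x, y) \<in> op_frac_power A \<theta>" "(x, z) \<in> op_frac_power A \<theta>"
  shows "y = z"
  using frac_power_closable[OF assms(1,2), of "y - z"]
    subspace_diff[OF subspace_op_frac_power assms(3,4)] by (simp add: op_frac_power_closure)

lemma subspace_relpow: "subspace (A ^^ n)"
  by (induction n) (auto intro: subspace_relcomp subspace_Id psa_subspace)

lemma subspace_op_power: "subspace (op_power A \<alpha>)"
  unfolding op_power_def
  by (auto intro!: subspace_relcomp subspace_Id subspace_op_frac_power subspace_relpow simp del: Id_O_R)

text \<open>\<open>op_app\<close> is a definite description, so this is what lets a known pair of
  the graph determine its value.\<close>

lemma single_valued_op_power: "(x, y) \<in> op_power A \<alpha> \<Longrightarrow> (x, z) \<in> op_power A \<alpha> \<Longrightarrow> y = z"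
proof -
  have sv: "single_valued (A ^^ n)" for n
    by (induction n) (auto intro!: single_valued_relcomp simp: single_valued_def dest: psa_single_valued)
  have "single_valued (op_frac_power A (frac \<alpha>))" if "frac \<alpha> \<noteq> 0"
    using single_valued_op_frac_power[of "frac \<alpha>"] that frac_ge_0[of \<alpha>] frac_lt_1[of \<alpha>]
    by (auto simp: single_valued_def)
  then have "single_valued (op_power A \<alpha>)"
    unfolding op_power_def by (intro single_valued_relcomp sv) auto
  then show "(x, y) \<in> op_power A \<alpha> \<Longrightarrow> (x, z) \<in> op_power A \<alpha> \<Longrightarrow> y = z"
    by (auto simp: single_valued_def)
qed

text \<open>Integer and fractional part of the exponent act one after the other. For an integer
  \<alpha> the fractional factor is \<open>Id\<close>, in agreement with \<mu> powr 0 = 1.\<close>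

lemma op_power_eigenvector:
  assumes x: "(x, \<mu> *\<^sub>R x) \<in> A" and \<mu>: "\<mu> > 0" and \<alpha>: "\<alpha> \<ge> 0"
  shows "(x, (\<mu> powr \<alpha>) *\<^sub>R x) \<in> op_power A \<alpha>"
proof -
  define n where "n = nat \<lfloor>\<alpha>\<rfloor>"
  have pow: "(c *\<^sub>R x, (\<mu> ^ n * c) *\<^sub>R x) \<in> A ^^ n" for c n
  proof (induction n)
    case (Suc n)
    have "((\<mu> ^ n * c) *\<^sub>R x, (\<mu> ^ n * c) *\<^sub>R (\<mu> *\<^sub>R x)) \<in> A" by (rule psa_scale[OF x])
    then show ?case using Suc by (auto simp: mult_ac intro!: relcompI)
  qed simp
  have "\<alpha> = frac \<alpha> + real n" using \<alpha> by (simp add: n_def frac_def)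
  then have eq: "\<mu> powr \<alpha> = \<mu> ^ n * \<mu> powr frac \<alpha>"
    using \<mu> by (metis powr_add powr_realpow mult.commute)
  have "(x, (\<mu> powr frac \<alpha>) *\<^sub>R x) \<in> (if frac \<alpha> = 0 then Id else op_frac_power A (frac \<alpha>))"
  proof (cases "frac \<alpha> = 0")
    case False
    then have "0 < frac \<alpha>" using frac_ge_0[of \<alpha>] by linarith
    then show ?thesis using frac_power_eigenvector[OF x \<mu> _ frac_lt_1] False by simp
  qed (use \<mu> in \<open>simp del: frac_eq_0_iff\<close>)
  then show ?thesis unfolding op_power_def eq n_def[symmetric] using pow by (rule relcompI)
qed

lemma op_power_eigenvector_sum:
  assumes "finite I" "\<And>k. k \<in> I \<Longrightarrow> (e k, \<mu> k *\<^sub>R e k) \<in> A" "\<And>k. k \<in> I \<Longrightarrow> \<mu> k > 0" "\<alpha> \<ge> 0"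
  shows "(\<Sum>k\<in>I. c k *\<^sub>R e k, \<Sum>k\<in>I. (c k * \<mu> k powr \<alpha>) *\<^sub>R e k) \<in> op_power A \<alpha>"
proof -
  have "(\<Sum>k\<in>I. c k *\<^sub>R (e k, (\<mu> k powr \<alpha>) *\<^sub>R e k)) \<in> op_power A \<alpha>"
    using assms by (intro subspace_sum subspace_scale subspace_op_power op_power_eigenvector)
  then show ?thesis by (simp add: sum_prod)
qed

text \<open>The solution and its derivative are finite combinations of eigenvectors at every time,
  so this computes every power of A that occurs.\<close>

lemma op_app_power_eigenvector_sum:
  fixes e :: "'i \<Rightarrow> 'a"
  assumes "finite I" "\<And>k. k \<in> I \<Longrightarrow> (e k, \<mu> k *\<^sub>R e k) \<in> A" "\<And>k. k \<in> I \<Longrightarrow> \<mu> k > 0" "\<alpha> \<ge> 0"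
  shows "op_app (op_power A \<alpha>) (\<Sum>k\<in>I. c k *\<^sub>R e k) = (\<Sum>k\<in>I. (c k * \<mu> k powr \<alpha>) *\<^sub>R e k)"
proof -
  have "(\<Sum>k\<in>I. c k *\<^sub>R e k, \<Sum>k\<in>I. (c k * \<mu> k powr \<alpha>) *\<^sub>R e k) \<in> op_power A \<alpha>"
    by (rule op_power_eigenvector_sum) (use assms in auto)
  then show ?thesis unfolding op_app_def using single_valued_op_power by blast
qed

lemma psa_eigenvector_sum:
  assumes "finite I" "\<And>k. k \<in> I \<Longrightarrow> (e k, \<mu> k *\<^sub>R e k) \<in> A"
  shows "(\<Sum>k\<in>I. c k *\<^sub>R e k, \<Sum>k\<in>I. (c k * \<mu> k) *\<^sub>R e k) \<in> A"
proof -
  have "(\<Sum>k\<in>I. c k *\<^sub>R (e k, \<mu> k *\<^sub>R e k)) \<in> A"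
    using assms by (intro subspace_sum subspace_scale psa_subspace)
  then show ?thesis by (simp add: sum_prod)
qed

lemma op_app_eigenvector_sum:
  fixes e :: "'i \<Rightarrow> 'a"
  assumes "finite I" "\<And>k. k \<in> I \<Longrightarrow> (e k, \<mu> k *\<^sub>R e k) \<in> A"
  shows "op_app A (\<Sum>k\<in>I. c k *\<^sub>R e k) = (\<Sum>k\<in>I. (c k * \<mu> k) *\<^sub>R e k)"
proof -
  have "(\<Sum>k\<in>I. c k *\<^sub>R e k, \<Sum>k\<in>I. (c k * \<mu> k) *\<^sub>R e k) \<in> A"
    by (rule psa_eigenvector_sum) (use assms in auto)
  then show ?thesis unfolding op_app_def using psa_single_valued by blast
qed

end

section \<open>Cutoff, oscillation and Gronwall lemmas\<close>

lemma C1_on_const: "C1_on UNIV (\<lambda>t. c) (\<lambda>t. 0)"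
  by (simp add: C1_on_def)

lemma C2_on_const: "C2_on UNIV (\<lambda>t. c) (\<lambda>t. 0) (\<lambda>t. 0)"
  by (simp add: C2_on_def C1_on_const)

lemma C1_on_imp_continuous: "C1_on I f f1 \<Longrightarrow> continuous_on I f"
  unfolding C1_on_def using DERIV_continuous_on by blast

lemma C2_on_add:
  "C2_on UNIV f f1 f2 \<Longrightarrow> C2_on UNIV g g1 g2 \<Longrightarrow>
    C2_on UNIV (\<lambda>t. f t + g t) (\<lambda>t. f1 t + g1 t) (\<lambda>t. f2 t + g2 t)"
  by (simp add: C2_on_def C1_on_def DERIV_add DERIV_diff continuous_on_add continuous_on_diff)

lemma C2_on_diff:
  "C2_on UNIV f f1 f2 \<Longrightarrow> C2_on UNIV g g1 g2 \<Longrightarrow>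
    C2_on UNIV (\<lambda>t. f t - g t) (\<lambda>t. f1 t - g1 t) (\<lambda>t. f2 t - g2 t)"
  by (simp add: C2_on_def C1_on_def DERIV_add DERIV_diff continuous_on_add continuous_on_diff)

lemma C2_on_mult:
  assumes "C2_on UNIV f f1 f2" "C2_on UNIV g g1 g2"
  shows "C2_on UNIV (\<lambda>t. f t * g t) (\<lambda>t. f1 t * g t + f t * g1 t)
      (\<lambda>t. f2 t * g t + 2 * (f1 t * g1 t) + f t * g2 t)"
proof -
  have "continuous_on UNIV f" "continuous_on UNIV f1" "continuous_on UNIV g" "continuous_on UNIV g1"
    using assms C1_on_imp_continuous unfolding C2_on_def by blast+
  then have "continuous_on UNIV (\<lambda>t. f1 t * g t + f t * g1 t)"
    "continuous_on UNIV (\<lambda>t. f2 t * g t + 2 * (f1 t * g1 t) + f t * g2 t)"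
    using assms unfolding C2_on_def C1_on_def by (intro continuous_intros; simp)+
  moreover have "((\<lambda>t. f t * g t) has_real_derivative f1 t * g t + f t * g1 t) (at t)" for t
    using DERIV_mult[of f "f1 t" t UNIV g "g1 t"] assms by (simp add: C2_on_def C1_on_def add_ac mult_ac)
  moreover have "((\<lambda>t. f1 t * g t + f t * g1 t) has_real_derivative
      f2 t * g t + 2 * (f1 t * g1 t) + f t * g2 t) (at t)" for t
    using DERIV_add[OF DERIV_mult[of f1 "f2 t" t UNIV g "g1 t"] DERIV_mult[of f "f1 t" t UNIV g1 "g2 t"]] assms
    by (simp add: C2_on_def C1_on_def algebra_simps)
  ultimately show ?thesis by (simp add: C2_on_def C1_on_def)
qed

lemma C2_on_affine:
  assumes "C2_on UNIV f f1 f2"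
  shows "C2_on UNIV (\<lambda>t. f (a * t + b)) (\<lambda>t. a * f1 (a * t + b)) (\<lambda>t. a\<^sup>2 * f2 (a * t + b))"
proof -
  have lin: "((\<lambda>t. a * t + b) has_real_derivative a) (at t)" for t
    by (auto intro!: derivative_eq_intros)
  have chain: "((\<lambda>t. h (a * t + b)) has_real_derivative a * h1 (a * t + b)) (at t)"
    if "\<And>t. (h has_real_derivative h1 t) (at t)" for h h1 t
    using DERIV_chain2[OF that lin, of t] by (simp only: mult.commute)
  have f: "\<And>t. (f has_real_derivative f1 t) (at t)" "\<And>t. (f1 has_real_derivative f2 t) (at t)"
    "continuous_on UNIV f1" "continuous_on UNIV f2"
    using assms by (simp_all add: C2_on_def C1_on_def)
  have "((\<lambda>t. a * f1 (a * t + b)) has_real_derivative a\<^sup>2 * f2 (a * t + b)) (at t)" for t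
    using DERIV_cmult[OF chain[OF f(2)], of a t] by (simp only: power2_eq_square mult.assoc)
  moreover have "continuous_on UNIV (\<lambda>t. c * h (a * t + b))" if "continuous_on UNIV h" for c and h :: "real \<Rightarrow> real"
    by (intro continuous_on_mult continuous_on_const continuous_on_compose2[OF that] continuous_on_add continuous_on_id) auto
  ultimately show ?thesis using chain[OF f(1)] f by (simp add: C2_on_def C1_on_def)
qed

text \<open>Truncated powers are the pieces of the spline cutoff. At the kink the difference
  quotient is at most |h|^n, whence \<open>n > 0\<close>.\<close>

lemma DERIV_max_power:
  fixes x :: real
  assumes n: "n > 0"
  shows "((\<lambda>x. max 0 x ^ Suc n) has_real_derivative real (Suc n) * max 0 x ^ n) (at x)"
proof (cases x "0::real" rule: linorder_cases)
  case less
  have "((\<lambda>x. 0) has_real_derivative real (Suc n) * max 0 x ^ n) (at x)"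
    using less n by (simp add: zero_power)
  then show ?thesis
    by (rule has_field_derivative_transform_within_open[where S = "{..<0}"]) (use less in auto)
next
  case greater
  have "((\<lambda>x. x ^ Suc n) has_real_derivative real (Suc n) * max 0 x ^ n) (at x)"
    using greater DERIV_pow[of "Suc n" x UNIV] by simp
  then show ?thesis
    by (rule has_field_derivative_transform_within_open[where S = "{0<..}"]) (use greater in auto)
next
  case equal
  have "((\<lambda>h. (max 0 (0 + h) ^ Suc n - max 0 0 ^ Suc n) / h) \<longlongrightarrow> 0) (at (0::real))"
  proof (rule Lim_null_comparison[OF always_eventually[OF allI]])
    show "((\<lambda>h::real. \<bar>h\<bar> ^ n) \<longlongrightarrow> 0) (at 0)"
      using n tendsto_power[OF tendsto_rabs[OF tendsto_ident_at[of 0 UNIV]], of n] by (simp add: zero_power)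
    fix h :: real
    show "norm ((max 0 (0 + h) ^ Suc n - max 0 0 ^ Suc n) / h) \<le> \<bar>h\<bar> ^ n"
      by (cases "h > 0") (auto simp: max_def)
  qed
  then show ?thesis using equal n by (simp add: DERIV_def zero_power)
qed

text \<open>The cutoff is the integral of the quadratic B-spline on $[0,3]$, hence of class $C^2$.\<close>

definition cutoff :: "real \<Rightarrow> real" where
  "cutoff x = (max 0 x ^ 3 - 3 * max 0 (x - 1) ^ 3 + 3 * max 0 (x - 2) ^ 3 - max 0 (x - 3) ^ 3) / 6"

definition cutoff1 :: "real \<Rightarrow> real" where
  "cutoff1 x = (max 0 x ^ 2 - 3 * max 0 (x - 1) ^ 2 + 3 * max 0 (x - 2) ^ 2 - max 0 (x - 3) ^ 2) / 2"

definition cutoff2 :: "real \<Rightarrow> real" where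
  "cutoff2 x = max 0 x - 3 * max 0 (x - 1) + 3 * max 0 (x - 2) - max 0 (x - 3)"

lemma C2_cutoff: "C2_on UNIV cutoff cutoff1 cutoff2"
proof -
  have 3: "((\<lambda>x. max 0 (x - c) ^ 3) has_real_derivative 3 * max 0 (x - c) ^ 2) (at x)" for c x :: real
  proof -
    have "((\<lambda>x. x - c) has_real_derivative 1) (at x)" by (auto intro!: derivative_eq_intros)
    from DERIV_chain2[OF DERIV_max_power[of 2 "x - c"] this] show ?thesis by (simp add: numeral_3_eq_3)
  qed
  have 2: "((\<lambda>x. max 0 (x - c) ^ 2) has_real_derivative 2 * max 0 (x - c)) (at x)" for c x :: real
  proof -
    have "((\<lambda>x. x - c) has_real_derivative 1) (at x)" by (auto intro!: derivative_eq_intros)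
    from DERIV_chain2[OF DERIV_max_power[of 1 "x - c"] this] show ?thesis by (simp add: numeral_2_eq_2)
  qed
  have "(cutoff has_real_derivative cutoff1 x) (at x)" for x
    unfolding cutoff_def[abs_def] cutoff1_def
    using DERIV_cdivide[OF DERIV_diff[OF DERIV_add[OF DERIV_diff[OF 3[of 0 x] DERIV_cmult[OF 3[of 1 x], of 3]]
          DERIV_cmult[OF 3[of 2 x], of 3]] 3[of 3 x]], of 6]
    by (simp add: add_divide_distrib diff_divide_distrib)
  moreover have d2: "(cutoff1 has_real_derivative cutoff2 x) (at x)" for x
    unfolding cutoff1_def[abs_def] cutoff2_def
    using DERIV_cdivide[OF DERIV_diff[OF DERIV_add[OF DERIV_diff[OF 2[of 0 x] DERIV_cmult[OF 2[of 1 x], of 3]]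
          DERIV_cmult[OF 2[of 2 x], of 3]] 2[of 3 x]], of 2]
    by (simp add: add_divide_distrib diff_divide_distrib)
  moreover have "continuous_on UNIV cutoff2"
    unfolding cutoff2_def[abs_def] by (intro continuous_intros)
  moreover have "continuous_on UNIV cutoff1" by (rule DERIV_continuous_on[OF d2])
  ultimately show ?thesis by (simp add: C2_on_def C1_on_def)
qed

lemma cutoff_left: "x \<le> 0 \<Longrightarrow> cutoff x = 0" "x \<le> 0 \<Longrightarrow> cutoff1 x = 0" "x \<le> 0 \<Longrightarrow> cutoff2 x = 0"
  by (auto simp: cutoff_def cutoff1_def cutoff2_def max_def)

lemma cutoff_right: "x \<ge> 3 \<Longrightarrow> cutoff x = 1" "x \<ge> 3 \<Longrightarrow> cutoff1 x = 0" "x \<ge> 3 \<Longrightarrow> cutoff2 x = 0"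
  by (auto simp: cutoff_def cutoff1_def cutoff2_def max_def power2_eq_square power3_eq_cube algebra_simps)

text \<open>Comparison with $\sin(\omega(t - a))$: the Wronskian is monotone with the wrong boundary signs.\<close>

lemma sturm_nonpos:
  fixes y y1 q :: "real \<Rightarrow> real"
  assumes dy: "\<And>t. (y has_real_derivative y1 t) (at t)"
    and dy1: "\<And>t. (y1 has_real_derivative - q t * y t) (at t)"
    and q: "\<And>t. q t \<ge> \<omega>\<^sup>2" and \<omega>: "\<omega> > 0"
  shows "\<exists>t\<in>{a..a + pi / \<omega>}. y t \<le> 0"
proof (rule ccontr)
  assume "\<not> ?thesis"
  then have pos: "y t > 0" if "a \<le> t" "t \<le> a + pi / \<omega>" for t using that by force
  define F where "F t = y1 t * sin (\<omega> * (t - a)) - y t * (\<omega> * cos (\<omega> * (t - a)))" for t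
  have dF: "(F has_real_derivative (\<omega>\<^sup>2 - q t) * y t * sin (\<omega> * (t - a))) (at t)" for t
    unfolding F_def[abs_def]
    by (rule derivative_eq_intros dy dy1 refl)+ (simp add: algebra_simps power2_eq_square)
  have le: "a \<le> a + pi / \<omega>" using \<omega> by simp
  have "F (a + pi / \<omega>) \<le> F a"
  proof (rule DERIV_nonpos_imp_nonincreasing[OF le])
    fix t assume t: "a \<le> t" "t \<le> a + pi / \<omega>"
    have "0 \<le> sin (\<omega> * (t - a))" using t \<omega> by (intro sin_ge_zero) (auto simp: field_simps)
    then have "(\<omega>\<^sup>2 - q t) * y t * sin (\<omega> * (t - a)) \<le> 0"
      using q[of t] pos[OF t] by (intro mult_nonpos_nonneg) auto
    then show "\<exists>y. (F has_real_derivative y) (at t) \<and> y \<le> 0" using dF by blast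
  qed
  moreover have "F a = - \<omega> * y a" "F (a + pi / \<omega>) = \<omega> * y (a + pi / \<omega>)" using \<omega> by (auto simp: F_def)
  moreover have "\<omega> * y a > 0" "\<omega> * y (a + pi / \<omega>) > 0" using pos le \<omega> by auto
  ultimately show False by simp
qed

text \<open>Three half-periods of the comparison oscillator suffice: one to reach a value at most 0,
  at most one more to make it negative, one to return to a value at least 0. The first zero after
  the negative value is crossed upwards.\<close>

lemma upward_zero_exists:
  fixes y y1 q :: "real \<Rightarrow> real"
  assumes dy: "\<And>t. (y has_real_derivative y1 t) (at t)"
    and dy1: "\<And>t. (y1 has_real_derivative - q t * y t) (at t)"
    and q: "\<And>t. q t \<ge> \<omega>\<^sup>2" and \<omega>: "\<omega> > 0"
    and nd: "\<And>t. a \<le> t \<Longrightarrow> t \<le> a + 3 * pi / \<omega> \<Longrightarrow> y t = 0 \<Longrightarrow> y1 t \<noteq> 0"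
  shows "\<exists>t\<in>{a..a + 3 * pi / \<omega>}. y t = 0 \<and> y1 t > 0"
proof -
  have L: "pi / \<omega> > 0" "3 * pi / \<omega> = pi / \<omega> + pi / \<omega> + pi / \<omega>" using \<omega> by auto
  have conty: "continuous_on S y" for S by (rule DERIV_continuous_on) (rule has_field_derivative_at_within[OF dy])
  obtain t0 where t0: "a \<le> t0" "t0 \<le> a + pi / \<omega>" "y t0 \<le> 0"
    using sturm_nonpos[OF dy dy1 q \<omega>, of a] by auto
  show ?thesis
  proof (cases "y t0 = 0 \<and> y1 t0 > 0")
    case True
    then show ?thesis using t0 L by (intro bexI[of _ t0]) auto
  next
    case False
    have "\<exists>p. a \<le> p \<and> p \<le> a + pi / \<omega> + pi / \<omega> \<and> y p < 0"
    proof (cases "y t0 = 0")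
      \<comment> \<open>A zero \<open>t0\<close> that is not an upward one has negative slope, as
        zeros are simple; a short step to the right makes \<open>y\<close> negative.\<close>
      case True
      then have "y1 t0 < 0" using False nd[OF t0(1) _ True] t0(2) L by linarith
      from DERIV_neg_dec_right[OF dy this] obtain d where d: "d > 0" "\<And>h. h > 0 \<Longrightarrow> h < d \<Longrightarrow> y (t0 + h) < y t0"
        by blast
      define h where "h = min (d / 2) (pi / \<omega>)"
      have "h > 0" "h < d" "h \<le> pi / \<omega>" using d L by (auto simp: h_def)
      then show ?thesis using d(2)[of h] t0 True by (intro exI[of _ "t0 + h"]) auto
    next
      case False
      then show ?thesis using t0 L by (intro exI[of _ t0]) auto
    qed
    then obtain p where p: "a \<le> p" "p \<le> a + pi / \<omega> + pi / \<omega>" "y p < 0" by blast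
    \<comment> \<open>The same comparison for \<open>- y\<close>, restarted at
      \<open>p\<close>.\<close>
    have "\<exists>t\<in>{p..p + pi / \<omega>}. - y t \<le> 0"
    proof (rule sturm_nonpos[of _ "\<lambda>t. - y1 t" q, OF _ _ q \<omega>])
      show "((\<lambda>t. - y t) has_real_derivative - y1 t) (at t)" for t by (intro DERIV_minus dy)
      show "((\<lambda>t. - y1 t) has_real_derivative - q t * - y t) (at t)" for t
        using DERIV_minus[OF dy1[of t]] by simp
    qed
    then obtain s where s: "p \<le> s" "s \<le> p + pi / \<omega>" "y s \<ge> 0" by auto
    define Z where "Z = {t\<in>{p..s}. y t = 0}"
    have "\<exists>t\<ge>p. t \<le> s \<and> y t = 0" using IVT'[of y p 0 s] p s conty by fastforce
    then have ne: "Z \<noteq> {}" by (auto simp: Z_def)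
    have "closed Z" unfolding Z_def by (intro continuous_closed_preimage_constant conty) auto
    moreover have bdd: "bdd_below Z" by (auto simp: Z_def)
    ultimately have zZ: "Inf Z \<in> Z" using ne closed_contains_Inf by blast
    define z where "z = Inf Z"
    have z: "p \<le> z" "z \<le> s" "y z = 0" using zZ by (auto simp: Z_def z_def)
    have least: "z \<le> t" if "p \<le> t" "t \<le> s" "y t = 0" for t
      unfolding z_def using that by (intro cInf_lower bdd) (auto simp: Z_def)
    have "p \<noteq> z" using p(3) z(3) by auto
    then have pz: "p < z" using z by simp
    \<comment> \<open>A negative slope at \<open>z\<close> would make \<open>y\<close> positive just
      before \<open>z\<close>, hence produce an earlier zero after \<open>p\<close>.\<close>
    have "\<not> y1 z < 0"
    proof
      assume "y1 z < 0"
      from DERIV_neg_dec_left[OF dy this] obtain d where d: "d > 0" "\<And>h. h > 0 \<Longrightarrow> h < d \<Longrightarrow> y z < y (z - h)"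
        by blast
      define h where "h = min (d / 2) ((z - p) / 2)"
      have h: "h > 0" "h < d" "h < z - p" using d pz by (auto simp: h_def min_def field_simps)
      have "y (z - h) > 0" using d(2)[of h] h z by simp
      then obtain t where "p \<le> t" "t \<le> z - h" "y t = 0"
        using IVT'[of y p 0 "z - h"] p h conty by fastforce
      then show False using least[of t] h z by auto
    qed
    moreover have az: "a \<le> z" "z \<le> a + 3 * pi / \<omega>" using z p s L by linarith+
    moreover have "y1 z \<noteq> 0" using nd[OF az z(3)] .
    ultimately show ?thesis using z by (intro bexI[of _ z]) auto
  qed
qed

text \<open>Gronwall for the energy of \<open>D\<close>. The constant c^2 is included in
  \<open>G\<close> so that the source term is absorbed: G' is at most (L + 2) G, and G starts at no
  more than 2 c^2. The conclusion is therefore linear in \<open>c\<close>.\<close>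

lemma second_order_gronwall:
  fixes D D1 D2 :: "real \<Rightarrow> real"
  assumes dD: "\<And>t. (D has_real_derivative D1 t) (at t)"
    and dD1: "\<And>t. (D1 has_real_derivative D2 t) (at t)"
    and b: "\<And>t. 0 \<le> t \<Longrightarrow> t \<le> T \<Longrightarrow> \<bar>D2 t\<bar> \<le> L * \<bar>D t\<bar> + c"
    and L: "L \<ge> 0" and c: "c \<ge> 0" and D0: "D 0 = 0" "\<bar>D1 0\<bar> \<le> c"
    and t: "0 \<le> t" "t \<le> T"
  shows "\<bar>D t\<bar> \<le> c * sqrt (2 * exp ((L + 2) * T))" "\<bar>D1 t\<bar> \<le> c * sqrt (2 * exp ((L + 2) * T))"
proof -
  define G where "G t = (D t)\<^sup>2 + (D1 t)\<^sup>2 + c\<^sup>2" for t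
  define F where "F t = G t * exp (- (L + 2) * t)" for t
  have dG: "(G has_real_derivative 2 * D t * D1 t + 2 * D1 t * D2 t) (at t)" for t
    unfolding G_def[abs_def] by (rule derivative_eq_intros dD dD1 refl)+ simp
  have dF: "(F has_real_derivative (2 * D t * D1 t + 2 * D1 t * D2 t - (L + 2) * G t) * exp (- (L + 2) * t)) (at t)" for t
    unfolding F_def[abs_def] by (rule derivative_eq_intros dG refl)+ (simp add: algebra_simps)
  have "F t \<le> F 0"
  proof (rule DERIV_nonpos_imp_nonincreasing[OF t(1)])
    fix s assume s: "0 \<le> s" "s \<le> t"
    have 1: "2 * D s * D1 s \<le> (D s)\<^sup>2 + (D1 s)\<^sup>2" by (rule sum_squares_bound)
    have "D1 s * D2 s \<le> \<bar>D1 s\<bar> * \<bar>D2 s\<bar>" by (metis abs_ge_self abs_mult)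
    also have "\<dots> \<le> \<bar>D1 s\<bar> * (L * \<bar>D s\<bar> + c)" using b[of s] s t by (intro mult_left_mono) auto
    finally have 2: "2 * D1 s * D2 s \<le> L * (2 * \<bar>D s\<bar> * \<bar>D1 s\<bar>) + 2 * \<bar>D1 s\<bar> * c" by (simp add: algebra_simps)
    have 3: "2 * \<bar>D s\<bar> * \<bar>D1 s\<bar> \<le> (D s)\<^sup>2 + (D1 s)\<^sup>2" using sum_squares_bound[of "\<bar>D s\<bar>" "\<bar>D1 s\<bar>"] by simp
    have 4: "2 * \<bar>D1 s\<bar> * c \<le> (D1 s)\<^sup>2 + c\<^sup>2" using sum_squares_bound[of "\<bar>D1 s\<bar>" c] by simp
    have "2 * D s * D1 s + 2 * D1 s * D2 s \<le> (L + 2) * G s"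
    proof -
      have "L * (2 * \<bar>D s\<bar> * \<bar>D1 s\<bar>) \<le> L * (D s)\<^sup>2 + L * (D1 s)\<^sup>2"
        using mult_left_mono[OF 3 L] by (simp add: distrib_left)
      moreover have "(L + 2) * G s = L * (D s)\<^sup>2 + L * (D1 s)\<^sup>2 + L * c\<^sup>2 + 2 * (D s)\<^sup>2 + 2 * (D1 s)\<^sup>2 + 2 * c\<^sup>2"
        by (simp add: G_def algebra_simps)
      moreover have "0 \<le> L * c\<^sup>2" "0 \<le> c\<^sup>2" "0 \<le> (D s)\<^sup>2" using L by auto
      ultimately show ?thesis using 1 2 4 by linarith
    qed
    then have "(2 * D s * D1 s + 2 * D1 s * D2 s - (L + 2) * G s) * exp (- (L + 2) * s) \<le> 0"
      by (intro mult_nonpos_nonneg) auto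
    then show "\<exists>y. (F has_real_derivative y) (at s) \<and> y \<le> 0" using dF by blast
  qed
  also have "F 0 \<le> 2 * c\<^sup>2"
    using power_mono[OF D0(2), of 2] D0(1) by (simp add: F_def G_def)
  finally have "F t \<le> 2 * c\<^sup>2" .
  then have "G t \<le> 2 * c\<^sup>2 * exp ((L + 2) * t)"
  proof -
    have "G t = F t * exp ((L + 2) * t)" by (simp add: F_def mult.assoc algebra_simps flip: exp_add)
    also have "\<dots> \<le> 2 * c\<^sup>2 * exp ((L + 2) * t)"
      using \<open>F t \<le> 2 * c\<^sup>2\<close> by (intro mult_right_mono) auto
    finally show ?thesis .
  qed
  also have "\<dots> \<le> 2 * c\<^sup>2 * exp ((L + 2) * T)" using t L by (intro mult_left_mono) (auto intro: mult_left_mono)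
  finally have G: "G t \<le> c\<^sup>2 * (2 * exp ((L + 2) * T))" by (simp add: mult_ac)
  have "(D t)\<^sup>2 \<le> c\<^sup>2 * (2 * exp ((L + 2) * T))" "(D1 t)\<^sup>2 \<le> c\<^sup>2 * (2 * exp ((L + 2) * T))"
    by (rule order.trans[OF _ G], simp add: G_def)+
  then have "sqrt ((D t)\<^sup>2) \<le> sqrt (c\<^sup>2 * (2 * exp ((L + 2) * T)))" "sqrt ((D1 t)\<^sup>2) \<le> sqrt (c\<^sup>2 * (2 * exp ((L + 2) * T)))"
    by (intro real_sqrt_le_mono, simp)+
  then show "\<bar>D t\<bar> \<le> c * sqrt (2 * exp ((L + 2) * T))" "\<bar>D1 t\<bar> \<le> c * sqrt (2 * exp ((L + 2) * T))"
    using c by (simp_all only: real_sqrt_abs real_sqrt_mult abs_of_nonneg)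
qed

section \<open>Energy and zeros of the heteroclinic connection\<close>

locale heteroclinic =
  fixes m m' v v1 v2 w w1 w2 :: "real \<Rightarrow> real" and \<mu>1 lam A0 B0 :: real
  assumes m_C1: "C1_on {0..} m m'" and \<mu>1_pos: "\<mu>1 > 0" and m_ge: "\<sigma> \<ge> 0 \<Longrightarrow> m \<sigma> \<ge> \<mu>1"
    and lam_gt_1: "lam > 1"
    and v_C2: "C2_on UNIV v v1 v2" and w_C2: "C2_on UNIV w w1 w2"
    and nontrivial: "(v1 0)\<^sup>2 + (w1 0)\<^sup>2 + (v 0)\<^sup>2 + (w 0)\<^sup>2 > 0"
    and v_eq: "v2 t = - m ((v t)\<^sup>2 + lam\<^sup>2 * (w t)\<^sup>2) * v t"
    and w_eq: "w2 t = - lam\<^sup>2 * m ((v t)\<^sup>2 + lam\<^sup>2 * (w t)\<^sup>2) * w t"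
    and A0_pos: "A0 > 0" and B0_pos: "B0 > 0"
    and v_decay: "t \<ge> 0 \<Longrightarrow> (v1 t)\<^sup>2 + (v t)\<^sup>2 \<le> B0 * exp (- A0 * t)"
    and w_decay: "t \<le> 0 \<Longrightarrow> (w1 t)\<^sup>2 + lam\<^sup>2 * (w t)\<^sup>2 \<le> B0 * exp (A0 * t)"
begin

lemma dv: "(v has_real_derivative v1 t) (at t)" and dv1: "(v1 has_real_derivative v2 t) (at t)"
  and dw: "(w has_real_derivative w1 t) (at t)" and dw1: "(w1 has_real_derivative w2 t) (at t)"
  using v_C2 w_C2 by (auto simp: C2_on_def C1_on_def)

lemma m_bounded: "\<exists>K\<ge>1. \<forall>x\<in>{0..R}. \<bar>m x\<bar> \<le> K"
proof -
  have "continuous_on {0..R} m"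
    using C1_on_imp_continuous[OF m_C1] by (rule continuous_on_subset) auto
  then have "bounded (m ` {0..R})"
    by (intro compact_imp_bounded compact_continuous_image) auto
  then obtain K where "\<forall>x\<in>{0..R}. \<bar>m x\<bar> \<le> K" by (auto simp: bounded_iff)
  then show ?thesis by (intro exI[of _ "max 1 K"]) (auto simp: le_max_iff_disj)
qed

lemma m_lipschitz: "\<exists>K\<ge>0. \<forall>x\<in>{0..R}. \<forall>y\<in>{0..R}. \<bar>m x - m y\<bar> \<le> K * \<bar>x - y\<bar>"
proof -
  have "continuous_on {0..R} m'"
    using m_C1 by (auto simp: C1_on_def intro: continuous_on_subset)
  then have "bounded (m' ` {0..R})"
    by (intro compact_imp_bounded compact_continuous_image) auto
  then obtain K where K: "\<forall>x\<in>{0..R}. \<bar>m' x\<bar> \<le> K" by (auto simp: bounded_iff)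
  have "norm (m x - m y) \<le> max 0 K * norm (x - y)" if "x \<in> {0..R}" "y \<in> {0..R}" for x y
  proof (rule field_differentiable_bound[of "{0..R}" m m'])
    show "(m has_field_derivative m' z) (at z within {0..R})" if "z \<in> {0..R}" for z
      by (rule has_field_derivative_subset[of m "m' z" z "{0..}"]) (use m_C1 that in \<open>auto simp: C1_on_def\<close>)
    show "norm (m' z) \<le> max 0 K" if "z \<in> {0..R}" for z using bspec[OF K that] by simp
  qed (use that in auto)
  then show ?thesis by (intro exI[of _ "max 0 K"]) auto
qed

text \<open>The primitive of \<open>m\<close> that vanishes at 0. Continuing \<open>m\<close> by a
  constant to the left of 0 makes \<open>M\<close> differentiable from both sides at 0, as the chain
  rule needs when both profiles vanish.\<close>

definition M :: "real \<Rightarrow> real" where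
  "M x = integral {-1..x} (\<lambda>s. m (max 0 s)) - integral {-1..0} (\<lambda>s. m (max 0 s))"

lemma M_0: "M 0 = 0" by (simp add: M_def)

lemma dM: "x \<ge> 0 \<Longrightarrow> (M has_real_derivative m x) (at x)"
proof -
  assume x: "x \<ge> 0"
  have "continuous_on {-1..x + 1} (\<lambda>s. m (max 0 s))"
    by (rule continuous_on_compose2[OF C1_on_imp_continuous[OF m_C1]]) (auto intro!: continuous_intros)
  from integral_has_real_derivative[OF this, of x] x
  have "((\<lambda>x. integral {-1..x} (\<lambda>s. m (max 0 s))) has_real_derivative m x) (at x within {-1..x + 1})"
    by (simp add: max_def)
  moreover have "at x within {-1..x + 1} = at x" using x by (intro at_within_interior) auto
  ultimately show ?thesis unfolding M_def[abs_def] by (auto intro!: derivative_eq_intros)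
qed

lemma M_ge: "x \<ge> 0 \<Longrightarrow> \<mu>1 * x \<le> M x"
proof -
  assume x: "x \<ge> 0"
  have "M 0 - \<mu>1 * 0 \<le> M x - \<mu>1 * x"
  proof (rule DERIV_nonneg_imp_nondecreasing[OF x])
    fix s assume s: "0 \<le> s" "s \<le> x"
    have "((\<lambda>s. M s - \<mu>1 * s) has_real_derivative m s - \<mu>1) (at s)"
      by (rule derivative_eq_intros dM s refl)+ simp
    then show "\<exists>y. ((\<lambda>s. M s - \<mu>1 * s) has_real_derivative y) (at s) \<and> 0 \<le> y" using m_ge[OF s(1)] by force
  qed
  then show ?thesis by (simp add: M_0)
qed

lemma M_le:
  assumes K: "\<forall>x\<in>{0..R}. \<bar>m x\<bar> \<le> K" and x: "0 \<le> x" "x \<le> R"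
  shows "M x \<le> K * x"
proof -
  have "K * 0 - M 0 \<le> K * x - M x"
  proof (rule DERIV_nonneg_imp_nondecreasing[OF x(1)])
    fix s assume s: "0 \<le> s" "s \<le> x"
    have "((\<lambda>s. K * s - M s) has_real_derivative K - m s) (at s)"
      by (rule derivative_eq_intros dM s refl)+ simp
    moreover have "m s \<le> K" using K s x by force
    ultimately show "\<exists>y. ((\<lambda>s. K * s - M s) has_real_derivative y) (at s) \<and> 0 \<le> y" by force
  qed
  then show ?thesis by (simp add: M_0)
qed

definition E0 :: real where
  "E0 = (v1 0)\<^sup>2 + (w1 0)\<^sup>2 + M ((v 0)\<^sup>2 + lam\<^sup>2 * (w 0)\<^sup>2)"

text \<open>The two-mode system is Hamiltonian; this is twice its Hamiltonian.\<close>

lemma energy: "(v1 t)\<^sup>2 + (w1 t)\<^sup>2 + M ((v t)\<^sup>2 + lam\<^sup>2 * (w t)\<^sup>2) = E0"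
proof -
  define \<rho> where "\<rho> t = (v t)\<^sup>2 + lam\<^sup>2 * (w t)\<^sup>2" for t
  define E where "E t = (v1 t)\<^sup>2 + (w1 t)\<^sup>2 + M (\<rho> t)" for t
  have d\<rho>: "(\<rho> has_real_derivative 2 * v t * v1 t + lam\<^sup>2 * (2 * w t * w1 t)) (at t)" for t
    unfolding \<rho>_def[abs_def] by (rule derivative_eq_intros dv dw refl)+ simp
  have "\<rho> t \<ge> 0" for t by (simp add: \<rho>_def)
  from DERIV_chain2[OF dM[OF this] d\<rho>]
  have dM\<rho>: "((\<lambda>t. M (\<rho> t)) has_real_derivative m (\<rho> t) * (2 * v t * v1 t + lam\<^sup>2 * (2 * w t * w1 t))) (at t)" for t .
  have "(E has_real_derivative 0) (at t)" for t
    unfolding E_def[abs_def]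
    by (rule derivative_eq_intros dv1 dw1 dM\<rho> refl)+ (simp add: v_eq w_eq flip: \<rho>_def, simp add: algebra_simps)
  then have "E t = E 0" using DERIV_isconst_all by blast
  then show ?thesis by (simp add: E_def E0_def \<rho>_def)
qed

lemma E0_pos: "E0 > 0"
proof (rule ccontr)
  assume *: "\<not> ?thesis"
  have "\<mu>1 * ((v 0)\<^sup>2 + lam\<^sup>2 * (w 0)\<^sup>2) \<le> M ((v 0)\<^sup>2 + lam\<^sup>2 * (w 0)\<^sup>2)" by (rule M_ge) simp
  moreover have "\<mu>1 * ((v 0)\<^sup>2 + lam\<^sup>2 * (w 0)\<^sup>2) \<ge> 0" using \<mu>1_pos by simp
  ultimately have "(v1 0)\<^sup>2 + (w1 0)\<^sup>2 = 0" "\<mu>1 * ((v 0)\<^sup>2 + lam\<^sup>2 * (w 0)\<^sup>2) = 0"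
    using * sum_power2_ge_zero[of "v1 0" "w1 0"] unfolding E0_def by linarith+
  then show False using nontrivial \<mu>1_pos lam_gt_1 by (auto simp: sum_power2_eq_zero_iff add_nonneg_eq_0_iff)
qed

text \<open>Coercivity of \<open>M\<close> confines the argument of \<open>m\<close> to a compact
  interval, on which \<open>m\<close> is bounded.\<close>

lemma rho_le: "(v t)\<^sup>2 + lam\<^sup>2 * (w t)\<^sup>2 \<le> E0 / \<mu>1"
proof -
  have "\<mu>1 * ((v t)\<^sup>2 + lam\<^sup>2 * (w t)\<^sup>2) \<le> M ((v t)\<^sup>2 + lam\<^sup>2 * (w t)\<^sup>2)" by (rule M_ge) simp
  also have "\<dots> \<le> E0" using energy[of t] sum_power2_ge_zero[of "v1 t" "w1 t"] by linarith
  finally show ?thesis using \<mu>1_pos by (simp add: field_simps)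
qed

lemma M_rho_nonneg: "M ((v t)\<^sup>2 + lam\<^sup>2 * (w t)\<^sup>2) \<ge> 0"
  using M_ge[of "(v t)\<^sup>2 + lam\<^sup>2 * (w t)\<^sup>2"] \<mu>1_pos by (smt (verit) mult_nonneg_nonneg zero_le_power2)

lemma bounds:
  "\<bar>v t\<bar> \<le> sqrt (E0 / \<mu>1)" "\<bar>w t\<bar> \<le> sqrt (E0 / \<mu>1)"
proof -
  have "(w t)\<^sup>2 \<le> lam\<^sup>2 * (w t)\<^sup>2" using lam_gt_1 by (simp add: mult_le_cancel_right1 one_le_power)
  then have "(v t)\<^sup>2 \<le> E0 / \<mu>1" "(w t)\<^sup>2 \<le> E0 / \<mu>1" 
    using rho_le[of t] zero_le_power2[of "v t"] zero_le_power2[of "w t"] by linarith+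
  then show "\<bar>v t\<bar> \<le> sqrt (E0 / \<mu>1)" "\<bar>w t\<bar> \<le> sqrt (E0 / \<mu>1)"
    by (auto intro!: real_le_rsqrt)
qed

lemma exp_half_square: "(sqrt B0 * exp (A0 / 2 * t))\<^sup>2 = B0 * exp (A0 * t)"
  using B0_pos by (simp add: power_mult_distrib flip: exp_double)

lemma v_decay':
  assumes "t \<ge> 0"
  shows "\<bar>v t\<bar> \<le> sqrt B0 * exp (- (A0 / 2 * t))" "\<bar>v1 t\<bar> \<le> sqrt B0 * exp (- (A0 / 2 * t))"
proof -
  have "(v t)\<^sup>2 \<le> (sqrt B0 * exp (A0 / 2 * (- t)))\<^sup>2" "(v1 t)\<^sup>2 \<le> (sqrt B0 * exp (A0 / 2 * (- t)))\<^sup>2"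
    unfolding exp_half_square using v_decay[OF assms] zero_le_power2[of "v t"] zero_le_power2[of "v1 t"]
    by (simp_all, linarith+)
  then show "\<bar>v t\<bar> \<le> sqrt B0 * exp (- (A0 / 2 * t))" "\<bar>v1 t\<bar> \<le> sqrt B0 * exp (- (A0 / 2 * t))"
    using B0_pos by (auto simp flip: abs_le_square_iff simp: abs_mult)
qed

lemma w_decay':
  assumes "t \<le> 0"
  shows "\<bar>w t\<bar> \<le> sqrt B0 * exp (A0 / 2 * t)" "\<bar>w1 t\<bar> \<le> sqrt B0 * exp (A0 / 2 * t)"
proof -
  have "(w t)\<^sup>2 \<le> lam\<^sup>2 * (w t)\<^sup>2" using lam_gt_1 by (simp add: mult_le_cancel_right1 one_le_power)
  then have "(w t)\<^sup>2 \<le> (sqrt B0 * exp (A0 / 2 * t))\<^sup>2" "(w1 t)\<^sup>2 \<le> (sqrt B0 * exp (A0 / 2 * t))\<^sup>2"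
    unfolding exp_half_square using w_decay[OF assms] zero_le_power2[of "w t"] zero_le_power2[of "w1 t"]
    by linarith+
  then show "\<bar>w t\<bar> \<le> sqrt B0 * exp (A0 / 2 * t)" "\<bar>w1 t\<bar> \<le> sqrt B0 * exp (A0 / 2 * t)"
    using B0_pos by (auto simp flip: abs_le_square_iff simp: abs_mult)
qed

text \<open>At a zero of \<open>w\<close>, the conserved energy is w'^2 plus terms in
  \<open>v\<close> and \<open>v1\<close>, which decay forwards in time; at a zero of
  \<open>v\<close> the roles are exchanged backwards in time. A linear upper bound for
  \<open>M\<close> makes the defect comparable to the assumed decay of the squares.\<close>

lemma energy_at_zeros:
  "\<exists>K>0. (\<forall>t\<ge>0. w t = 0 \<longrightarrow> \<bar>(w1 t)\<^sup>2 - E0\<bar> \<le> K * exp (- A0 * t)) \<and>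
         (\<forall>t\<le>0. v t = 0 \<longrightarrow> \<bar>(v1 t)\<^sup>2 - E0\<bar> \<le> K * exp (A0 * t))"
proof -
  obtain K where K: "K \<ge> 1" "\<forall>x\<in>{0..E0 / \<mu>1}. \<bar>m x\<bar> \<le> K" using m_bounded by blast
  have Mle: "M ((v t)\<^sup>2 + lam\<^sup>2 * (w t)\<^sup>2) \<le> K * ((v t)\<^sup>2 + lam\<^sup>2 * (w t)\<^sup>2)" for t
    using M_le[OF K(2) _ rho_le] by simp
  have "\<bar>(w1 t)\<^sup>2 - E0\<bar> \<le> (K * B0) * exp (- A0 * t)" if "t \<ge> 0" "w t = 0" for t
  proof -
    have "\<bar>(w1 t)\<^sup>2 - E0\<bar> = (v1 t)\<^sup>2 + M ((v t)\<^sup>2 + lam\<^sup>2 * (w t)\<^sup>2)"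
      using energy[of t] M_rho_nonneg[of t] zero_le_power2[of "v1 t"] by linarith
    also have "\<dots> \<le> K * (v1 t)\<^sup>2 + K * (v t)\<^sup>2"
      using Mle[of t] that K(1) mult_right_mono[OF K(1), of "(v1 t)\<^sup>2"] by simp
    also have "\<dots> \<le> K * (B0 * exp (- A0 * t))"
      using mult_left_mono[OF v_decay[OF that(1)], of K] K(1) by (simp add: distrib_left)
    finally show ?thesis by simp
  qed
  moreover have "\<bar>(v1 t)\<^sup>2 - E0\<bar> \<le> (K * B0) * exp (A0 * t)" if "t \<le> 0" "v t = 0" for t
  proof -
    have "\<bar>(v1 t)\<^sup>2 - E0\<bar> = (w1 t)\<^sup>2 + M ((v t)\<^sup>2 + lam\<^sup>2 * (w t)\<^sup>2)"
      using energy[of t] M_rho_nonneg[of t] zero_le_power2[of "w1 t"] by linarith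
    also have "\<dots> \<le> K * (w1 t)\<^sup>2 + K * (lam\<^sup>2 * (w t)\<^sup>2)"
      using Mle[of t] that K(1) mult_right_mono[OF K(1), of "(w1 t)\<^sup>2"] by simp
    also have "\<dots> \<le> K * (B0 * exp (A0 * t))"
      using mult_left_mono[OF w_decay[OF that(1)], of K] K(1) by (simp add: distrib_left)
    finally show ?thesis by simp
  qed
  ultimately show ?thesis using K(1) B0_pos by (intro exI[of _ "K * B0"]) auto
qed

text \<open>Beyond \<open>R0\<close> the energy defect at a zero is at most E0 / 2, so every zero
  there is simple and the oscillation lemma applies, with frequency sqrt \<mu>1 because both
  coefficients are at least \<mu>1.\<close>

lemma crossing_times:
  "\<exists>R0 l. R0 \<ge> 3 \<and> l > 0 \<and> (\<forall>R\<ge>R0.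
     (\<exists>t\<in>{R..R + l}. w t = 0 \<and> w1 t > 0 \<and> (w1 t)\<^sup>2 \<ge> E0 / 2) \<and>
     (\<exists>t\<in>{R..R + l}. v (- t) = 0 \<and> v1 (- t) > 0))"
proof -
  obtain K where K: "K > 0" "\<And>t. t \<ge> 0 \<Longrightarrow> w t = 0 \<Longrightarrow> \<bar>(w1 t)\<^sup>2 - E0\<bar> \<le> K * exp (- A0 * t)"
    "\<And>t. t \<le> 0 \<Longrightarrow> v t = 0 \<Longrightarrow> \<bar>(v1 t)\<^sup>2 - E0\<bar> \<le> K * exp (A0 * t)"
    using energy_at_zeros by blast
  define \<omega> where "\<omega> = sqrt \<mu>1"
  have \<omega>: "\<omega> > 0" "\<omega>\<^sup>2 = \<mu>1" using \<mu>1_pos by (auto simp: \<omega>_def)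
  define l where "l = 3 * pi / \<omega>"
  \<comment> \<open>The logarithm is the time after which K exp (- A0 t) is at most E0 / 2. The
    lower bound 3 is the length of the gluing window, which must stay on the decaying side of the
    incoming stage.\<close>
  define R0 where "R0 = max 3 (ln (2 * K / E0) / A0)"
  have small: "K * exp (- A0 * t) \<le> E0 / 2" if "t \<ge> R0" for t
  proof -
    have "ln (2 * K / E0) \<le> A0 * t" using that A0_pos by (simp add: R0_def field_simps)
    then have "exp (ln (2 * K / E0)) \<le> exp (A0 * t)" by simp
    then have "2 * K / E0 \<le> exp (A0 * t)" using K(1) E0_pos by simp
    then show ?thesis using E0_pos by (simp add: exp_minus field_simps)
  qed
  let ?q = "\<lambda>t. m ((v t)\<^sup>2 + lam\<^sup>2 * (w t)\<^sup>2)"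
  have q: "?q t \<ge> \<omega>\<^sup>2" for t using m_ge \<omega> by simp
  have q': "lam\<^sup>2 * ?q t \<ge> \<omega>\<^sup>2" for t
  proof -
    have "1 * ?q t \<le> lam\<^sup>2 * ?q t"
      using lam_gt_1 q[of t] \<omega> \<mu>1_pos by (intro mult_right_mono) (auto intro: one_le_power)
    then show ?thesis using q[of t] by simp
  qed
  have "\<exists>t\<in>{R..R + l}. w t = 0 \<and> w1 t > 0 \<and> (w1 t)\<^sup>2 \<ge> E0 / 2" if R: "R \<ge> R0" for R
  proof -
    have R0: "R0 \<ge> 3" by (simp add: R0_def)
    have big: "(w1 t)\<^sup>2 \<ge> E0 / 2" if "R \<le> t" "w t = 0" for t
      using K(2)[of t] small[of t] that R R0 by linarith
    have "\<exists>t\<in>{R..R + l}. w t = 0 \<and> w1 t > 0" unfolding l_def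
    proof (rule upward_zero_exists[OF dw _ q' \<omega>(1)])
      show "(w1 has_real_derivative - (lam\<^sup>2 * ?q t) * w t) (at t)" for t using dw1[of t] by (simp add: w_eq)
      show "w1 t \<noteq> 0" if "R \<le> t" "w t = 0" for t using big[OF that] E0_pos by auto
    qed
    then show ?thesis using big by auto
  qed
  moreover have "\<exists>t\<in>{R..R + l}. v (- t) = 0 \<and> v1 (- t) > 0" if R: "R \<ge> R0" for R
  proof -
    \<comment> \<open>The interval that ends at -R: the zero of \<open>v\<close> is sought backwards
      in time.\<close>
    have "\<exists>t\<in>{- R - l..- R - l + 3 * pi / \<omega>}. v t = 0 \<and> v1 t > 0"
    proof (rule upward_zero_exists[OF dv _ q \<omega>(1)])
      show "(v1 has_real_derivative - ?q t * v t) (at t)" for t using dv1[of t] by (simp add: v_eq)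
      show "v1 t \<noteq> 0" if "t \<le> - R - l + 3 * pi / \<omega>" "v t = 0" for t
      proof -
        have t: "t \<le> - R" using that by (simp add: l_def)
        have "\<bar>(v1 t)\<^sup>2 - E0\<bar> \<le> E0 / 2"
          using K(3)[of t] small[of "- t"] t R that by (simp add: R0_def)
        then show ?thesis using E0_pos by auto
      qed
    qed
    then obtain t where "t \<in> {- R - l..- R}" "v t = 0" "v1 t > 0" by (auto simp: l_def)
    then show ?thesis by (intro bexI[of _ "- t"]) auto
  qed
  moreover have "l > 0" "R0 \<ge> 3" using \<omega> by (auto simp: l_def R0_def)
  ultimately show ?thesis by blast
qed

end

section \<open>Gluing consecutive stages\<close>

text \<open>Over a principal filter, big O means a bound on the whole set. It is used for pairs of a
  stage and a window time, so that one constant serves all stages and none has to be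
  tracked.\<close>

lemma bigo_principalI:
  assumes "\<And>x. x \<in> S \<Longrightarrow> \<bar>f x\<bar> \<le> C * \<bar>g x\<bar>"
  shows "f \<in> O[principal S](g :: _ \<Rightarrow> real)"
  using assms by (intro bigoI[of _ C]) (auto simp: eventually_principal)

lemma bigo_principalD:
  assumes "f \<in> O[principal S](g :: _ \<Rightarrow> real)"
  obtains C where "C > 0" "\<And>x. x \<in> S \<Longrightarrow> \<bar>f x\<bar> \<le> C * \<bar>g x\<bar>"
  using assms by (auto elim!: landau_o.bigE simp: eventually_principal)

lemma bigo_bounded_mult:
  fixes f g h :: "'a \<Rightarrow> real"
  assumes "f \<in> O[F](\<lambda>_. 1)" "g \<in> O[F](h)"
  shows "(\<lambda>x. f x * g x) \<in> O[F](h)"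
  using landau_o.big.mult[OF assms] by simp

text \<open>Stage \<open>n\<close> ends at its local time \<open>b n\<close> and stage \<open>n + 1\<close> starts at its local time \<open>- a n\<close>.\<close>

locale heteroclinic_chain = heteroclinic +
  fixes a b L :: "nat \<Rightarrow> real" and l :: real
  assumes L_ge: "L n \<ge> 3"
    and a_ge: "a n \<ge> L n" and a_le: "a n \<le> L n + l" and b_ge: "b n \<ge> L n" and b_le: "b n \<le> L n + l"
    and b_zero: "w (b n) = 0" "w1 (b n) > 0" "(w1 (b n))\<^sup>2 \<ge> E0 / 2"
    and a_zero: "v (- a n) = 0" "v1 (- a n) > 0"
begin

text \<open>The size of the gluing errors at the end of stage \<open>n\<close>. The factor 1/2
  appears because decay is assumed for the squares of the profiles.\<close>

definition \<delta> :: "nat \<Rightarrow> real" where "\<delta> n = exp (- (A0 / 2 * L n))"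

lemma \<delta>_pos: "\<delta> n > 0" by (simp add: \<delta>_def)

text \<open>All profiles are read in the window clock, in which the end of stage \<open>n\<close>
  and the start of stage \<open>n + 1\<close> are both time 0, and are multiplied by lam^(n + 1).
  Stage \<open>n\<close> puts \<open>X\<close> on e_n and \<open>W\<close> on e_(n+1); stage
  \<open>n + 1\<close> puts \<open>V\<close> on e_(n+1) and \<open>Z\<close> on e_(n+2).\<close>

definition X :: "nat \<times> real \<Rightarrow> real" where "X p = lam * v (b (fst p) + snd p / lam)"
definition X1 :: "nat \<times> real \<Rightarrow> real" where "X1 p = v1 (b (fst p) + snd p / lam)"
definition X2 :: "nat \<times> real \<Rightarrow> real" where "X2 p = v2 (b (fst p) + snd p / lam) / lam"
definition W :: "nat \<times> real \<Rightarrow> real" where "W p = lam * w (b (fst p) + snd p / lam)"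
definition W1 :: "nat \<times> real \<Rightarrow> real" where "W1 p = w1 (b (fst p) + snd p / lam)"
definition W2 :: "nat \<times> real \<Rightarrow> real" where "W2 p = w2 (b (fst p) + snd p / lam) / lam"
definition V :: "nat \<times> real \<Rightarrow> real" where "V p = v (snd p - a (fst p))"
definition V1 :: "nat \<times> real \<Rightarrow> real" where "V1 p = v1 (snd p - a (fst p))"
definition V2 :: "nat \<times> real \<Rightarrow> real" where "V2 p = v2 (snd p - a (fst p))"
definition Z :: "nat \<times> real \<Rightarrow> real" where "Z p = w (snd p - a (fst p))"
definition Z1 :: "nat \<times> real \<Rightarrow> real" where "Z1 p = w1 (snd p - a (fst p))"
definition Z2 :: "nat \<times> real \<Rightarrow> real" where "Z2 p = w2 (snd p - a (fst p))"

definition \<sigma>a :: "nat \<times> real \<Rightarrow> real" where "\<sigma>a p = (X p)\<^sup>2 / lam\<^sup>2 + (W p)\<^sup>2"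
definition \<sigma>b :: "nat \<times> real \<Rightarrow> real" where "\<sigma>b p = (V p)\<^sup>2 + lam\<^sup>2 * (Z p)\<^sup>2"

lemma lam_pos: "lam > 0" using lam_gt_1 by simp

text \<open>In this clock \<open>W\<close> obeys y'' = - m y, and so does \<open>V\<close> below;
  only the arguments of \<open>m\<close> differ. Hence their difference is accessible to
  Gronwall.\<close>

lemma X_eq: "X2 p = - m (\<sigma>a p) * X p / lam\<^sup>2" and W_eq: "W2 p = - m (\<sigma>a p) * W p"
proof -
  have "\<sigma>a p = (v (b (fst p) + snd p / lam))\<^sup>2 + lam\<^sup>2 * (w (b (fst p) + snd p / lam))\<^sup>2"
    using lam_pos by (simp add: \<sigma>a_def X_def W_def power_mult_distrib)
  then show "X2 p = - m (\<sigma>a p) * X p / lam\<^sup>2" "W2 p = - m (\<sigma>a p) * W p"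
    using lam_pos by (auto simp: X2_def X_def W2_def W_def v_eq w_eq power2_eq_square)
qed

lemma V_eq: "V2 p = - m (\<sigma>b p) * V p" and Z_eq: "Z2 p = - lam\<^sup>2 * m (\<sigma>b p) * Z p"
  by (auto simp: V2_def V_def Z2_def Z_def \<sigma>b_def v_eq w_eq)

abbreviation window :: "(nat \<times> real) filter" where "window \<equiv> principal (UNIV \<times> {0..3})"

lemma small_X: "X \<in> O[window](\<lambda>p. \<delta> (fst p))" and small_X1: "X1 \<in> O[window](\<lambda>p. \<delta> (fst p))"
proof -
  have *: "b n + \<tau> / lam \<ge> 0" "exp (- (A0 / 2 * (b n + \<tau> / lam))) \<le> \<delta> n" if "0 \<le> \<tau>" for n \<tau>
  proof -
    have "b n + \<tau> / lam \<ge> L n" using b_ge[of n] that lam_pos divide_nonneg_pos[OF that lam_pos] by linarith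
    then show "b n + \<tau> / lam \<ge> 0" "exp (- (A0 / 2 * (b n + \<tau> / lam))) \<le> \<delta> n"
      using L_ge[of n] A0_pos by (auto simp: \<delta>_def)
  qed
  have "\<bar>X (n, \<tau>)\<bar> \<le> (lam * sqrt B0) * \<delta> n" "\<bar>X1 (n, \<tau>)\<bar> \<le> sqrt B0 * \<delta> n" if "0 \<le> \<tau>" for n \<tau>
  proof -
    have "\<bar>v (b n + \<tau> / lam)\<bar> \<le> sqrt B0 * \<delta> n" "\<bar>v1 (b n + \<tau> / lam)\<bar> \<le> sqrt B0 * \<delta> n"
      using v_decay'[OF *(1)[OF that, of n]] mult_left_mono[OF *(2)[OF that, of n], of "sqrt B0"] B0_pos
      by (auto intro: order.trans)
    then show "\<bar>X (n, \<tau>)\<bar> \<le> (lam * sqrt B0) * \<delta> n" "\<bar>X1 (n, \<tau>)\<bar> \<le> sqrt B0 * \<delta> n"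
      using lam_pos by (simp_all add: X_def X1_def abs_mult mult.assoc)
  qed
  then show "X \<in> O[window](\<lambda>p. \<delta> (fst p))" "X1 \<in> O[window](\<lambda>p. \<delta> (fst p))"
    using \<delta>_pos by (auto intro!: bigo_principalI simp: abs_of_pos)
qed

text \<open>Here the window runs against the decay: moving by up to 3 towards local time 0 costs the
  factor \<open>exp (A0 / 2 * 3)\<close>, and \<open>L_ge\<close> keeps the local time at most
  0.\<close>

lemma small_Z: "Z \<in> O[window](\<lambda>p. \<delta> (fst p))" and small_Z1: "Z1 \<in> O[window](\<lambda>p. \<delta> (fst p))"
proof -
  have *: "\<tau> - a n \<le> 0" "exp (A0 / 2 * (\<tau> - a n)) \<le> exp (A0 / 2 * 3) * \<delta> n" if "0 \<le> \<tau>" "\<tau> \<le> 3" for n \<tau>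
  proof -
    show "\<tau> - a n \<le> 0" using a_ge[of n] L_ge[of n] that by linarith
    have "A0 / 2 * (\<tau> - a n) \<le> A0 / 2 * (3 - L n)"
      using a_ge[of n] that A0_pos by (intro mult_left_mono) auto
    then have "exp (A0 / 2 * (\<tau> - a n)) \<le> exp (A0 / 2 * (3 - L n))" by simp
    also have "\<dots> = exp (A0 / 2 * 3) * \<delta> n"
      unfolding \<delta>_def by (simp add: algebra_simps flip: exp_add)
    finally show "exp (A0 / 2 * (\<tau> - a n)) \<le> exp (A0 / 2 * 3) * \<delta> n" .
  qed
  have "\<bar>Z (n, \<tau>)\<bar> \<le> (sqrt B0 * exp (A0 / 2 * 3)) * \<delta> n" "\<bar>Z1 (n, \<tau>)\<bar> \<le> (sqrt B0 * exp (A0 / 2 * 3)) * \<delta> n"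
    if "0 \<le> \<tau>" "\<tau> \<le> 3" for n \<tau>
  proof -
    have "sqrt B0 * exp (A0 / 2 * (\<tau> - a n)) \<le> (sqrt B0 * exp (A0 / 2 * 3)) * \<delta> n"
      using mult_left_mono[OF *(2)[OF that, of n], of "sqrt B0"] B0_pos by simp
    then show "\<bar>Z (n, \<tau>)\<bar> \<le> (sqrt B0 * exp (A0 / 2 * 3)) * \<delta> n" "\<bar>Z1 (n, \<tau>)\<bar> \<le> (sqrt B0 * exp (A0 / 2 * 3)) * \<delta> n"
      using w_decay'[OF *(1)[OF that, of n]] unfolding Z_def Z1_def fst_conv snd_conv by linarith+
  qed
  then show "Z \<in> O[window](\<lambda>p. \<delta> (fst p))" "Z1 \<in> O[window](\<lambda>p. \<delta> (fst p))"
    using \<delta>_pos by (auto intro!: bigo_principalI simp: abs_of_pos)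
qed

lemma \<delta>_bounded: "(\<lambda>p. \<delta> (fst p)) \<in> O[window](\<lambda>_. 1)"
proof -
  have "0 \<le> A0 * L n" for n using A0_pos L_ge[of n] by simp
  then show ?thesis by (intro bigo_principalI[of _ _ 1]) (auto simp: \<delta>_def)
qed

lemma small_imp_bounded: "f \<in> O[window](\<lambda>p. \<delta> (fst p)) \<Longrightarrow> f \<in> O[window](\<lambda>_. 1)"
  using landau_o.big_trans \<delta>_bounded by blast

lemma bounded_W: "W \<in> O[window](\<lambda>_. 1)" and bounded_V: "V \<in> O[window](\<lambda>_. 1)"
proof -
  show "W \<in> O[window](\<lambda>_. 1)"
    using bounds(2) lam_pos by (intro bigo_principalI[of _ _ "lam * sqrt (E0 / \<mu>1)"]) (auto simp: W_def abs_mult)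
  show "V \<in> O[window](\<lambda>_. 1)"
    using bounds(1) by (intro bigo_principalI[of _ _ "sqrt (E0 / \<mu>1)"]) (auto simp: V_def)
qed

lemma bounded_m:
  assumes "f \<in> O[principal S](\<lambda>_. 1)" "\<And>p. f p \<ge> 0"
  shows "(\<lambda>p. m (f p)) \<in> O[principal S](\<lambda>_. 1)"
proof -
  obtain C where C: "\<And>p. p \<in> S \<Longrightarrow> \<bar>f p\<bar> \<le> C" using bigo_principalD[OF assms(1)] by (metis abs_1 mult.right_neutral)
  obtain K where "\<forall>x\<in>{0..C}. \<bar>m x\<bar> \<le> K" using m_bounded by blast
  then show ?thesis using C assms(2) by (intro bigo_principalI[of _ _ K]) auto
qed

text \<open>\<open>m\<close> is Lipschitz only on compact intervals, so both arguments have to be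
  bounded uniformly over the set first.\<close>

lemma small_m_diff:
  assumes "f \<in> O[principal S](\<lambda>_. 1)" "\<And>p. f p \<ge> 0" "g \<in> O[principal S](\<lambda>_. 1)" "\<And>p. g p \<ge> 0"
    and "(\<lambda>p. f p - g p) \<in> O[principal S](h)"
  shows "(\<lambda>p. m (f p) - m (g p)) \<in> O[principal S](h)"
proof -
  obtain C where C: "\<And>p. p \<in> S \<Longrightarrow> \<bar>f p\<bar> \<le> C" using bigo_principalD[OF assms(1)] by (metis abs_1 mult.right_neutral)
  obtain C' where C': "\<And>p. p \<in> S \<Longrightarrow> \<bar>g p\<bar> \<le> C'" using bigo_principalD[OF assms(3)] by (metis abs_1 mult.right_neutral)
  obtain K where K: "\<forall>x\<in>{0..max C C'}. \<forall>y\<in>{0..max C C'}. \<bar>m x - m y\<bar> \<le> K * \<bar>x - y\<bar>"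
    using m_lipschitz by blast
  have "(\<lambda>p. m (f p) - m (g p)) \<in> O[principal S](\<lambda>p. f p - g p)"
  proof (rule bigo_principalI)
    fix p assume p: "p \<in> S"
    have "f p \<in> {0..max C C'}" "g p \<in> {0..max C C'}" using C[OF p] C'[OF p] assms(2,4)[of p] by auto
    then show "\<bar>m (f p) - m (g p)\<bar> \<le> K * \<bar>f p - g p\<bar>" using K by blast
  qed
  then show ?thesis using assms(5) landau_o.big_trans by blast
qed

lemma bounded_\<sigma>: "\<sigma>a \<in> O[window](\<lambda>_. 1)" "\<sigma>b \<in> O[window](\<lambda>_. 1)"
  and \<sigma>_nonneg: "\<sigma>a p \<ge> 0" "\<sigma>b p \<ge> 0"
proof -
  note b = small_imp_bounded[OF small_X] small_imp_bounded[OF small_Z] bounded_W bounded_V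
  have "(\<lambda>p. (1 / lam\<^sup>2) * (X p * X p) + W p * W p) \<in> O[window](\<lambda>_. 1)"
    by (intro sum_in_bigo bigo_bounded_mult bigo_const b)
  then show "\<sigma>a \<in> O[window](\<lambda>_. 1)" by (simp add: \<sigma>a_def[abs_def] power2_eq_square)
  have "(\<lambda>p. V p * V p + lam\<^sup>2 * (Z p * Z p)) \<in> O[window](\<lambda>_. 1)"
    by (intro sum_in_bigo bigo_bounded_mult bigo_const b)
  then show "\<sigma>b \<in> O[window](\<lambda>_. 1)" by (simp add: \<sigma>b_def[abs_def] power2_eq_square)
qed (simp_all add: \<sigma>a_def \<sigma>b_def)

lemma small_X2: "X2 \<in> O[window](\<lambda>p. \<delta> (fst p))"
proof -
  have "(\<lambda>p. (- 1 / lam\<^sup>2) * (m (\<sigma>a p) * X p)) \<in> O[window](\<lambda>p. \<delta> (fst p))"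
    by (intro bigo_bounded_mult bigo_const bounded_m bounded_\<sigma> \<sigma>_nonneg small_X)
  then show ?thesis by (simp add: X_eq[abs_def])
qed

lemma small_Z2: "Z2 \<in> O[window](\<lambda>p. \<delta> (fst p))"
proof -
  have "(\<lambda>p. (- lam\<^sup>2) * (m (\<sigma>b p) * Z p)) \<in> O[window](\<lambda>p. \<delta> (fst p))"
    by (intro bigo_bounded_mult bigo_const bounded_m bounded_\<sigma> \<sigma>_nonneg small_Z)
  then show ?thesis by (simp add: Z_eq[abs_def] mult.assoc)
qed

section \<open>Mismatch of the two profiles of the shared mode\<close>

definition D :: "nat \<times> real \<Rightarrow> real" where "D p = V p - W p"
definition D1 :: "nat \<times> real \<Rightarrow> real" where "D1 p = V1 p - W1 p"
definition D2 :: "nat \<times> real \<Rightarrow> real" where "D2 p = V2 p - W2 p"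

text \<open>Subtracting the equations leaves a multiple of \<open>D\<close> and the difference of
  two values of \<open>m\<close>. Their arguments differ by (V + W) D plus squares of the small
  profiles \<open>X\<close> and \<open>Z\<close>.\<close>

lemma D2_bound: "D2 \<in> O[window](\<lambda>p. \<bar>D p\<bar> + \<delta> (fst p))"
proof -
  let ?h = "\<lambda>p. \<bar>D p\<bar> + \<delta> (fst p)"
  have D: "D \<in> O[window](?h)"
    using \<delta>_pos by (intro bigo_principalI[of _ _ 1]) (auto simp: abs_of_nonneg add_nonneg_nonneg less_imp_le)
  have \<delta>: "(\<lambda>p. \<delta> (fst p)) \<in> O[window](?h)"
    using \<delta>_pos by (intro bigo_principalI[of _ _ 1]) (auto simp: abs_of_nonneg add_nonneg_nonneg less_imp_le)
  note b = small_imp_bounded[OF small_X] small_imp_bounded[OF small_Z] bounded_W bounded_V bounded_\<sigma> \<sigma>_nonneg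
  have X: "X \<in> O[window](?h)" and Z: "Z \<in> O[window](?h)"
    using landau_o.big_trans[OF _ \<delta>] small_X small_Z by blast+
  have "(\<lambda>p. (V p + W p) * D p + (lam\<^sup>2 * (Z p * Z p) - (1 / lam\<^sup>2) * (X p * X p))) \<in> O[window](?h)"
    by (intro sum_in_bigo bigo_bounded_mult bigo_const D X Z b)
  moreover have "(V p + W p) * D p + (lam\<^sup>2 * (Z p * Z p) - (1 / lam\<^sup>2) * (X p * X p)) = \<sigma>b p - \<sigma>a p" for p
    by (simp add: D_def \<sigma>a_def \<sigma>b_def power2_eq_square algebra_simps)
  ultimately have "(\<lambda>p. \<sigma>b p - \<sigma>a p) \<in> O[window](?h)" by simp
  define q where "q p = m (\<sigma>b p) - m (\<sigma>a p)" for p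
  from \<open>(\<lambda>p. \<sigma>b p - \<sigma>a p) \<in> O[window](?h)\<close> have "q \<in> O[window](?h)"
    unfolding q_def[abs_def] by (intro small_m_diff b)
  then have "(\<lambda>p. - 1 * (V p * q p + m (\<sigma>a p) * D p)) \<in> O[window](?h)"
    by (intro sum_in_bigo bigo_bounded_mult bigo_const bounded_m D b)
  moreover have "- 1 * (V p * q p + m (\<sigma>a p) * D p) = D2 p" for p
    by (simp add: q_def D_def D2_def V_eq W_eq algebra_simps)
  ultimately show ?thesis by simp
qed

text \<open>Both profiles vanish at window time 0. Their squared slopes equal E0 up to order
  \<delta>^2, and extracting the root leaves an error of order \<delta>.\<close>

lemma D_initial: "D (n, 0) = 0" "\<exists>C\<ge>0. \<forall>n. \<bar>D1 (n, 0)\<bar> \<le> C * \<delta> n"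
proof -
  show "D (n, 0) = 0" by (simp add: D_def V_def W_def a_zero b_zero)
  obtain K where K: "K > 0" "\<And>t. t \<ge> 0 \<Longrightarrow> w t = 0 \<Longrightarrow> \<bar>(w1 t)\<^sup>2 - E0\<bar> \<le> K * exp (- A0 * t)"
    "\<And>t. t \<le> 0 \<Longrightarrow> v t = 0 \<Longrightarrow> \<bar>(v1 t)\<^sup>2 - E0\<bar> \<le> K * exp (A0 * t)"
    using energy_at_zeros by blast
  have "\<bar>D1 (n, 0)\<bar> \<le> sqrt (2 * K) * \<delta> n" for n
  proof -
    have d2: "(\<delta> n)\<^sup>2 = exp (- A0 * L n)" by (simp add: \<delta>_def flip: exp_double)
    have 1: "\<bar>(w1 (b n))\<^sup>2 - E0\<bar> \<le> K * (\<delta> n)\<^sup>2"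
    proof -
      have "exp (- A0 * b n) \<le> (\<delta> n)\<^sup>2" unfolding d2 using b_ge A0_pos by simp
      then show ?thesis using K(2)[of "b n"] b_zero L_ge[of n] b_ge[of n] K(1)
        by (meson mult_left_mono less_imp_le order.trans zero_le_numeral)
    qed
    have 2: "\<bar>(v1 (- a n))\<^sup>2 - E0\<bar> \<le> K * (\<delta> n)\<^sup>2"
    proof -
      have "exp (A0 * - a n) \<le> (\<delta> n)\<^sup>2" unfolding d2 using a_ge A0_pos by simp
      moreover have "- a n \<le> 0" using a_ge[of n] L_ge[of n] by linarith
      ultimately show ?thesis using K(3)[of "- a n"] a_zero K(1)
        by (meson mult_left_mono less_imp_le order.trans)
    qed
    define x y where "x = v1 (- a n)" and "y = w1 (b n)"
    \<comment> \<open>Both slopes are positive, so |x - y| is at most |x + y|; multiplying by |x -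
      y| gives the difference of squares. This is where the common sign of the slopes
      enters.\<close>
    have "(x - y)\<^sup>2 \<le> \<bar>x\<^sup>2 - y\<^sup>2\<bar>"
    proof -
      have "\<bar>x - y\<bar> \<le> \<bar>x + y\<bar>" using a_zero(2)[of n] b_zero(2)[of n] by (simp add: x_def y_def)
      then have "\<bar>x - y\<bar> * \<bar>x - y\<bar> \<le> \<bar>x + y\<bar> * \<bar>x - y\<bar>" by (intro mult_right_mono) auto
      also have "\<dots> = \<bar>x\<^sup>2 - y\<^sup>2\<bar>" by (simp add: power2_eq_square algebra_simps flip: abs_mult)
      finally show ?thesis by (simp add: power2_eq_square)
    qed
    also have "\<dots> \<le> 2 * K * (\<delta> n)\<^sup>2" using 1 2 unfolding x_def y_def by linarith
    also have "\<dots> = (sqrt (2 * K) * \<delta> n)\<^sup>2" using K(1) by (simp add: power_mult_distrib)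
    finally have "\<bar>x - y\<bar> \<le> \<bar>sqrt (2 * K) * \<delta> n\<bar>" by (simp add: abs_le_square_iff)
    then show ?thesis using K(1) \<delta>_pos[of n] by (simp add: D1_def V1_def W1_def x_def y_def abs_mult)
  qed
  then show "\<exists>C\<ge>0. \<forall>n. \<bar>D1 (n, 0)\<bar> \<le> C * \<delta> n" using K(1) by (intro exI[of _ "sqrt (2 * K)"]) auto
qed

lemma dD: "((\<lambda>\<tau>. D (n, \<tau>)) has_real_derivative D1 (n, \<tau>)) (at \<tau>)"
  and dD1: "((\<lambda>\<tau>. D1 (n, \<tau>)) has_real_derivative D2 (n, \<tau>)) (at \<tau>)"
proof -
  have 1: "((\<lambda>\<tau>. b n + \<tau> / lam) has_real_derivative 1 / lam) (at \<tau>)"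
    using lam_pos by (auto intro!: derivative_eq_intros)
  have 2: "((\<lambda>\<tau>. \<tau> - a n) has_real_derivative 1) (at \<tau>)"
    by (auto intro!: derivative_eq_intros)
  show "((\<lambda>\<tau>. D (n, \<tau>)) has_real_derivative D1 (n, \<tau>)) (at \<tau>)"
    using DERIV_diff[OF DERIV_chain2[OF dv 2] DERIV_cmult[OF DERIV_chain2[OF dw 1], of lam]] lam_pos
    by (simp add: D_def D1_def V_def W_def V1_def W1_def)
  show "((\<lambda>\<tau>. D1 (n, \<tau>)) has_real_derivative D2 (n, \<tau>)) (at \<tau>)"
    using DERIV_diff[OF DERIV_chain2[OF dv1 2] DERIV_chain2[OF dw1 1]]
    by (simp add: D1_def D2_def V1_def W1_def V2_def W2_def)
qed

text \<open>Gronwall on the window. Its length 3 is the same for all \<open>n\<close>, so the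
  exponential factor does not depend on the stage.\<close>

lemma small_D: "D \<in> O[window](\<lambda>p. \<delta> (fst p))" and small_D1: "D1 \<in> O[window](\<lambda>p. \<delta> (fst p))"
  and small_D2: "D2 \<in> O[window](\<lambda>p. \<delta> (fst p))"
proof -
  obtain C where C: "C > 0" "\<And>p. p \<in> UNIV \<times> {0..3} \<Longrightarrow> \<bar>D2 p\<bar> \<le> C * \<bar>\<bar>D p\<bar> + \<delta> (fst p)\<bar>"
    using bigo_principalD[OF D2_bound] by blast
  obtain C' where C': "C' \<ge> 0" "\<And>n. \<bar>D1 (n, 0)\<bar> \<le> C' * \<delta> n" using D_initial(2) by blast
  \<comment> \<open>One constant has to bound both the source term and the initial slope, hence the
    maximum.\<close>
  define c where "c = max C C'"
  define K where "K = c * sqrt (2 * exp ((C + 2) * 3))"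
  have le: "C * \<delta> n \<le> c * \<delta> n" "C' * \<delta> n \<le> c * \<delta> n" for n using \<delta>_pos[of n] by (auto simp: c_def intro: mult_right_mono)
  have c0: "c * \<delta> n \<ge> 0" for n using C(1) \<delta>_pos[of n] by (simp add: c_def le_max_iff_disj)
  have D2: "\<bar>D2 (n, \<tau>)\<bar> \<le> C * \<bar>D (n, \<tau>)\<bar> + c * \<delta> n" if "0 \<le> \<tau>" "\<tau> \<le> 3" for n \<tau>
    proof -
    have "\<bar>D2 (n, \<tau>)\<bar> \<le> C * \<bar>D (n, \<tau>)\<bar> + C * \<delta> n"
      using C(2)[of "(n, \<tau>)"] that \<delta>_pos[of n] by (simp add: abs_of_nonneg distrib_left)
    then show ?thesis using le(1)[of n] by linarith
  qed
  have "\<bar>D (n, \<tau>)\<bar> \<le> K * \<delta> n" "\<bar>D1 (n, \<tau>)\<bar> \<le> K * \<delta> n" if "0 \<le> \<tau>" "\<tau> \<le> 3" for n \<tau>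
    using second_order_gronwall[OF dD dD1 D2 _ c0 D_initial(1) order.trans[OF C'(2) le(2)] that] C(1)
    by (auto simp: K_def mult_ac)
  then show D: "D \<in> O[window](\<lambda>p. \<delta> (fst p))" and "D1 \<in> O[window](\<lambda>p. \<delta> (fst p))"
    using \<delta>_pos by (auto intro!: bigo_principalI[of _ _ K] simp: abs_of_pos)
  have "(\<lambda>p. \<bar>D p\<bar> + \<delta> (fst p)) \<in> O[window](\<lambda>p. \<delta> (fst p))"
    using D by (intro sum_in_bigo) auto
  with D2_bound show "D2 \<in> O[window](\<lambda>p. \<delta> (fst p))" by (rule landau_o.big_trans)
qed

text \<open>In the local time \<open>\<tau>\<close> of a window, \<open>x\<close>, \<open>y\<close> and \<open>z\<close> are the rescaled modes that fade
  out, persist and fade in; the digit counts derivatives.\<close>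

definition x0 :: "nat \<times> real \<Rightarrow> real" where "x0 p = (1 - cutoff (snd p)) * X p"
definition x2 :: "nat \<times> real \<Rightarrow> real" where
  "x2 p = - cutoff2 (snd p) * X p - 2 * (cutoff1 (snd p) * X1 p) + (1 - cutoff (snd p)) * X2 p"
definition y0 :: "nat \<times> real \<Rightarrow> real" where "y0 p = W p + cutoff (snd p) * D p"
definition y1 :: "nat \<times> real \<Rightarrow> real" where "y1 p = W1 p + cutoff1 (snd p) * D p + cutoff (snd p) * D1 p"
definition y2 :: "nat \<times> real \<Rightarrow> real" where
  "y2 p = W2 p + cutoff2 (snd p) * D p + 2 * (cutoff1 (snd p) * D1 p) + cutoff (snd p) * D2 p"
definition z0 :: "nat \<times> real \<Rightarrow> real" where "z0 p = cutoff (snd p) * Z p"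
definition z2 :: "nat \<times> real \<Rightarrow> real" where
  "z2 p = cutoff2 (snd p) * Z p + 2 * (cutoff1 (snd p) * Z1 p) + cutoff (snd p) * Z2 p"
definition \<sigma> :: "nat \<times> real \<Rightarrow> real" where
  "\<sigma> p = (x0 p)\<^sup>2 / lam\<^sup>2 + (y0 p)\<^sup>2 + lam\<^sup>2 * (z0 p)\<^sup>2"

lemma bounded_cutoff: "(\<lambda>p. cutoff (snd p)) \<in> O[window](\<lambda>_. 1)" "(\<lambda>p. cutoff1 (snd p)) \<in> O[window](\<lambda>_. 1)"
  "(\<lambda>p. cutoff2 (snd p)) \<in> O[window](\<lambda>_. 1)"
proof -
  have "(\<lambda>p. f (snd p)) \<in> O[window](\<lambda>_. 1)" if "continuous_on UNIV f" for f :: "real \<Rightarrow> real"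
  proof -
    have "bounded (f ` {0..3})"
      using that by (intro compact_imp_bounded compact_continuous_image) (auto intro: continuous_on_subset)
    then obtain C where "\<forall>x\<in>{0..3}. \<bar>f x\<bar> \<le> C" by (auto simp: bounded_iff)
    then show ?thesis by (intro bigo_principalI[of _ _ C]) auto
  qed
  then show "(\<lambda>p. cutoff (snd p)) \<in> O[window](\<lambda>_. 1)" "(\<lambda>p. cutoff1 (snd p)) \<in> O[window](\<lambda>_. 1)"
    "(\<lambda>p. cutoff2 (snd p)) \<in> O[window](\<lambda>_. 1)"
    using C2_cutoff C1_on_imp_continuous by (auto simp: C2_on_def C1_on_def)
qed

lemma bounded_one_minus_cutoff: "(\<lambda>p. 1 - cutoff (snd p)) \<in> O[window](\<lambda>_. 1)"
  by (intro sum_in_bigo bounded_cutoff) auto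

lemma window_small:
  "x0 \<in> O[window](\<lambda>p. \<delta> (fst p))" "z0 \<in> O[window](\<lambda>p. \<delta> (fst p))"
  "x2 \<in> O[window](\<lambda>p. \<delta> (fst p))" "z2 \<in> O[window](\<lambda>p. \<delta> (fst p))"
proof -
  note small = small_X small_X1 small_X2 small_Z small_Z1 small_Z2
  show "x0 \<in> O[window](\<lambda>p. \<delta> (fst p))" unfolding x0_def[abs_def]
    by (intro bigo_bounded_mult bounded_one_minus_cutoff small)
  show "z0 \<in> O[window](\<lambda>p. \<delta> (fst p))" unfolding z0_def[abs_def]
    by (intro bigo_bounded_mult bounded_cutoff small)
  have "(\<lambda>p. (1 - cutoff (snd p)) * X2 p - (cutoff2 (snd p) * X p + 2 * (cutoff1 (snd p) * X1 p))) \<in> O[window](\<lambda>p. \<delta> (fst p))"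
    by (intro sum_in_bigo bigo_bounded_mult bounded_cutoff bounded_one_minus_cutoff bigo_const small)
  then show "x2 \<in> O[window](\<lambda>p. \<delta> (fst p))" by (simp add: x2_def[abs_def] algebra_simps)
  show "z2 \<in> O[window](\<lambda>p. \<delta> (fst p))" unfolding z2_def[abs_def]
    by (intro sum_in_bigo bigo_bounded_mult bounded_cutoff bigo_const small)
qed

lemma \<sigma>_window_nonneg: "\<sigma> p \<ge> 0" by (simp add: \<sigma>_def)

lemma bounded_\<sigma>_window: "\<sigma> \<in> O[window](\<lambda>_. 1)"
proof -
  note b = window_small(1,2)[THEN small_imp_bounded] small_imp_bounded[OF small_D] bounded_W bounded_cutoff
  have y0: "y0 \<in> O[window](\<lambda>_. 1)" unfolding y0_def[abs_def]
    by (intro sum_in_bigo bigo_bounded_mult b)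
  have "(\<lambda>p. (1 / lam\<^sup>2) * (x0 p * x0 p) + y0 p * y0 p + lam\<^sup>2 * (z0 p * z0 p)) \<in> O[window](\<lambda>_. 1)"
    by (intro sum_in_bigo bigo_bounded_mult bigo_const b y0)
  then show ?thesis by (simp add: \<sigma>_def[abs_def] power2_eq_square)
qed

text \<open>For the modes that fade out or in, every term is already small. The shared profile is
  written as \<open>W\<close> plus a cutoff times \<open>D\<close>: the equation of \<open>W\<close>
  cancels its large part up to the change in the argument of \<open>m\<close>, and the cutoff
  derivatives multiply only \<open>D\<close> and \<open>D1\<close>.\<close>

lemma residual_small:
  "(\<lambda>p. x2 p + m (\<sigma> p) * x0 p / lam\<^sup>2) \<in> O[window](\<lambda>p. \<delta> (fst p))"
  "(\<lambda>p. y2 p + m (\<sigma> p) * y0 p) \<in> O[window](\<lambda>p. \<delta> (fst p))"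
  "(\<lambda>p. z2 p + lam\<^sup>2 * m (\<sigma> p) * z0 p) \<in> O[window](\<lambda>p. \<delta> (fst p))"
proof -
  note m = bounded_m[OF bounded_\<sigma>_window \<sigma>_window_nonneg]
  have "(\<lambda>p. x2 p + (1 / lam\<^sup>2) * (m (\<sigma> p) * x0 p)) \<in> O[window](\<lambda>p. \<delta> (fst p))"
    by (intro sum_in_bigo bigo_bounded_mult bigo_const window_small m)
  then show "(\<lambda>p. x2 p + m (\<sigma> p) * x0 p / lam\<^sup>2) \<in> O[window](\<lambda>p. \<delta> (fst p))" by simp
  have "(\<lambda>p. z2 p + lam\<^sup>2 * (m (\<sigma> p) * z0 p)) \<in> O[window](\<lambda>p. \<delta> (fst p))"
    by (intro sum_in_bigo bigo_bounded_mult bigo_const window_small m)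
  then show "(\<lambda>p. z2 p + lam\<^sup>2 * m (\<sigma> p) * z0 p) \<in> O[window](\<lambda>p. \<delta> (fst p))" by (simp add: mult.assoc)
  note small = small_X small_Z small_D small_D1 small_D2 window_small(1,2)
  note b = small_D[THEN small_imp_bounded] small_X[THEN small_imp_bounded] window_small(1,2)[THEN small_imp_bounded]
    bounded_W bounded_cutoff
  have "(\<lambda>p. (1 / lam\<^sup>2) * (x0 p * x0 p) + ((W p + W p + cutoff (snd p) * D p) * (cutoff (snd p) * D p) +
      lam\<^sup>2 * (z0 p * z0 p)) - (1 / lam\<^sup>2) * (X p * X p)) \<in> O[window](\<lambda>p. \<delta> (fst p))"
    by (intro sum_in_bigo bigo_bounded_mult bigo_const small b)
  moreover have "(1 / lam\<^sup>2) * (x0 p * x0 p) + ((W p + W p + cutoff (snd p) * D p) * (cutoff (snd p) * D p) +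
      lam\<^sup>2 * (z0 p * z0 p)) - (1 / lam\<^sup>2) * (X p * X p) = \<sigma> p - \<sigma>a p" for p
    by (simp add: \<sigma>_def \<sigma>a_def y0_def power2_eq_square algebra_simps)
  ultimately have "(\<lambda>p. \<sigma> p - \<sigma>a p) \<in> O[window](\<lambda>p. \<delta> (fst p))" by simp
  define q where "q p = m (\<sigma> p) - m (\<sigma>a p)" for p
  from \<open>(\<lambda>p. \<sigma> p - \<sigma>a p) \<in> O[window](\<lambda>p. \<delta> (fst p))\<close>
  have "q \<in> O[window](\<lambda>p. \<delta> (fst p))" unfolding q_def[abs_def]
    by (intro small_m_diff bounded_\<sigma>_window bounded_\<sigma> \<sigma>_window_nonneg \<sigma>_nonneg)
  then have "(\<lambda>p. W p * q p + (cutoff2 (snd p) * D p + 2 * (cutoff1 (snd p) * D1 p) +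
      cutoff (snd p) * (D2 p + m (\<sigma> p) * D p))) \<in> O[window](\<lambda>p. \<delta> (fst p))"
    by (intro sum_in_bigo bigo_bounded_mult bigo_const small b m)
  moreover have "W p * q p + (cutoff2 (snd p) * D p + 2 * (cutoff1 (snd p) * D1 p) +
      cutoff (snd p) * (D2 p + m (\<sigma> p) * D p)) = y2 p + m (\<sigma> p) * y0 p" for p
    by (simp add: q_def y2_def y0_def W_eq algebra_simps)
  ultimately show "(\<lambda>p. y2 p + m (\<sigma> p) * y0 p) \<in> O[window](\<lambda>p. \<delta> (fst p))" by simp
qed

text \<open>Once the cutoff equals 1, only stage \<open>n + 1\<close> remains, and it is an exact
  solution.\<close>

lemma residual_zero:
  assumes "snd p \<ge> 3"
  shows "x2 p + m (\<sigma> p) * x0 p / lam\<^sup>2 = 0" "y2 p + m (\<sigma> p) * y0 p = 0"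
    "z2 p + lam\<^sup>2 * m (\<sigma> p) * z0 p = 0"
proof -
  have "\<sigma> p = \<sigma>b p" by (simp add: \<sigma>_def \<sigma>b_def x0_def y0_def z0_def D_def cutoff_right assms)
  then show "x2 p + m (\<sigma> p) * x0 p / lam\<^sup>2 = 0" "y2 p + m (\<sigma> p) * y0 p = 0"
    "z2 p + lam\<^sup>2 * m (\<sigma> p) * z0 p = 0"
    by (simp_all add: x0_def x2_def y0_def y2_def z0_def z2_def D_def D2_def cutoff_right assms V_eq Z_eq)
qed

lemma residual_bound:
  "\<exists>C>0. \<forall>n \<tau>. \<tau> \<ge> 0 \<longrightarrow>
     \<bar>x2 (n, \<tau>) + m (\<sigma> (n, \<tau>)) * x0 (n, \<tau>) / lam\<^sup>2\<bar> \<le> C * \<delta> n \<and>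
     \<bar>y2 (n, \<tau>) + m (\<sigma> (n, \<tau>)) * y0 (n, \<tau>)\<bar> \<le> C * \<delta> n \<and>
     \<bar>z2 (n, \<tau>) + lam\<^sup>2 * m (\<sigma> (n, \<tau>)) * z0 (n, \<tau>)\<bar> \<le> C * \<delta> n"
proof -
  have *: "\<exists>C>0. \<forall>n \<tau>. \<tau> \<ge> 0 \<longrightarrow> \<bar>f (n, \<tau>)\<bar> \<le> C * \<delta> n"
    if f: "f \<in> O[window](\<lambda>p. \<delta> (fst p))" "\<And>p. snd p \<ge> 3 \<Longrightarrow> f p = 0" for f
  proof -
    obtain C where C: "C > 0" "\<And>p. p \<in> UNIV \<times> {0..3} \<Longrightarrow> \<bar>f p\<bar> \<le> C * \<bar>\<delta> (fst p)\<bar>"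
      using bigo_principalD[OF f(1)] by blast
    have "\<bar>f (n, \<tau>)\<bar> \<le> C * \<delta> n" if "\<tau> \<ge> 0" for n \<tau>
      using C(1) C(2)[of "(n, \<tau>)"] f(2)[of "(n, \<tau>)"] that \<delta>_pos[of n]
      by (cases "\<tau> \<le> 3") (auto simp: abs_of_pos)
    then show ?thesis using C(1) by blast
  qed
  obtain Cx where Cx: "\<forall>n \<tau>. \<tau> \<ge> 0 \<longrightarrow> \<bar>x2 (n, \<tau>) + m (\<sigma> (n, \<tau>)) * x0 (n, \<tau>) / lam\<^sup>2\<bar> \<le> Cx * \<delta> n"
    using *[OF residual_small(1) residual_zero(1)] by blast
  obtain Cy where Cy: "\<forall>n \<tau>. \<tau> \<ge> 0 \<longrightarrow> \<bar>y2 (n, \<tau>) + m (\<sigma> (n, \<tau>)) * y0 (n, \<tau>)\<bar> \<le> Cy * \<delta> n"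
    using *[OF residual_small(2) residual_zero(2)] by blast
  obtain Cz where Cz: "Cz > 0" "\<forall>n \<tau>. \<tau> \<ge> 0 \<longrightarrow> \<bar>z2 (n, \<tau>) + lam\<^sup>2 * m (\<sigma> (n, \<tau>)) * z0 (n, \<tau>)\<bar> \<le> Cz * \<delta> n"
    using *[OF residual_small(3) residual_zero(3)] by blast
  define C where "C = max Cx (max Cy Cz)"
  have "Cx * \<delta> n \<le> C * \<delta> n" "Cy * \<delta> n \<le> C * \<delta> n" "Cz * \<delta> n \<le> C * \<delta> n" for n
    using \<delta>_pos[of n] by (auto simp: C_def intro!: mult_right_mono)
  then have "\<forall>n \<tau>. \<tau> \<ge> 0 \<longrightarrow>
     \<bar>x2 (n, \<tau>) + m (\<sigma> (n, \<tau>)) * x0 (n, \<tau>) / lam\<^sup>2\<bar> \<le> C * \<delta> n \<and>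
     \<bar>y2 (n, \<tau>) + m (\<sigma> (n, \<tau>)) * y0 (n, \<tau>)\<bar> \<le> C * \<delta> n \<and>
     \<bar>z2 (n, \<tau>) + lam\<^sup>2 * m (\<sigma> (n, \<tau>)) * z0 (n, \<tau>)\<bar> \<le> C * \<delta> n"
    using Cx Cy Cz(2) by (meson order.trans)
  moreover have "C > 0" using Cz(1) by (simp add: C_def less_max_iff_disj)
  ultimately show ?thesis by blast
qed

end

section \<open>The chain of modes\<close>

lemma C2_on_cmult: "C2_on UNIV f f1 f2 \<Longrightarrow> C2_on UNIV (\<lambda>t. c * f t) (\<lambda>t. c * f1 t) (\<lambda>t. c * f2 t)"
  by (simp add: C2_on_def C1_on_def DERIV_cmult continuous_on_mult)

context heteroclinic_chain
begin

text \<open>The real time at which stage \<open>n\<close> is left. Stage \<open>i + 1\<close> runs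
  from local time - a i to b (i + 1) at speed lam^(i + 1); real time 0 is the end of stage
  0.\<close>

definition S :: "nat \<Rightarrow> real" where "S n = (\<Sum>i<n. (a i + b (Suc i)) / lam ^ Suc i)"

lemma S_0: "S 0 = 0" by (simp add: S_def)

lemma S_Suc: "S (Suc n) = S n + (a n + b (Suc n)) / lam ^ Suc n" by (simp add: S_def)

text \<open>The window opened at \<open>S n\<close> closes before the next one opens, so no more
  than two stages are ever mixed.\<close>

lemma S_gap: "S n + 3 / lam ^ Suc n \<le> S (Suc n)"
proof -
  have "3 \<le> a n + b (Suc n)" using a_ge[of n] b_ge[of "Suc n"] L_ge[of n] L_ge[of "Suc n"] by linarith
  then have "3 / lam ^ Suc n \<le> (a n + b (Suc n)) / lam ^ Suc n" using lam_pos by (intro divide_right_mono) auto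
  then show ?thesis by (simp add: S_Suc)
qed

lemma strict_mono_S: "strict_mono S"
proof (rule strict_mono_Suc_iff[THEN iffD2, rule_format])
  fix n
  have "0 < 3 / lam ^ Suc n" using lam_pos by simp
  then show "S n < S (Suc n)" using S_gap[of n] by linarith
qed

lemma S_mono: "i \<le> j \<Longrightarrow> S i \<le> S j"
  using strict_mono_S by (simp add: strict_mono_less_eq)

text \<open>The window clock, in the form a * t + b that \<open>C2_on_affine\<close>
  matches.\<close>

definition tau :: "nat \<Rightarrow> real \<Rightarrow> real" where "tau k t = lam ^ Suc k * t + - (lam ^ Suc k * S k)"

lemma tau_eq: "tau k t = lam ^ Suc k * (t - S k)" by (simp add: tau_def right_diff_distrib)

lemma tau_ge: "S n \<le> t \<Longrightarrow> k < n \<Longrightarrow> tau k t \<ge> 3"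
proof -
  assume "S n \<le> t" "k < n"
  then have "3 / lam ^ Suc k \<le> t - S k" using S_mono[of "Suc k" n] S_gap[of k] by simp
  then show ?thesis using lam_pos by (simp only: tau_eq) (simp add: field_simps)
qed

lemma tau_le: "t \<le> S n \<Longrightarrow> n \<le> k \<Longrightarrow> tau k t \<le> 0"
  using S_mono[of n k] lam_pos by (simp add: tau_eq mult_le_0_iff)

lemma tau_nonneg: "S n \<le> t \<Longrightarrow> tau n t \<ge> 0"
  using lam_pos by (simp add: tau_eq)

definition eta0 :: "nat \<Rightarrow> real \<Rightarrow> real" where "eta0 k t = cutoff (tau k t)"
definition eta1 :: "nat \<Rightarrow> real \<Rightarrow> real" where "eta1 k t = lam ^ Suc k * cutoff1 (tau k t)"
definition eta2 :: "nat \<Rightarrow> real \<Rightarrow> real" where "eta2 k t = (lam ^ Suc k)\<^sup>2 * cutoff2 (tau k t)"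

lemma C2_eta: "C2_on UNIV (eta0 k) (eta1 k) (eta2 k)"
  unfolding eta0_def[abs_def] eta1_def[abs_def] eta2_def[abs_def] tau_def
  by (rule C2_on_affine[OF C2_cutoff])

lemma eta_late: "tau k t \<ge> 3 \<Longrightarrow> eta0 k t = 1 \<and> eta1 k t = 0 \<and> eta2 k t = 0"
  by (simp add: eta0_def eta1_def eta2_def cutoff_right)

lemma eta_early: "tau k t \<le> 0 \<Longrightarrow> eta0 k t = 0 \<and> eta1 k t = 0 \<and> eta2 k t = 0"
  by (simp add: eta0_def eta1_def eta2_def cutoff_left)

text \<open>Telescoping differences of the cutoffs: a partition of unity with \<open>rho0 k\<close>
  the weight of stage \<open>k\<close>. The value 1 for \<open>k = 0\<close> stands for a cutoff
  that is already complete.\<close>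

definition rho0 :: "nat \<Rightarrow> real \<Rightarrow> real" where "rho0 k t = (case k of 0 \<Rightarrow> 1 | Suc j \<Rightarrow> eta0 j t) - eta0 k t"
definition rho1 :: "nat \<Rightarrow> real \<Rightarrow> real" where "rho1 k t = (case k of 0 \<Rightarrow> 0 | Suc j \<Rightarrow> eta1 j t) - eta1 k t"
definition rho2 :: "nat \<Rightarrow> real \<Rightarrow> real" where "rho2 k t = (case k of 0 \<Rightarrow> 0 | Suc j \<Rightarrow> eta2 j t) - eta2 k t"

lemma C2_rho: "C2_on UNIV (rho0 k) (rho1 k) (rho2 k)"
  unfolding rho0_def[abs_def] rho1_def[abs_def] rho2_def[abs_def]
  by (rule C2_on_diff[OF _ C2_eta]) (cases k, simp_all add: C2_on_const C2_eta)

section \<open>Coefficients of the modes and their supports in time\<close>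

definition loc :: "nat \<Rightarrow> real \<Rightarrow> real" where "loc k t = lam ^ k * t + (b k - lam ^ k * S k)"

text \<open>The weighted share of stage \<open>k\<close> in e_k; \<open>q0 k\<close> is its share in
  e_(k+1). The uncancelled powers of \<open>lam\<close> are the shape that the C2 rules for
  products, multiples and affine substitutions produce.\<close>

definition p0 :: "nat \<Rightarrow> real \<Rightarrow> real" where "p0 k t = rho0 k t * (1 / lam ^ k * v (loc k t))"
definition p1 :: "nat \<Rightarrow> real \<Rightarrow> real" where
  "p1 k t = rho1 k t * (1 / lam ^ k * v (loc k t)) + rho0 k t * (1 / lam ^ k * (lam ^ k * v1 (loc k t)))"
definition p2 :: "nat \<Rightarrow> real \<Rightarrow> real" where
  "p2 k t = rho2 k t * (1 / lam ^ k * v (loc k t)) + 2 * (rho1 k t * (1 / lam ^ k * (lam ^ k * v1 (loc k t))))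
     + rho0 k t * (1 / lam ^ k * ((lam ^ k)\<^sup>2 * v2 (loc k t)))"
definition q0 :: "nat \<Rightarrow> real \<Rightarrow> real" where "q0 k t = rho0 k t * (1 / lam ^ k * w (loc k t))"
definition q1 :: "nat \<Rightarrow> real \<Rightarrow> real" where
  "q1 k t = rho1 k t * (1 / lam ^ k * w (loc k t)) + rho0 k t * (1 / lam ^ k * (lam ^ k * w1 (loc k t)))"
definition q2 :: "nat \<Rightarrow> real \<Rightarrow> real" where
  "q2 k t = rho2 k t * (1 / lam ^ k * w (loc k t)) + 2 * (rho1 k t * (1 / lam ^ k * (lam ^ k * w1 (loc k t))))
     + rho0 k t * (1 / lam ^ k * ((lam ^ k)\<^sup>2 * w2 (loc k t)))"

lemma C2_p: "C2_on UNIV (p0 k) (p1 k) (p2 k)"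
  unfolding p0_def[abs_def] p1_def[abs_def] p2_def[abs_def] loc_def
  by (rule C2_on_mult[OF C2_rho C2_on_cmult[OF C2_on_affine[OF v_C2]]])

lemma C2_q: "C2_on UNIV (q0 k) (q1 k) (q2 k)"
  unfolding q0_def[abs_def] q1_def[abs_def] q2_def[abs_def] loc_def
  by (rule C2_on_mult[OF C2_rho C2_on_cmult[OF C2_on_affine[OF w_C2]]])

definition g0 :: "nat \<Rightarrow> real \<Rightarrow> real" where "g0 k t = p0 k t + (case k of 0 \<Rightarrow> 0 | Suc j \<Rightarrow> q0 j t)"
definition g1 :: "nat \<Rightarrow> real \<Rightarrow> real" where "g1 k t = p1 k t + (case k of 0 \<Rightarrow> 0 | Suc j \<Rightarrow> q1 j t)"
definition g2 :: "nat \<Rightarrow> real \<Rightarrow> real" where "g2 k t = p2 k t + (case k of 0 \<Rightarrow> 0 | Suc j \<Rightarrow> q2 j t)"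

lemma C2_g: "C2_on UNIV (g0 k) (g1 k) (g2 k)"
  unfolding g0_def[abs_def] g1_def[abs_def] g2_def[abs_def]
  by (rule C2_on_add[OF C2_p]) (cases k, simp_all add: C2_on_const C2_q)

lemma rho_future: "t \<le> S n \<Longrightarrow> n < k \<Longrightarrow> rho0 k t = 0 \<and> rho1 k t = 0 \<and> rho2 k t = 0"
proof -
  assume t: "t \<le> S n" "n < k"
  then obtain j where j: "k = Suc j" "n \<le> j" by (cases k) auto
  then show ?thesis using eta_early[OF tau_le[OF t(1), of j]] eta_early[OF tau_le[OF t(1), of k]]
    by (simp add: rho0_def rho1_def rho2_def)
qed

lemma rho_past: "S n \<le> t \<Longrightarrow> k < n \<Longrightarrow> rho0 k t = 0 \<and> rho1 k t = 0 \<and> rho2 k t = 0"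
  using eta_late[OF tau_ge[of n t k]] eta_late[OF tau_ge[of n t "k - 1"]]
  by (cases k) (auto simp: rho0_def rho1_def rho2_def)

text \<open>Stage \<open>k\<close> feeds only e_k and e_(k+1), and stages after \<open>n\<close> are
  off up to \<open>S n\<close>; hence the offset 2. Together with \<open>g_past\<close> it leaves
  only the modes n, n + 1, n + 2 between \<open>S n\<close> and \<open>S (Suc n)\<close>.\<close>

lemma g_future:
  assumes "t \<le> S n" "n + 2 \<le> k"
  shows "g0 k t = 0" "g1 k t = 0" "g2 k t = 0"
proof -
  obtain j where j: "k = Suc j" "n < j" using assms by (cases k) auto
  then show "g0 k t = 0" "g1 k t = 0" "g2 k t = 0"
    using rho_future[OF assms(1), of j] rho_future[OF assms(1), of k]
    by (auto simp: g0_def g1_def g2_def p0_def p1_def p2_def q0_def q1_def q2_def)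
qed

lemma g_past:
  assumes "S n \<le> t" "k < n"
  shows "g0 k t = 0" "g1 k t = 0" "g2 k t = 0"
  using rho_past[OF assms] rho_past[OF assms(1), of "k - 1"] assms(2)
  by (cases k; simp add: g0_def g1_def g2_def p0_def p1_def p2_def q0_def q1_def q2_def)+

text \<open>One instant in two stage clocks; the second identity is the recursion for
  \<open>S\<close>.\<close>

lemma loc_eq: "loc n t = b n + tau n t / lam" "loc (Suc n) t = tau n t - a n"
proof -
  show "loc n t = b n + tau n t / lam" using lam_pos by (simp add: loc_def tau_eq field_simps)
  have "lam ^ Suc n * S (Suc n) = lam ^ Suc n * S n + (a n + b (Suc n))"
    using lam_pos by (simp only: S_Suc distrib_left) simp
  then show "loc (Suc n) t = tau n t - a n" by (simp only: loc_def tau_def)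
qed

text \<open>Between two consecutive exit times only one cutoff is active, so the modes are the
  window profiles up to scale: amplitudes carry lam^-(n+1), and each derivative contributes a factor
  lam^(n+1).\<close>

lemma window_modes:
  assumes t: "S n \<le> t" "t \<le> S (Suc n)"
  shows "g0 n t = x0 (n, tau n t) / lam ^ Suc n" "g0 (Suc n) t = y0 (n, tau n t) / lam ^ Suc n"
    "g0 (Suc (Suc n)) t = z0 (n, tau n t) / lam ^ Suc n"
    "g1 (Suc n) t = y1 (n, tau n t)"
    "g2 n t = lam ^ Suc n * x2 (n, tau n t)" "g2 (Suc n) t = lam ^ Suc n * y2 (n, tau n t)"
    "g2 (Suc (Suc n)) t = lam ^ Suc n * z2 (n, tau n t)"
proof -
  have early: "eta0 k t = 0 \<and> eta1 k t = 0 \<and> eta2 k t = 0" if "n < k" for k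
    using eta_early[OF tau_le[OF t(2)]] that by simp
  have late: "eta0 k t = 1 \<and> eta1 k t = 0 \<and> eta2 k t = 0" if "k < n" for k
    using eta_late[OF tau_ge[OF t(1)]] that by simp
  have rn: "rho0 n t = 1 - eta0 n t" "rho1 n t = - eta1 n t" "rho2 n t = - eta2 n t"
    using late[of "n - 1"] by (cases n; simp add: rho0_def rho1_def rho2_def)+
  have rSn: "rho0 (Suc n) t = eta0 n t" "rho1 (Suc n) t = eta1 n t" "rho2 (Suc n) t = eta2 n t"
    using early[of "Suc n"] by (simp_all add: rho0_def rho1_def rho2_def)
  have rSSn: "rho0 (Suc (Suc n)) t = 0" "rho1 (Suc (Suc n)) t = 0" "rho2 (Suc (Suc n)) t = 0"
    using rho_future[OF t(2), of "Suc (Suc n)"] by auto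
  have rp: "(case n of 0 \<Rightarrow> 0 | Suc j \<Rightarrow> q0 j t) = 0" "(case n of 0 \<Rightarrow> 0 | Suc j \<Rightarrow> q2 j t) = 0"
    using rho_past[OF t(1), of "n - 1"] by (cases n; simp add: q0_def q2_def)+
  note defs = g0_def g1_def g2_def p0_def p1_def p2_def q0_def q1_def q2_def rn rSn rSSn rp
    eta0_def eta1_def eta2_def loc_eq(1)[of n t] loc_eq(2)[of n t]
    x0_def x2_def y0_def y1_def y2_def z0_def z2_def D_def D1_def D2_def X_def X1_def X2_def W_def W1_def W2_def
    V_def V1_def V2_def Z_def Z1_def Z2_def
  have l0: "lam \<noteq> 0" using lam_pos by simp
  show "g0 n t = x0 (n, tau n t) / lam ^ Suc n" "g0 (Suc n) t = y0 (n, tau n t) / lam ^ Suc n"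
    "g0 (Suc (Suc n)) t = z0 (n, tau n t) / lam ^ Suc n"
    using l0 by (simp_all add: defs field_simps)
  show "g1 (Suc n) t = y1 (n, tau n t)" using l0 by (simp add: defs field_simps)
  show "g2 n t = lam ^ Suc n * x2 (n, tau n t)"
    using l0 by (simp add: defs power2_eq_square divide_simps) (simp add: algebra_simps)
  show "g2 (Suc n) t = lam ^ Suc n * y2 (n, tau n t)"
    using l0 by (simp add: defs power2_eq_square divide_simps) (simp add: algebra_simps)
  show "g2 (Suc (Suc n)) t = lam ^ Suc n * z2 (n, tau n t)"
    using l0 by (simp add: defs power2_eq_square divide_simps) (simp add: algebra_simps)
qed

text \<open>At the start of a window the cutoff and its derivative vanish, so the velocity is the
  slope of \<open>w\<close> at its chosen zero. The bound does not decay with \<open>n\<close>: both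
  the blow-up and the missing limit rest on it.\<close>

lemma g1_at_S: "g1 (Suc n) (S n) \<ge> sqrt (E0 / 2)"
proof -
  have "S n \<le> S (Suc n)" by (intro S_mono) simp
  from window_modes(4)[OF order_refl this] have "g1 (Suc n) (S n) = w1 (b n)"
    by (simp add: tau_eq y1_def cutoff_left W1_def)
  then show ?thesis using b_zero(2,3)[of n] by (simp add: real_le_lsqrt)
qed

text \<open>The window residuals, multiplied by the scale lam^(n+1) of second derivatives. The first
  n + 3 modes contain all that are alive, so the finite sum is the full argument of
  \<open>m\<close>.\<close>

lemma modes_residual:
  "\<exists>C>0. \<forall>n t k. S n \<le> t \<longrightarrow> t \<le> S (Suc n) \<longrightarrow>
     \<bar>g2 k t + m (\<Sum>j<n + 3. lam ^ (2 * j) * (g0 j t)\<^sup>2) * lam ^ (2 * k) * g0 k t\<bar> \<le> C * (lam ^ Suc n * \<delta> n)"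
proof -
  obtain C where C: "C > 0" "\<And>n \<tau>. \<tau> \<ge> 0 \<Longrightarrow> \<bar>x2 (n, \<tau>) + m (\<sigma> (n, \<tau>)) * x0 (n, \<tau>) / lam\<^sup>2\<bar> \<le> C * \<delta> n"
     "\<And>n \<tau>. \<tau> \<ge> 0 \<Longrightarrow> \<bar>y2 (n, \<tau>) + m (\<sigma> (n, \<tau>)) * y0 (n, \<tau>)\<bar> \<le> C * \<delta> n"
     "\<And>n \<tau>. \<tau> \<ge> 0 \<Longrightarrow> \<bar>z2 (n, \<tau>) + lam\<^sup>2 * m (\<sigma> (n, \<tau>)) * z0 (n, \<tau>)\<bar> \<le> C * \<delta> n"
    using residual_bound by blast
  have "\<bar>g2 k t + m (\<Sum>j<n + 3. lam ^ (2 * j) * (g0 j t)\<^sup>2) * lam ^ (2 * k) * g0 k t\<bar> \<le> C * (lam ^ Suc n * \<delta> n)"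
    if t: "S n \<le> t" "t \<le> S (Suc n)" for n t k
  proof -
    define N where "N = lam ^ Suc n"
    define p where "p = (n, tau n t)"
    have N: "N > 0" using lam_pos by (simp add: N_def)
    have N2: "lam ^ (2 * n) = N\<^sup>2 / lam\<^sup>2" "lam ^ (2 * Suc n) = N\<^sup>2" "lam ^ (2 * Suc (Suc n)) = N\<^sup>2 * lam\<^sup>2"
      using lam_pos by (simp_all add: N_def power_mult_distrib power2_eq_square power_add mult_2 mult_2_right divide_simps)
    note wm = window_modes[OF t, folded N_def p_def]
    have "(\<Sum>j<n + 3. lam ^ (2 * j) * (g0 j t)\<^sup>2) = (\<Sum>j<n. lam ^ (2 * j) * (g0 j t)\<^sup>2) +
        lam ^ (2 * n) * (g0 n t)\<^sup>2 + lam ^ (2 * Suc n) * (g0 (Suc n) t)\<^sup>2 + lam ^ (2 * Suc (Suc n)) * (g0 (Suc (Suc n)) t)\<^sup>2"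
      by (simp only: numeral_3_eq_3 add_Suc_right add_0_right sum.lessThan_Suc)
    also have "(\<Sum>j<n. lam ^ (2 * j) * (g0 j t)\<^sup>2) = 0" using g_past(1)[OF t(1)] by (intro sum.neutral) auto
    finally have s: "(\<Sum>j<n + 3. lam ^ (2 * j) * (g0 j t)\<^sup>2) = \<sigma> p"
      unfolding N2 wm \<sigma>_def using N by (simp add: power_divide)
    have \<tau>: "tau n t \<ge> 0" by (rule tau_nonneg[OF t(1)])
    have bd: "\<bar>N * r\<bar> \<le> C * (N * \<delta> n)" if "\<bar>r\<bar> \<le> C * \<delta> n" for r
      using mult_left_mono[OF that, of N] N by (simp add: abs_mult mult_ac)
    consider "k < n" | "k = n" | "k = Suc n" | "k = Suc (Suc n)" | "Suc n + 2 \<le> k" by linarith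
    then have "\<bar>g2 k t + m (\<sigma> p) * lam ^ (2 * k) * g0 k t\<bar> \<le> C * (N * \<delta> n)"
    proof cases
      case 1
      then show ?thesis using g_past[OF t(1)] N lam_pos C(1) \<delta>_pos[of n] by simp
    next
      case 2
      have "g2 n t + m (\<sigma> p) * lam ^ (2 * n) * g0 n t = N * (x2 p + m (\<sigma> p) * x0 p / lam\<^sup>2)"
        unfolding N2 wm using N by (simp add: power2_eq_square distrib_left)
      then show ?thesis using bd[OF C(2)[OF \<tau>, of n]] 2 by (simp add: p_def)
    next
      case 3
      have "g2 (Suc n) t + m (\<sigma> p) * lam ^ (2 * Suc n) * g0 (Suc n) t = N * (y2 p + m (\<sigma> p) * y0 p)"
        unfolding N2 wm using N by (simp add: power2_eq_square distrib_left)
      then show ?thesis using bd[OF C(3)[OF \<tau>, of n]] 3 by (simp add: p_def)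
    next
      case 4
      have "g2 (Suc (Suc n)) t + m (\<sigma> p) * lam ^ (2 * Suc (Suc n)) * g0 (Suc (Suc n)) t = N * (z2 p + lam\<^sup>2 * m (\<sigma> p) * z0 p)"
        unfolding N2 wm using N by (simp add: power2_eq_square distrib_left)
      then show ?thesis using bd[OF C(4)[OF \<tau>, of n]] 4 by (simp add: p_def)
    next
      case 5
      then show ?thesis using g_future[OF t(2)] N lam_pos C(1) \<delta>_pos[of n] by simp
    qed
    then show ?thesis by (simp only: s N_def)
  qed
  then show ?thesis using C(1) by blast
qed

end

text \<open>The stage lengths \<open>lam ^ n / (n + 1)\<^sup>2\<close> in local time make the total duration finite, while the
  residual \<open>exp (- \<kappa> * lam ^ n / (n + 1)\<^sup>2)\<close> beats every Gevrey weight with exponent \<open>s > 1\<close>.\<close>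

theorem heteroclinic_chain_modes:
  fixes m :: "real \<Rightarrow> real" and \<mu>1 lam :: real
  assumes m: "C1_on {0..} m m'" and \<mu>1: "\<mu>1 > 0" "\<forall>\<sigma>\<ge>0. m \<sigma> \<ge> \<mu>1" and lam: "lam > 1"
    and hc: "heteroclinic_connection m lam"
  obtains S :: "nat \<Rightarrow> real" and T C c \<kappa> :: real and g0 g1 g2 :: "nat \<Rightarrow> real \<Rightarrow> real" where
    "S 0 = 0" "strict_mono S" "S \<longlonglongrightarrow> T" "C > 0" "c > 0" "\<kappa> > 0"
    "\<And>k. C2_on UNIV (g0 k) (g1 k) (g2 k)"
    "\<And>n k t. t \<le> S n \<Longrightarrow> n + 2 \<le> k \<Longrightarrow> g0 k t = 0 \<and> g1 k t = 0 \<and> g2 k t = 0"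
    "\<And>n k t. S n \<le> t \<Longrightarrow> k < n \<Longrightarrow> g0 k t = 0 \<and> g1 k t = 0 \<and> g2 k t = 0"
    "\<And>n k t. S n \<le> t \<Longrightarrow> t \<le> S (Suc n) \<Longrightarrow>
      \<bar>g2 k t + m (\<Sum>j<n + 3. lam ^ (2 * j) * (g0 j t)\<^sup>2) * lam ^ (2 * k) * g0 k t\<bar>
        \<le> C * (lam ^ Suc n * exp (- (\<kappa> * (lam ^ n / (real (Suc n))\<^sup>2))))"
    "\<And>n. g1 (Suc n) (S n) \<ge> c"
proof -
  obtain v v1 v2 w w1 w2 A0 B0 where h: "C2_on UNIV v v1 v2" "C2_on UNIV w w1 w2"
    "(v1 0)\<^sup>2 + (w1 0)\<^sup>2 + (v 0)\<^sup>2 + (w 0)\<^sup>2 > 0"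
    "\<And>t. v2 t + m ((v t)\<^sup>2 + lam\<^sup>2 * (w t)\<^sup>2) * v t = 0"
    "\<And>t. w2 t + lam\<^sup>2 * m ((v t)\<^sup>2 + lam\<^sup>2 * (w t)\<^sup>2) * w t = 0"
    "A0 > 0" "B0 > 0" "\<And>t. t \<ge> 0 \<Longrightarrow> \<bar>v1 t\<bar>\<^sup>2 + \<bar>v t\<bar>\<^sup>2 \<le> B0 * exp (- A0 * t)"
    "\<And>t. t \<le> 0 \<Longrightarrow> \<bar>w1 t\<bar>\<^sup>2 + lam\<^sup>2 * \<bar>w t\<bar>\<^sup>2 \<le> B0 * exp (- A0 * \<bar>t\<bar>)"
    using hc unfolding heteroclinic_connection_def by blast
  interpret heteroclinic m m' v v1 v2 w w1 w2 \<mu>1 lam A0 B0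
  proof
    show "v2 t = - m ((v t)\<^sup>2 + lam\<^sup>2 * (w t)\<^sup>2) * v t" for t using h(4)[of t] by linarith
    show "w2 t = - lam\<^sup>2 * m ((v t)\<^sup>2 + lam\<^sup>2 * (w t)\<^sup>2) * w t" for t using h(5)[of t] by linarith
    show "(v1 t)\<^sup>2 + (v t)\<^sup>2 \<le> B0 * exp (- A0 * t)" if "t \<ge> 0" for t using h(8)[OF that] by simp
    show "(w1 t)\<^sup>2 + lam\<^sup>2 * (w t)\<^sup>2 \<le> B0 * exp (A0 * t)" if "t \<le> 0" for t using h(9)[OF that] that by simp
    show "m \<sigma> \<ge> \<mu>1" if "\<sigma> \<ge> 0" for \<sigma> using \<mu>1(2) that by blast
  qed (fact m \<mu>1 lam h)+
  obtain R0 l where R0: "R0 \<ge> 3" "l > 0"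
    "\<And>R. R \<ge> R0 \<Longrightarrow> \<exists>t\<in>{R..R + l}. w t = 0 \<and> w1 t > 0 \<and> (w1 t)\<^sup>2 \<ge> E0 / 2"
    "\<And>R. R \<ge> R0 \<Longrightarrow> \<exists>t\<in>{R..R + l}. v (- t) = 0 \<and> v1 (- t) > 0"
    using crossing_times by blast
  define L where "L n = R0 + lam ^ n / (real (Suc n))\<^sup>2" for n
  have L: "L n \<ge> R0" for n using lam by (simp add: L_def)
  have "\<exists>b. \<forall>n. b n \<in> {L n..L n + l} \<and> w (b n) = 0 \<and> w1 (b n) > 0 \<and> (w1 (b n))\<^sup>2 \<ge> E0 / 2"
    using R0(3)[OF L] by (intro choice) blast
  then obtain b where b: "\<And>n. b n \<in> {L n..L n + l} \<and> w (b n) = 0 \<and> w1 (b n) > 0 \<and> (w1 (b n))\<^sup>2 \<ge> E0 / 2" by blast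
  have "\<exists>a. \<forall>n. a n \<in> {L n..L n + l} \<and> v (- a n) = 0 \<and> v1 (- a n) > 0"
    using R0(4)[OF L] by (intro choice) blast
  then obtain a where a: "\<And>n. a n \<in> {L n..L n + l} \<and> v (- a n) = 0 \<and> v1 (- a n) > 0" by blast
  interpret heteroclinic_chain m m' v v1 v2 w w1 w2 \<mu>1 lam A0 B0 a b L l
  proof
    show "3 \<le> L n" for n using L[of n] R0(1) by linarith
  qed (use a b in auto)
  have summ: "summable (\<lambda>i. (a i + b (Suc i)) / lam ^ Suc i)"
  proof (rule summable_comparison_test_ev[OF always_eventually[OF allI]])
    fix i
    have "a i + b (Suc i) \<ge> 0" using a_ge[of i] b_ge[of "Suc i"] L_ge[of i] L_ge[of "Suc i"] by linarith
    then have "norm ((a i + b (Suc i)) / lam ^ Suc i) = (a i + b (Suc i)) / lam ^ Suc i" using lam by simp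
    also have "\<dots> \<le> (L i + L (Suc i) + 2 * l) / lam ^ Suc i"
      using a_le[of i] b_le[of "Suc i"] lam by (intro divide_right_mono) auto
    \<comment> \<open>The constants \<open>R0\<close> and \<open>l\<close> leave a geometric series,
      the growing parts of \<open>L i\<close> and \<open>L (Suc i)\<close> inverse squares.\<close>
    also have "\<dots> = 2 * (R0 + l) * (1 / lam) ^ Suc i + (1 / lam) * inverse (real (Suc i) ^ 2) + inverse (real (Suc (Suc i)) ^ 2)"
      using lam by (simp add: L_def add_divide_distrib inverse_eq_divide power_one_over)
    finally show "norm ((a i + b (Suc i)) / lam ^ Suc i) \<le>
      2 * (R0 + l) * (1 / lam) ^ Suc i + (1 / lam) * inverse (real (Suc i) ^ 2) + inverse (real (Suc (Suc i)) ^ 2)" .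
  next
    have 1: "summable (\<lambda>n. inverse (real n ^ 2))" by (rule inverse_power_summable) simp
    have 2: "summable (\<lambda>i. inverse (real (Suc i) ^ 2))" using 1 by (subst summable_Suc_iff)
    have 3: "summable (\<lambda>i. inverse (real (Suc (Suc i)) ^ 2))" using 2 by (subst summable_Suc_iff)
    have "summable (\<lambda>i. (1 / lam) ^ i)" using lam by (intro summable_geometric) simp
    then have "summable (\<lambda>i. (1 / lam) ^ Suc i)" by (subst summable_Suc_iff)
    then show "summable (\<lambda>i. 2 * (R0 + l) * (1 / lam) ^ Suc i + (1 / lam) * inverse (real (Suc i) ^ 2) + inverse (real (Suc (Suc i)) ^ 2))"
      using 2 3 by (intro summable_add summable_mult)
  qed
  then have lim: "S \<longlonglongrightarrow> (\<Sum>i. (a i + b (Suc i)) / lam ^ Suc i)"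
    unfolding S_def[abs_def] by (rule summable_LIMSEQ)
  obtain C where C: "C > 0" "\<And>n t k. S n \<le> t \<Longrightarrow> t \<le> S (Suc n) \<Longrightarrow>
     \<bar>g2 k t + m (\<Sum>j<n + 3. lam ^ (2 * j) * (g0 j t)\<^sup>2) * lam ^ (2 * k) * g0 k t\<bar> \<le> C * (lam ^ Suc n * \<delta> n)"
    using modes_residual by blast
  have d: "C * (lam ^ Suc n * \<delta> n) \<le> C * (lam ^ Suc n * exp (- (A0 / 2 * (lam ^ n / (real (Suc n))\<^sup>2))))" for n
  proof -
    have "A0 / 2 * (lam ^ n / (real (Suc n))\<^sup>2) \<le> A0 / 2 * L n"
      using h(6) R0(1) by (intro mult_left_mono) (simp_all add: L_def)
    then have "\<delta> n \<le> exp (- (A0 / 2 * (lam ^ n / (real (Suc n))\<^sup>2)))" by (simp only: \<delta>_def exp_le_cancel_iff neg_le_iff_le)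
    then show ?thesis using C(1) lam by (intro mult_left_mono) simp_all
  qed
  show ?thesis
  proof (rule that[OF S_0 strict_mono_S lim C(1) _ _ C2_g])
    show "sqrt (E0 / 2) > 0" using E0_pos by simp
    show "A0 / 2 > 0" using h(6) by simp
    show "g0 k t = 0 \<and> g1 k t = 0 \<and> g2 k t = 0" if "t \<le> S n" "n + 2 \<le> k" for n k t
      using g_future[OF that] by simp
    show "g0 k t = 0 \<and> g1 k t = 0 \<and> g2 k t = 0" if "S n \<le> t" "k < n" for n k t
      using g_past[OF that] by simp
    show "\<bar>g2 k t + m (\<Sum>j<n + 3. lam ^ (2 * j) * (g0 j t)\<^sup>2) * lam ^ (2 * k) * g0 k t\<bar>
        \<le> C * (lam ^ Suc n * exp (- (A0 / 2 * (lam ^ n / (real (Suc n))\<^sup>2))))"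
      if "S n \<le> t" "t \<le> S (Suc n)" for n k t
      using order.trans[OF C(2)[OF that] d] .
    show "sqrt (E0 / 2) \<le> g1 (Suc n) (S n)" for n by (rule g1_at_S)
  qed
qed

section \<open>Gevrey regularity and blow-up\<close>

text \<open>A vector given by its coefficients. The lemmas below apply it to finitely supported
  sequences, for which the series is a finite sum.\<close>

definition orthonormal_sum :: "(nat \<Rightarrow> 'a::real_inner) \<Rightarrow> (nat \<Rightarrow> real) \<Rightarrow> 'a" where
  "orthonormal_sum e c = (\<Sum>k. c k *\<^sub>R e k)"

lemma orthonormal_sum_finite:
  "(\<And>k. k \<ge> N \<Longrightarrow> c k = 0) \<Longrightarrow> orthonormal_sum e c = (\<Sum>k<N. c k *\<^sub>R e k)"
  unfolding orthonormal_sum_def by (rule suminf_finite) auto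

context
  fixes e :: "nat \<Rightarrow> 'a::real_inner"
  assumes ortho: "\<And>i j. e i \<bullet> e j = (if i = j then 1 else 0)"
begin

lemma orthonormal_sum_inner:
  assumes "\<And>k. k \<ge> N \<Longrightarrow> c k = 0"
  shows "orthonormal_sum e c \<bullet> e k = c k"
proof -
  have "(\<Sum>i<N. c i *\<^sub>R e i) \<bullet> e k = (\<Sum>i<N. if i = k then c i else 0)"
    unfolding inner_sum_left by (intro sum.cong) (auto simp: ortho)
  then show ?thesis using assms by (simp add: orthonormal_sum_finite[OF assms] not_less)
qed

lemma orthonormal_sum_norm:
  assumes "\<And>k. k \<ge> N \<Longrightarrow> c k = 0"
  shows "(norm (orthonormal_sum e c))\<^sup>2 = (\<Sum>k<N. (c k)\<^sup>2)"
proof -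
  have "(norm (orthonormal_sum e c))\<^sup>2 = (\<Sum>k<N. c k *\<^sub>R e k) \<bullet> orthonormal_sum e c"
    unfolding power2_norm_eq_inner using orthonormal_sum_finite[of N c e, OF assms] by simp
  also have "\<dots> = (\<Sum>k<N. (c k)\<^sup>2)"
    by (simp add: inner_sum_left inner_commute[of "e _"] orthonormal_sum_inner[OF assms] power2_eq_square)
  finally show ?thesis .
qed

lemma orthonormal_sum_diff:
  assumes "\<And>k. k \<ge> N \<Longrightarrow> c k = 0" "\<And>k. k \<ge> N \<Longrightarrow> d k = 0"
  shows "orthonormal_sum e c - orthonormal_sum e d = orthonormal_sum e (\<lambda>k. c k - d k)"
proof -
  have "orthonormal_sum e (\<lambda>k. c k - d k) = (\<Sum>k<N. (c k - d k) *\<^sub>R e k)"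
    using assms by (intro orthonormal_sum_finite) simp
  then show ?thesis using orthonormal_sum_finite[of N c e] orthonormal_sum_finite[of N d e] assms
    by (simp add: scaleR_diff_left sum_subtractf)
qed

lemma orthonormal_sum_scale:
  assumes "\<And>k. k \<ge> N \<Longrightarrow> c k = 0"
  shows "a *\<^sub>R orthonormal_sum e c = orthonormal_sum e (\<lambda>k. a * c k)"
proof -
  have "orthonormal_sum e (\<lambda>k. a * c k) = (\<Sum>k<N. (a * c k) *\<^sub>R e k)"
    using assms by (intro orthonormal_sum_finite) simp
  then show ?thesis using orthonormal_sum_finite[of N c e] assms by (simp add: scaleR_sum_right)
qed

lemma orthonormal_sum_in_gevrey:
  assumes "\<And>k. k \<ge> N \<Longrightarrow> c k = 0"
  shows "orthonormal_sum e c \<in> gevrey e lv r s"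
proof -
  have "(\<lambda>k. c k *\<^sub>R e k) sums (\<Sum>k<N. c k *\<^sub>R e k)"
    using assms by (intro sums_finite) auto
  moreover have "summable (\<lambda>k. (c k)\<^sup>2 * exp (r * lv k powr (1 / s)))"
    using assms by (intro summable_finite[of "{..<N}"]) auto
  ultimately show ?thesis
    by (simp add: gevrey_def orthonormal_sum_inner[of N c, OF assms])
      (simp add: orthonormal_sum_finite[of N c e, OF assms])
qed

lemma gevrey_norm_orthonormal_sum:
  assumes "\<And>k. k \<ge> N \<Longrightarrow> c k = 0"
  shows "gevrey_norm e lv r s (orthonormal_sum e c) = sqrt (\<Sum>k<N. (c k)\<^sup>2 * exp (r * lv k powr (1 / s)))"
proof -
  have "(\<Sum>k. (c k)\<^sup>2 * exp (r * lv k powr (1 / s))) = (\<Sum>k<N. (c k)\<^sup>2 * exp (r * lv k powr (1 / s)))"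
    using assms by (intro suminf_finite) auto
  then show ?thesis by (simp add: gevrey_norm_def orthonormal_sum_inner[OF assms])
qed

text \<open>With finitely many fixed weights, convergence of each coefficient is convergence in
  every Gevrey norm at once, also for s at most 1.\<close>

lemma gevrey_norm_tendsto_0:
  assumes "\<forall>\<^sub>F \<tau> in F. \<forall>k\<ge>N. c \<tau> k = 0" "\<And>k. ((\<lambda>\<tau>. c \<tau> k) \<longlongrightarrow> 0) F"
  shows "((\<lambda>\<tau>. gevrey_norm e lv r s (orthonormal_sum e (c \<tau>))) \<longlongrightarrow> 0) F"
proof (rule Lim_transform_eventually)
  show "((\<lambda>\<tau>. sqrt (\<Sum>k<N. (c \<tau> k)\<^sup>2 * exp (r * lv k powr (1 / s)))) \<longlongrightarrow> 0) F"
  proof -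
    have "((\<lambda>\<tau>. sqrt (\<Sum>k<N. (c \<tau> k)\<^sup>2 * exp (r * lv k powr (1 / s)))) \<longlongrightarrow>
        sqrt (\<Sum>k<N. 0\<^sup>2 * exp (r * lv k powr (1 / s)))) F"
      by (intro tendsto_real_sqrt tendsto_sum tendsto_mult tendsto_power tendsto_const assms(2))
    then show ?thesis by simp
  qed
  show "\<forall>\<^sub>F \<tau> in F. sqrt (\<Sum>k<N. (c \<tau> k)\<^sup>2 * exp (r * lv k powr (1 / s))) =
      gevrey_norm e lv r s (orthonormal_sum e (c \<tau>))"
    using assms(1) by eventually_elim (subst gevrey_norm_orthonormal_sum[of N], auto)
qed

text \<open>Near \<open>t\<close> the modes \<open>k \<ge> N\<close> vanish, so that no uniformity in \<open>k\<close> is needed.\<close>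

lemma gevrey_continuous_at:
  assumes N: "\<forall>\<^sub>F \<tau> in F. \<forall>k\<ge>N. c k \<tau> = 0" "\<And>k. k \<ge> N \<Longrightarrow> c k t = 0"
    and c: "\<And>k. ((\<lambda>\<tau>. c k \<tau>) \<longlongrightarrow> c k t) F"
  shows "((\<lambda>\<tau>. gevrey_norm e lv r s (orthonormal_sum e (\<lambda>k. c k \<tau>) - orthonormal_sum e (\<lambda>k. c k t))) \<longlongrightarrow> 0) F"
proof (rule Lim_transform_eventually)
  show "((\<lambda>\<tau>. gevrey_norm e lv r s (orthonormal_sum e (\<lambda>k. c k \<tau> - c k t))) \<longlongrightarrow> 0) F"
  proof (rule gevrey_norm_tendsto_0)
    show "\<forall>\<^sub>F \<tau> in F. \<forall>k\<ge>N. c k \<tau> - c k t = 0" using N(1) by eventually_elim (simp add: N(2))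
    show "((\<lambda>\<tau>. c k \<tau> - c k t) \<longlongrightarrow> 0) F" for k using c[of k] by (simp add: LIM_zero_iff)
  qed
  show "\<forall>\<^sub>F \<tau> in F. gevrey_norm e lv r s (orthonormal_sum e (\<lambda>k. c k \<tau> - c k t)) =
      gevrey_norm e lv r s (orthonormal_sum e (\<lambda>k. c k \<tau>) - orthonormal_sum e (\<lambda>k. c k t))"
    using N(1) by eventually_elim (subst orthonormal_sum_diff[of N], auto simp: N(2))
qed

lemma gevrey_derivative_at:
  assumes N: "\<forall>\<^sub>F \<tau> in at t within I. \<forall>k\<ge>N. c k \<tau> = 0" "\<And>k. k \<ge> N \<Longrightarrow> c k t = 0 \<and> c1 k t = 0"
    and c: "\<And>k. (c k has_real_derivative c1 k t) (at t within I)"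
  shows "((\<lambda>\<tau>. gevrey_norm e lv r s ((orthonormal_sum e (\<lambda>k. c k \<tau>) - orthonormal_sum e (\<lambda>k. c k t)) /\<^sub>R (\<tau> - t)
      - orthonormal_sum e (\<lambda>k. c1 k t))) \<longlongrightarrow> 0) (at t within I)"
proof (rule Lim_transform_eventually)
  show "((\<lambda>\<tau>. gevrey_norm e lv r s (orthonormal_sum e (\<lambda>k. inverse (\<tau> - t) * (c k \<tau> - c k t) - c1 k t))) \<longlongrightarrow> 0)
      (at t within I)"
  proof (rule gevrey_norm_tendsto_0)
    show "\<forall>\<^sub>F \<tau> in at t within I. \<forall>k\<ge>N. inverse (\<tau> - t) * (c k \<tau> - c k t) - c1 k t = 0"
      using N(1) by eventually_elim (simp add: N(2))
    show "((\<lambda>\<tau>. inverse (\<tau> - t) * (c k \<tau> - c k t) - c1 k t) \<longlongrightarrow> 0) (at t within I)" for k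
      using c[of k] by (simp add: LIM_zero_iff has_field_derivative_iff divide_inverse mult.commute)
  qed
  show "\<forall>\<^sub>F \<tau> in at t within I. gevrey_norm e lv r s (orthonormal_sum e (\<lambda>k. inverse (\<tau> - t) * (c k \<tau> - c k t) - c1 k t)) =
      gevrey_norm e lv r s ((orthonormal_sum e (\<lambda>k. c k \<tau>) - orthonormal_sum e (\<lambda>k. c k t)) /\<^sub>R (\<tau> - t)
      - orthonormal_sum e (\<lambda>k. c1 k t))"
    using N(1)
  proof eventually_elim
    case (elim \<tau>)
    have "(orthonormal_sum e (\<lambda>k. c k \<tau>) - orthonormal_sum e (\<lambda>k. c k t)) /\<^sub>R (\<tau> - t) - orthonormal_sum e (\<lambda>k. c1 k t)
        = orthonormal_sum e (\<lambda>k. inverse (\<tau> - t) * (c k \<tau> - c k t)) - orthonormal_sum e (\<lambda>k. c1 k t)"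
      by (subst orthonormal_sum_diff[of N], use elim N(2) in simp, use N(2) in simp)
        (subst orthonormal_sum_scale[of N], use elim N(2) in simp_all)
    also have "\<dots> = orthonormal_sum e (\<lambda>k. inverse (\<tau> - t) * (c k \<tau> - c k t) - c1 k t)"
      by (rule orthonormal_sum_diff[of N]) (use elim N(2) in simp_all)
    finally show ?case by simp
  qed
qed

end

text \<open>Since s > 1, the exponent lam^(n/s) of the weight is negligible against lam^n / (n +
  1)^2. The factor n + 3 counts modes.\<close>

lemma gevrey_forcing_bound_tendsto_0:
  fixes lam \<kappa> C r s :: real
  assumes "lam > 1" "\<kappa> > 0" "s > 1" "r > 0"
  shows "(\<lambda>n. (real n + 3) * ((C * (lam ^ Suc n * exp (- (\<kappa> * (lam ^ n / (real (Suc n))\<^sup>2)))))\<^sup>2 *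
      exp (r * (lam ^ (n + 2)) powr (1 / s)))) \<longlonglongrightarrow> 0"
proof -
  define a p R where "a = ln lam" and "p = 1 / s" and "R = r * (lam\<^sup>2) powr (1 / s)"
  have a: "a > 0" "0 < p" "p < 1" "R > 0" using assms by (auto simp: a_def p_def R_def)
  have pw: "lam ^ n = exp (a * real n)" for n
    using assms by (simp add: a_def mult.commute flip: powr_realpow powr_def) (simp add: powr_def)
  have pw2: "r * (lam ^ (n + 2)) powr (1 / s) = R * exp (p * a * real n)" for n
  proof -
    have "(lam ^ (n + 2)) powr (1 / s) = (lam ^ n) powr p * (lam\<^sup>2) powr (1 / s)"
      using assms powr_mult[of "lam ^ n" "lam\<^sup>2" "1 / s"] by (simp only: power_add p_def)
    also have "(lam ^ n) powr p = exp (p * a * real n)"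
      unfolding pw by (simp add: powr_def)
    finally show ?thesis by (simp add: R_def)
  qed
  \<comment> \<open>Squaring doubles \<kappa>: one copy of the exponential absorbs the prefactor,
    the other the Gevrey weight.\<close>
  have 1: "(\<lambda>n. (real n + 3) * exp (2 * a * (real n + 1) - \<kappa> * exp (a * real n) / (real n + 1)\<^sup>2)) \<longlonglongrightarrow> 0"
    using a assms(2) by real_asymp
  have 2: "(\<lambda>n. exp (R * exp (p * a * real n) - \<kappa> * exp (a * real n) / (real n + 1)\<^sup>2)) \<longlonglongrightarrow> 0"
    using a assms(2) by real_asymp
  have eq: "(real n + 3) * ((C * (exp (a * (real n + 1)) * exp (- (\<kappa> * (exp (a * real n) / (real n + 1)\<^sup>2)))))\<^sup>2 *
      exp (R * exp (p * a * real n))) =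
      C\<^sup>2 * (((real n + 3) * exp (2 * a * (real n + 1) - \<kappa> * exp (a * real n) / (real n + 1)\<^sup>2)) *
      exp (R * exp (p * a * real n) - \<kappa> * exp (a * real n) / (real n + 1)\<^sup>2))" for n
    by (simp add: power_mult_distrib flip: exp_add exp_double)
  have "(\<lambda>n. (real n + 3) * ((C * (exp (a * (real n + 1)) * exp (- (\<kappa> * (exp (a * real n) / (real n + 1)\<^sup>2)))))\<^sup>2 *
      exp (R * exp (p * a * real n)))) \<longlonglongrightarrow> 0"
    unfolding eq using tendsto_mult[OF tendsto_const tendsto_mult[OF 1 2], of "C\<^sup>2"] by simp
  then show ?thesis unfolding pw2 unfolding pw by (simp only: of_nat_Suc add.commute[of 1])
qed

theorem theorem2p3:
  fixes m :: "real \<Rightarrow> real" and \<mu>1 lam :: real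
    and A :: "('a::{real_inner,banach} \<times> 'a) set" and e :: "nat \<Rightarrow> 'a"
  assumes "\<exists>m'. C1_on {0..} m m'"
    and "\<mu>1 > 0" and "\<forall>\<sigma>\<ge>0. m \<sigma> \<ge> \<mu>1"
    and "lam > 1"
    and "heteroclinic_connection m lam"
    and "positive_self_adjoint A"
    and "\<forall>i j. e i \<bullet> e j = (if i = j then 1 else 0)"
    and "\<forall>k. (e k, lam ^ (2 * k) *\<^sub>R e k) \<in> A"
  shows "\<exists>(f :: real \<Rightarrow> 'a) (T :: real) (u :: real \<Rightarrow> 'a) (u1 :: real \<Rightarrow> 'a) (u2 :: real \<Rightarrow> 'a).
      (\<forall>s>1. \<forall>r>0. gevrey_C0_on e (\<lambda>k. lam ^ k) r s {0..} f) \<and>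
      T > 0 \<and>
      (\<forall>s>0. \<forall>r>0. gevrey_C2_on e (\<lambda>k. lam ^ k) r s {0..<T} u u1 u2) \<and>
      (\<forall>t\<in>{0..<T}.
         u t \<in> Domain A \<and> u t \<in> Domain (op_power A (1/2)) \<and>
         u2 t + m ((norm (op_app (op_power A (1/2)) (u t)))\<^sup>2) *\<^sub>R op_app A (u t) = f t) \<and>
      (\<forall>\<alpha>>0.
         (\<forall>t\<in>{0..<T}. u1 t \<in> Domain (op_power A \<alpha>) \<and> u t \<in> Domain (op_power A (\<alpha> + 1/2))) \<and>
         Limsup (at_left T)
           (\<lambda>t. ereal ((norm (op_app (op_power A \<alpha>) (u1 t)))\<^sup>2
                      + (norm (op_app (op_power A (\<alpha> + 1/2)) (u t)))\<^sup>2)) = \<infinity>) \<and>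
      \<not> (\<exists>l. (u1 \<longlongrightarrow> l) (at_left T))"
proof -
  obtain m' where m': "C1_on {0..} m m'" using assms(1) by blast
  have lam: "lam > 1" "lam > 0" using assms(4) by auto
  have ortho: "\<And>i j. e i \<bullet> e j = (if i = j then 1 else 0)" and eig: "\<And>k. (e k, lam ^ (2 * k) *\<^sub>R e k) \<in> A"
    using assms(7,8) by blast+
  have m_cont: "continuous_on {0..} m" by (rule C1_on_imp_continuous[OF m'])
  obtain S T C c \<kappa> g0 g1 g2 where
    S: "S 0 = 0" "strict_mono S" "S \<longlonglongrightarrow> T" and C: "C > 0" and c: "c > 0" and \<kappa>: "\<kappa> > 0"
    and g: "\<And>k. C2_on UNIV (g0 k) (g1 k) (g2 k)"
    and future: "\<And>n k t. t \<le> S n \<Longrightarrow> n + 2 \<le> k \<Longrightarrow> g0 k t = 0 \<and> g1 k t = 0 \<and> g2 k t = 0"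
    and past: "\<And>n k t. S n \<le> t \<Longrightarrow> k < n \<Longrightarrow> g0 k t = 0 \<and> g1 k t = 0 \<and> g2 k t = 0"
    and residual: "\<And>n k t. S n \<le> t \<Longrightarrow> t \<le> S (Suc n) \<Longrightarrow>
      \<bar>g2 k t + m (\<Sum>j<n + 3. lam ^ (2 * j) * (g0 j t)\<^sup>2) * lam ^ (2 * k) * g0 k t\<bar>
        \<le> C * (lam ^ Suc n * exp (- (\<kappa> * (lam ^ n / (real (Suc n))\<^sup>2))))"
    and g1_S: "\<And>n. g1 (Suc n) (S n) \<ge> c"
    by (rule heteroclinic_chain_modes[OF m' assms(2,3,4,5)]) (rule that; assumption)

  have S_less_T: "S n < T" for n
  proof -
    have "S (Suc n) \<le> T" using S by (intro incseq_le) (simp_all add: strict_mono_mono)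
    then show ?thesis using strict_monoD[OF S(2), of n "Suc n"] by simp
  qed
  have T: "T > 0" using S_less_T[of 0] S(1) by simp
  have S_nonneg: "S n \<ge> 0" for n using strict_mono_less_eq[OF S(2), of 0 n] S(1) by simp
  have stage: "\<exists>n. S n \<le> t \<and> t < S (Suc n)" if t: "0 \<le> t" "t < T" for t
  proof -
    have "\<forall>\<^sub>F n in sequentially. t < S n" using S(3) t(2) by (rule order_tendstoD)
    then have "\<exists>n. t < S n" by (auto simp: eventually_sequentially)
    then obtain n where n: "t < S n" "\<And>j. j < n \<Longrightarrow> \<not> t < S j" using exists_least_iff[of "\<lambda>n. t < S n"] by blast
    then obtain j where "n = Suc j" using t(1) S(1) by (cases n) auto
    then show ?thesis using n by (intro exI[of _ j]) (auto simp: not_less)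
  qed
  \<comment> \<open>Before the end of stage \<open>n + 1\<close>, the offset 2 of
    \<open>future\<close> becomes 3 in terms of \<open>n\<close>.\<close>
  have fin: "g0 k t = 0 \<and> g1 k t = 0 \<and> g2 k t = 0" if "t < S (Suc n)" "n + 3 \<le> k" for t n k
    using future[of t "Suc n" k] that by simp

  define q where "q t = (\<Sum>k. lam ^ (2 * k) * (g0 k t)\<^sup>2)" for t
  have q_sum: "q t = (\<Sum>k<n + 3. lam ^ (2 * k) * (g0 k t)\<^sup>2)" if "t < S (Suc n)" for t n
    unfolding q_def using fin[OF that] by (intro suminf_finite) auto
  \<comment> \<open>The force is read off from the equation before \<open>T\<close> and set to zero
    afterwards. The residual bound is then needed only for continuity at \<open>T\<close>.\<close>
  define F where "F k t = (if t < T then g2 k t + m (q t) * lam ^ (2 * k) * g0 k t else 0)" for k t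
  have F_fin: "F k t = 0" if "t < S (Suc n)" "n + 3 \<le> k" for t n k
    using fin[OF that] by (simp add: F_def)

  define u where "u t = orthonormal_sum e (\<lambda>k. g0 k t)" for t
  define u1 where "u1 t = orthonormal_sum e (\<lambda>k. g1 k t)" for t
  define u2 where "u2 t = orthonormal_sum e (\<lambda>k. g2 k t)" for t
  define f where "f t = orthonormal_sum e (\<lambda>k. F k t)" for t

  have dg: "\<And>k t. (g0 k has_real_derivative g1 k t) (at t)" "\<And>k t. (g1 k has_real_derivative g2 k t) (at t)"
    and cg: "\<And>k. continuous_on UNIV (g2 k)"
    using g by (auto simp: C2_on_def C1_on_def)
  have lim_g: "(g0 k \<longlongrightarrow> g0 k t) (at t within I)" "(g1 k \<longlongrightarrow> g1 k t) (at t within I)"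
    "(g2 k \<longlongrightarrow> g2 k t) (at t within I)" for k t I
    using DERIV_isCont[OF dg(1)] DERIV_isCont[OF dg(2)] cg
    by (auto simp: isCont_def continuous_on_eq_continuous_at intro: tendsto_within_subset[OF _ subset_UNIV])
  have near: "\<forall>\<^sub>F \<tau> in at t within I. \<tau> < S (Suc n)" if "t < S (Suc n)" for t n I
    by (rule order_tendstoD(2)[OF tendsto_ident_at that])

  have gevrey_u: "gevrey_C2_on e (\<lambda>k. lam ^ k) r s {0..<T} u u1 u2" for r s
  proof -
    \<comment> \<open>Stated for an arbitrary locally finite family, as it serves the coefficients
      of u and of both derivatives.\<close>
    have C0: "gevrey_C0_on e (\<lambda>k. lam ^ k) r s {0..<T} (\<lambda>t. orthonormal_sum e (\<lambda>k. h k t))"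
      if fin_h: "\<And>t n k. t < S (Suc n) \<Longrightarrow> n + 3 \<le> k \<Longrightarrow> h k t = 0"
        and lim_h: "\<And>k t I. (h k \<longlongrightarrow> h k t) (at t within I)" for h
      unfolding gevrey_C0_on_def
    proof (intro conjI ballI)
      fix t assume "t \<in> {0..<T}"
      then obtain n where n: "t < S (Suc n)" using stage[of t] by auto
      show "orthonormal_sum e (\<lambda>k. h k t) \<in> gevrey e (\<lambda>k. lam ^ k) r s"
        by (rule orthonormal_sum_in_gevrey[OF ortho, of "n + 3"]) (use fin_h[OF n] in auto)
      show "((\<lambda>\<tau>. gevrey_norm e (\<lambda>k. lam ^ k) r s (orthonormal_sum e (\<lambda>k. h k \<tau>) - orthonormal_sum e (\<lambda>k. h k t)))
          \<longlongrightarrow> 0) (at t within {0..<T})"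
      proof (rule gevrey_continuous_at[OF ortho])
        show "\<forall>\<^sub>F \<tau> in at t within {0..<T}. \<forall>k\<ge>n + 3. h k \<tau> = 0"
          using near[OF n] by eventually_elim (use fin_h in auto)
      qed (use fin_h[OF n] lim_h in auto)
    qed
    have D: "gevrey_derivative_on e (\<lambda>k. lam ^ k) r s {0..<T} (\<lambda>t. orthonormal_sum e (\<lambda>k. h k t))
        (\<lambda>t. orthonormal_sum e (\<lambda>k. h1 k t))"
      if fin_h: "\<And>t n k. t < S (Suc n) \<Longrightarrow> n + 3 \<le> k \<Longrightarrow> h k t = 0 \<and> h1 k t = 0"
        and dh: "\<And>k t. (h k has_real_derivative h1 k t) (at t)" for h h1
      unfolding gevrey_derivative_on_def
    proof
      fix t assume "t \<in> {0..<T}"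
      then obtain n where n: "t < S (Suc n)" using stage[of t] by auto
      show "((\<lambda>\<tau>. gevrey_norm e (\<lambda>k. lam ^ k) r s ((orthonormal_sum e (\<lambda>k. h k \<tau>) - orthonormal_sum e (\<lambda>k. h k t))
          /\<^sub>R (\<tau> - t) - orthonormal_sum e (\<lambda>k. h1 k t))) \<longlongrightarrow> 0) (at t within {0..<T})"
      proof (rule gevrey_derivative_at[OF ortho])
        show "\<forall>\<^sub>F \<tau> in at t within {0..<T}. \<forall>k\<ge>n + 3. h k \<tau> = 0"
          using near[OF n] by eventually_elim (use fin_h in auto)
        show "(h k has_real_derivative h1 k t) (at t within {0..<T})" for k
          by (rule has_field_derivative_at_within[OF dh])
      qed (use fin_h[OF n] in auto)
    qed
    show ?thesis unfolding gevrey_C2_on_def u_def[abs_def] u1_def[abs_def] u2_def[abs_def]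
      using fin by (intro conjI C0 D dg lim_g) blast+
  qed

  have F_lim: "(F k \<longlongrightarrow> F k t) (at t within I)" if t: "0 \<le> t" "t < T" for k t I
  proof -
    obtain n where n: "t < S (Suc n)" using stage[OF t] by auto
    \<comment> \<open>A fixed finite sum that agrees with \<open>q\<close> near \<open>t\<close>, so
      that continuity passes through \<open>m\<close>.\<close>
    define q' where "q' \<tau> = (\<Sum>k<n + 3. lam ^ (2 * k) * (g0 k \<tau>)\<^sup>2)" for \<tau>
    have "(q' \<longlongrightarrow> q' t) (at t within I)" unfolding q'_def[abs_def]
      by (intro tendsto_sum tendsto_mult tendsto_power tendsto_const lim_g)
    then have "((\<lambda>\<tau>. m (q' \<tau>)) \<longlongrightarrow> m (q' t)) (at t within I)"
      by (rule continuous_on_tendsto_compose[OF m_cont])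
        (auto simp: q'_def intro!: sum_nonneg always_eventually mult_nonneg_nonneg)
    then have lim: "((\<lambda>\<tau>. g2 k \<tau> + m (q' \<tau>) * lam ^ (2 * k) * g0 k \<tau>) \<longlongrightarrow> g2 k t + m (q' t) * lam ^ (2 * k) * g0 k t) (at t within I)"
      by (intro tendsto_add tendsto_mult tendsto_const lim_g)
    have Ft: "F k t = g2 k t + m (q' t) * lam ^ (2 * k) * g0 k t"
      using t by (simp add: F_def q_sum[OF n] q'_def)
    have ev: "\<forall>\<^sub>F \<tau> in at t within I. g2 k \<tau> + m (q' \<tau>) * lam ^ (2 * k) * g0 k \<tau> = F k \<tau>"
      using near[OF n]
    proof eventually_elim
      case (elim \<tau>)
      then show ?case using S_less_T[of "Suc n"] by (simp add: F_def q_sum q'_def)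
    qed
    show ?thesis unfolding Ft using lim ev by (rule Lim_transform_eventually)
  qed
  have F_late: "F k t = 0" if "t \<ge> T" for k t using that by (simp add: F_def)

  have gevrey_f: "gevrey_C0_on e (\<lambda>k. lam ^ k) r s {0..} f" if s: "s > 1" "r > 0" for r s
    unfolding gevrey_C0_on_def
  proof (intro conjI ballI)
    fix t :: real assume "t \<in> {0..}"
    then have t: "t \<ge> 0" by simp
    have "\<exists>N. \<forall>k\<ge>N. F k t = 0"
    proof (cases "t < T")
      case True
      then show ?thesis using stage[OF t True] F_fin by blast
    qed (simp add: F_late)
    then obtain N where "\<And>k. k \<ge> N \<Longrightarrow> F k t = 0" by blast
    then show "f t \<in> gevrey e (\<lambda>k. lam ^ k) r s"
      unfolding f_def by (rule orthonormal_sum_in_gevrey[OF ortho])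
    consider "t < T" | "t = T" | "t > T" by linarith
    then show "((\<lambda>\<tau>. gevrey_norm e (\<lambda>k. lam ^ k) r s (f \<tau> - f t)) \<longlongrightarrow> 0) (at t within {0..})"
    proof cases
      case 1
      then obtain n where n: "t < S (Suc n)" using stage[OF t] by auto
      show ?thesis unfolding f_def
      proof (rule gevrey_continuous_at[OF ortho])
        show "\<forall>\<^sub>F \<tau> in at t within {0..}. \<forall>k\<ge>n + 3. F k \<tau> = 0"
          using near[OF n] by eventually_elim (use F_fin in auto)
      qed (use F_fin[OF n] F_lim[OF t 1] in auto)
    next
      case 3
      have "\<forall>\<^sub>F \<tau> in at t within {0..}. \<tau> > T" by (rule order_tendstoD(1)[OF tendsto_ident_at 3])
      then have late: "\<forall>\<^sub>F \<tau> in at t within {0..}. \<forall>k. F k \<tau> = 0"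
        by eventually_elim (simp add: F_late)
      show ?thesis unfolding f_def
      proof (rule gevrey_continuous_at[OF ortho])
        show "\<forall>\<^sub>F \<tau> in at t within {0..}. \<forall>k\<ge>0. F k \<tau> = 0" using late by simp
        show "(F k \<longlongrightarrow> F k t) (at t within {0..})" for k
          by (rule tendsto_eventually) (use late in eventually_elim, use 3 in \<open>simp add: F_late\<close>)
      qed (use 3 in \<open>simp add: F_late\<close>)
    next
      case 2
      \<comment> \<open>Bounds the squared norm of the force between \<open>S n\<close> and
        \<open>S (Suc n)\<close>: at most n + 3 modes, each with the residual bound and with the
        largest weight, that of index n + 2.\<close>
      define \<beta> where "\<beta> n = (real n + 3) * ((C * (lam ^ Suc n * exp (- (\<kappa> * (lam ^ n / (real (Suc n))\<^sup>2)))))\<^sup>2 *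
        exp (r * (lam ^ (n + 2)) powr (1 / s)))" for n
      have \<beta>: "\<beta> \<longlonglongrightarrow> 0" unfolding \<beta>_def[abs_def]
        by (rule gevrey_forcing_bound_tendsto_0[OF lam(1) \<kappa> s])
      have bound: "gevrey_norm e (\<lambda>k. lam ^ k) r s (f \<tau>) \<le> sqrt (\<beta> n)"
        if \<tau>: "S n \<le> \<tau>" "\<tau> < S (Suc n)" for n \<tau>
      proof -
        have "(F k \<tau>)\<^sup>2 * exp (r * (lam ^ k) powr (1 / s)) \<le>
          (C * (lam ^ Suc n * exp (- (\<kappa> * (lam ^ n / (real (Suc n))\<^sup>2)))))\<^sup>2 * exp (r * (lam ^ (n + 2)) powr (1 / s))"
          if k: "k < n + 3" for k
        proof (rule mult_mono)
          have "\<bar>F k \<tau>\<bar> \<le> C * (lam ^ Suc n * exp (- (\<kappa> * (lam ^ n / (real (Suc n))\<^sup>2))))"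
            using residual[OF \<tau>(1) less_imp_le[OF \<tau>(2)], of k] \<tau>(2) S_less_T[of "Suc n"]
            by (simp add: F_def q_sum[OF \<tau>(2)])
          then have "\<bar>F k \<tau>\<bar>\<^sup>2 \<le> (C * (lam ^ Suc n * exp (- (\<kappa> * (lam ^ n / (real (Suc n))\<^sup>2)))))\<^sup>2"
            by (rule power_mono) simp
          then show "(F k \<tau>)\<^sup>2 \<le> (C * (lam ^ Suc n * exp (- (\<kappa> * (lam ^ n / (real (Suc n))\<^sup>2)))))\<^sup>2" by simp
          have "lam ^ k \<le> lam ^ (n + 2)" using lam k by (intro power_increasing) auto
          then have "(lam ^ k) powr (1 / s) \<le> (lam ^ (n + 2)) powr (1 / s)" using s lam by (intro powr_mono2) auto
          then show "exp (r * (lam ^ k) powr (1 / s)) \<le> exp (r * (lam ^ (n + 2)) powr (1 / s))" using s by simp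
        qed auto
        then have "(\<Sum>k<n + 3. (F k \<tau>)\<^sup>2 * exp (r * (lam ^ k) powr (1 / s))) \<le> real (card {..<n + 3}) *
          ((C * (lam ^ Suc n * exp (- (\<kappa> * (lam ^ n / (real (Suc n))\<^sup>2)))))\<^sup>2 * exp (r * (lam ^ (n + 2)) powr (1 / s)))"
          by (intro sum_bounded_above) auto
        also have "\<dots> = \<beta> n" by (simp add: \<beta>_def)
        finally have "sqrt (\<Sum>k<n + 3. (F k \<tau>)\<^sup>2 * exp (r * (lam ^ k) powr (1 / s))) \<le> sqrt (\<beta> n)" by simp
        then show ?thesis unfolding f_def
          by (subst gevrey_norm_orthonormal_sum[OF ortho, of "n + 3"]) (use F_fin[OF \<tau>(2)] in auto)
      qed
      have f0: "f \<tau> = 0" if "\<tau> \<ge> T" for \<tau>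
        unfolding f_def using F_late[OF that] by (simp add: orthonormal_sum_finite[of 0])
      have norm0: "gevrey_norm e (\<lambda>k. lam ^ k) r s 0 = 0" by (simp add: gevrey_norm_def)
      have norm_ge: "gevrey_norm e (\<lambda>k. lam ^ k) r s (f \<tau>) \<ge> 0" if \<tau>: "0 \<le> \<tau>" for \<tau>
      proof (cases "\<tau> < T")
        case True
        then obtain n where "\<tau> < S (Suc n)" using stage[OF \<tau>] by auto
        from F_fin[OF this] show ?thesis unfolding f_def
          by (subst gevrey_norm_orthonormal_sum[OF ortho, of "n + 3"]) (auto intro!: sum_nonneg)
      qed (simp add: f0 norm0)
      have "((\<lambda>\<tau>. gevrey_norm e (\<lambda>k. lam ^ k) r s (f \<tau>)) \<longlongrightarrow> 0) (at T within {0..})"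
      proof (rule tendstoI)
        fix \<epsilon> :: real assume \<epsilon>: "\<epsilon> > 0"
        have "(\<lambda>n. sqrt (\<beta> n)) \<longlonglongrightarrow> sqrt 0" by (intro tendsto_real_sqrt \<beta>)
        then have "\<forall>\<^sub>F n in sequentially. sqrt (\<beta> n) < \<epsilon>" using \<epsilon> by (intro order_tendstoD(2)) auto
        then obtain M where M: "\<And>n. n \<ge> M \<Longrightarrow> sqrt (\<beta> n) < \<epsilon>" by (auto simp: eventually_sequentially)
        \<comment> \<open>Times close to \<open>T\<close> lie either beyond \<open>T\<close>, where
          the force is zero, or in a stage of index at least \<open>M\<close>.\<close>
        have ev: "\<forall>\<^sub>F \<tau> in at T within {0..}. \<tau> > S M" by (rule order_tendstoD(1)[OF tendsto_ident_at S_less_T])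
        show "\<forall>\<^sub>F \<tau> in at T within {0..}. dist (gevrey_norm e (\<lambda>k. lam ^ k) r s (f \<tau>)) 0 < \<epsilon>"
          using ev
        proof eventually_elim
          case (elim \<tau>)
          have \<tau>0: "\<tau> \<ge> 0" using elim S_nonneg[of M] by linarith
          show ?case
          proof (cases "\<tau> < T")
            case True
            then obtain n where n: "S n \<le> \<tau>" "\<tau> < S (Suc n)" using stage[OF \<tau>0] by blast
            have "S M < S (Suc n)" using elim n by linarith
            then have "M \<le> n" using strict_mono_less[OF S(2)] by simp
            from le_less_trans[OF bound[OF n] M[OF this]] show ?thesis using norm_ge[OF \<tau>0] by simp
          qed (use \<epsilon> in \<open>simp add: f0 norm0\<close>)
        qed
      qed
      then show ?thesis using 2 by (simp add: f0)
    qed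
  qed

  have powr_half: "(lam ^ (2 * k)) powr (1 / 2) = lam ^ k" for k
    using lam by (simp add: powr_half_sqrt power_even_eq)
  have eqn: "u t \<in> Domain A \<and> u t \<in> Domain (op_power A (1/2)) \<and>
      u2 t + m ((norm (op_app (op_power A (1/2)) (u t)))\<^sup>2) *\<^sub>R op_app A (u t) = f t"
    if t: "t \<in> {0..<T}" for t
  proof -
    obtain n where n: "t < S (Suc n)" using stage[of t] t by auto
    let ?I = "{..<n + 3}"
    have u: "u t = (\<Sum>k\<in>?I. g0 k t *\<^sub>R e k)" unfolding u_def
      by (rule orthonormal_sum_finite) (use fin[OF n] in auto)
    have Au: "op_app A (u t) = (\<Sum>k\<in>?I. (g0 k t * lam ^ (2 * k)) *\<^sub>R e k)" unfolding u
      by (rule op_app_eigenvector_sum[OF assms(6)]) (use eig in auto)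
    have "op_app (op_power A (1/2)) (u t) = (\<Sum>k\<in>?I. (g0 k t * (lam ^ (2 * k)) powr (1/2)) *\<^sub>R e k)" unfolding u
      by (rule op_app_power_eigenvector_sum[OF assms(6)]) (use eig lam in auto)
    also have "\<dots> = orthonormal_sum e (\<lambda>k. g0 k t * lam ^ k)"
      unfolding powr_half using fin[OF n] by (subst orthonormal_sum_finite[of "n + 3"]) auto
    finally have "(norm (op_app (op_power A (1/2)) (u t)))\<^sup>2 = (\<Sum>k<n + 3. (g0 k t * lam ^ k)\<^sup>2)"
      using orthonormal_sum_norm[OF ortho, of "n + 3" "\<lambda>k. g0 k t * lam ^ k"] fin[OF n] by simp
    also have "\<dots> = q t" unfolding q_sum[OF n]
      by (intro sum.cong) (simp_all add: power_mult_distrib power_even_eq)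
    finally have nq: "(norm (op_app (op_power A (1/2)) (u t)))\<^sup>2 = q t" .
    have "u2 t = (\<Sum>k\<in>?I. g2 k t *\<^sub>R e k)" unfolding u2_def
      by (rule orthonormal_sum_finite) (use fin[OF n] in auto)
    moreover have "f t = (\<Sum>k\<in>?I. F k t *\<^sub>R e k)" unfolding f_def
      by (rule orthonormal_sum_finite) (use F_fin[OF n] in auto)
    ultimately have "u2 t + m (q t) *\<^sub>R op_app A (u t) = f t"
      using t by (simp add: Au F_def scaleR_sum_right scaleR_add_left mult_ac flip: sum.distrib)
    moreover have "u t \<in> Domain A" unfolding u
      by (rule DomainI[OF psa_eigenvector_sum[OF assms(6), where \<mu> = "\<lambda>k. lam ^ (2 * k)"]]) (use eig in auto)
    moreover have "u t \<in> Domain (op_power A (1/2))" unfolding u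
      by (rule DomainI[OF op_power_eigenvector_sum[OF assms(6), where \<mu> = "\<lambda>k. lam ^ (2 * k)"]]) (use eig lam in auto)
    ultimately show ?thesis using nq by simp
  qed

  have domain: "u1 t \<in> Domain (op_power A \<alpha>) \<and> u t \<in> Domain (op_power A (\<alpha> + 1/2))"
    if t: "t \<in> {0..<T}" and \<alpha>: "\<alpha> > 0" for t \<alpha>
  proof -
    obtain n where n: "t < S (Suc n)" using stage[of t] t by auto
    have u: "u t = (\<Sum>k<n + 3. g0 k t *\<^sub>R e k)" "u1 t = (\<Sum>k<n + 3. g1 k t *\<^sub>R e k)" unfolding u_def u1_def
      by (rule orthonormal_sum_finite, use fin[OF n] in auto)+
    have "u t \<in> Domain (op_power A (\<alpha> + 1/2))" unfolding u
      by (rule DomainI[OF op_power_eigenvector_sum[OF assms(6), where \<mu> = "\<lambda>k. lam ^ (2 * k)"]]) (use eig lam \<alpha> in auto)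
    moreover have "u1 t \<in> Domain (op_power A \<alpha>)" unfolding u
      by (rule DomainI[OF op_power_eigenvector_sum[OF assms(6), where \<mu> = "\<lambda>k. lam ^ (2 * k)"]]) (use eig lam \<alpha> in auto)
    ultimately show ?thesis by blast
  qed

  \<comment> \<open>The exit times approach \<open>T\<close> from the left, so they can test both
    the limit superior and the limit of u'.\<close>
  have S_left: "filterlim S (at_left T) sequentially"
    using S(3) S_less_T by (auto simp: filterlim_at intro!: always_eventually)

  have blowup: "Limsup (at_left T) (\<lambda>t. ereal ((norm (op_app (op_power A \<alpha>) (u1 t)))\<^sup>2
      + (norm (op_app (op_power A (\<alpha> + 1/2)) (u t)))\<^sup>2)) = \<infinity>" if \<alpha>: "\<alpha> > 0" for \<alpha>
  proof (rule ccontr)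
    let ?h = "\<lambda>t. (norm (op_app (op_power A \<alpha>) (u1 t)))\<^sup>2 + (norm (op_app (op_power A (\<alpha> + 1/2)) (u t)))\<^sup>2"
    assume "Limsup (at_left T) (\<lambda>t. ereal (?h t)) \<noteq> \<infinity>"
    then obtain B where "Limsup (at_left T) (\<lambda>t. ereal (?h t)) < ereal B"
      unfolding less_PInf_Ex_of_nat by blast
    then have "\<forall>\<^sub>F t in at_left T. ereal (?h t) < ereal B" by (rule Limsup_lessD)
    then have "\<forall>\<^sub>F n in sequentially. ereal (?h (S n)) < ereal B"
      using S_left by (rule eventually_compose_filterlim)
    then have 1: "\<forall>\<^sub>F n in sequentially. ?h (S n) < B" by simp
    \<comment> \<open>The ratio lam^(4 \<alpha>) by which the squared factor of A^\<alpha> grows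
      from one mode to the next. The single mode e_(n+1) at time \<open>S n\<close> already gives
      geometric growth.\<close>
    define \<gamma> where "\<gamma> = (lam powr (2 * \<alpha>))\<^sup>2"
    have "lam powr (2 * \<alpha>) > 1" using lam \<alpha> by simp
    then have \<gamma>: "\<gamma> > 1" by (simp add: \<gamma>_def one_less_power)
    have lower: "c\<^sup>2 * \<gamma> ^ Suc n \<le> ?h (S n)" for n
    proof -
      have n: "S n < S (Suc n)" using strict_monoD[OF S(2)] by simp
      let ?c = "\<lambda>k. g1 k (S n) * (lam ^ (2 * k)) powr \<alpha>"
      have "u1 (S n) = (\<Sum>k<n + 3. g1 k (S n) *\<^sub>R e k)" unfolding u1_def
        by (rule orthonormal_sum_finite) (use fin[OF n] in auto)
      moreover have "op_app (op_power A \<alpha>) (\<Sum>k<n + 3. g1 k (S n) *\<^sub>R e k) = (\<Sum>k<n + 3. ?c k *\<^sub>R e k)"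
        by (rule op_app_power_eigenvector_sum[OF assms(6)]) (use eig lam \<alpha> in auto)
      moreover have "(\<Sum>k<n + 3. ?c k *\<^sub>R e k) = orthonormal_sum e ?c"
        using fin[OF n] by (subst orthonormal_sum_finite[of "n + 3"]) auto
      ultimately have "(norm (op_app (op_power A \<alpha>) (u1 (S n))))\<^sup>2 = (\<Sum>k<n + 3. (?c k)\<^sup>2)"
        using orthonormal_sum_norm[OF ortho, of "n + 3" ?c] fin[OF n] by simp
      also have "\<dots> \<ge> (?c (Suc n))\<^sup>2" by (rule member_le_sum) auto
      finally have e1: "(g1 (Suc n) (S n))\<^sup>2 * ((lam ^ (2 * Suc n)) powr \<alpha>)\<^sup>2 \<le> (norm (op_app (op_power A \<alpha>) (u1 (S n))))\<^sup>2"
        by (simp only: power_mult_distrib)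
      have e2: "((lam ^ (2 * Suc n)) powr \<alpha>)\<^sup>2 = \<gamma> ^ Suc n"
      proof -
        have "(lam ^ (2 * Suc n)) powr \<alpha> = (lam powr (2 * \<alpha>)) ^ Suc n"
          using lam by (simp only: powr_realpow[symmetric] powr_powr powr_gt_zero) (simp add: algebra_simps)
        then show ?thesis by (simp only: \<gamma>_def power_mult[symmetric] mult.commute)
      qed
      have e3: "c\<^sup>2 * \<gamma> ^ Suc n \<le> (g1 (Suc n) (S n))\<^sup>2 * \<gamma> ^ Suc n"
        using g1_S[of n] c \<gamma> by (intro mult_right_mono power_mono) auto
      show ?thesis
        using add_mono[OF order.trans[OF e3 e1[unfolded e2]] zero_le_power2[of "norm (op_app (op_power A (\<alpha> + 1/2)) (u (S n)))"]]
        by (simp only: add_0_right)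
    qed
    obtain N where N: "B / c\<^sup>2 < \<gamma> ^ N" using real_arch_pow[OF \<gamma>] by blast
    obtain n where n: "n \<ge> N" "?h (S n) < B"
      using eventually_happens[OF eventually_conj[OF eventually_ge_at_top[of N] 1]] by auto
    have "\<gamma> ^ N \<le> \<gamma> ^ Suc n" using \<gamma> n(1) by (intro power_increasing) auto
    then have "B / c\<^sup>2 < \<gamma> ^ Suc n" using N by linarith
    then have "B < c\<^sup>2 * \<gamma> ^ Suc n" using c by (simp add: divide_less_eq mult.commute)
    then show False using lower[of n] n(2) by linarith
  qed

  \<comment> \<open>A limit along \<open>S n\<close> is orthogonal to each e_k, because mode
    \<open>k\<close> is dead after \<open>S (Suc k)\<close>. Each u'(S n) is a combination of the
    e_k, so the limit is orthogonal to itself, hence 0, while |u'(S n)| is at least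
    \<open>c\<close>.\<close>
  have no_limit: "\<not> (\<exists>l. (u1 \<longlongrightarrow> l) (at_left T))"
  proof
    assume "\<exists>l. (u1 \<longlongrightarrow> l) (at_left T)"
    then obtain l where "(u1 \<longlongrightarrow> l) (at_left T)" by blast
    then have lim: "(\<lambda>n. u1 (S n)) \<longlonglongrightarrow> l" using S_left by (rule filterlim_compose)
    have inner: "u1 (S n) \<bullet> e k = g1 k (S n)" for n k
    proof -
      have "S n < S (Suc n)" using strict_monoD[OF S(2)] by simp
      from fin[OF this] show ?thesis unfolding u1_def
        by (intro orthonormal_sum_inner[OF ortho, of "n + 3"]) auto
    qed
    have l_orth: "l \<bullet> e k = 0" for k
    proof (rule LIMSEQ_unique)
      show "(\<lambda>n. u1 (S n) \<bullet> e k) \<longlonglongrightarrow> l \<bullet> e k" by (intro tendsto_intros lim)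
      have "\<forall>\<^sub>F n in sequentially. u1 (S n) \<bullet> e k = 0"
        using eventually_gt_at_top[of k] by eventually_elim (simp add: inner past[OF order_refl])
      then show "(\<lambda>n. u1 (S n) \<bullet> e k) \<longlonglongrightarrow> 0" by (rule tendsto_eventually)
    qed
    have "u1 (S n) \<bullet> l = 0" for n
    proof -
      have "S n < S (Suc n)" using strict_monoD[OF S(2)] by simp
      from fin[OF this] have "u1 (S n) = (\<Sum>k<n + 3. g1 k (S n) *\<^sub>R e k)" unfolding u1_def
        by (intro orthonormal_sum_finite) auto
      then show ?thesis using l_orth by (simp add: inner_commute[of _ l] inner_sum_right)
    qed
    moreover have "(\<lambda>n. u1 (S n) \<bullet> l) \<longlonglongrightarrow> l \<bullet> l" by (intro tendsto_intros lim)
    ultimately have "l = 0" by (simp add: LIMSEQ_const_iff)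
    then have "(\<lambda>n. norm (u1 (S n))) \<longlonglongrightarrow> 0" using tendsto_norm[OF lim] by simp
    then have "\<forall>\<^sub>F n in sequentially. norm (u1 (S n)) < c" using c by (rule order_tendstoD)
    then obtain n where n: "norm (u1 (S n)) < c" by (auto simp: eventually_sequentially)
    have "c \<le> u1 (S n) \<bullet> e (Suc n)" using g1_S[of n] by (simp add: inner)
    also have "\<dots> \<le> norm (u1 (S n)) * norm (e (Suc n))" by (rule norm_cauchy_schwarz)
    also have "norm (e (Suc n)) = 1" using ortho[of "Suc n" "Suc n"] by (simp add: norm_eq_sqrt_inner)
    finally show False using n by simp
  qed

  show ?thesis
    using gevrey_f T gevrey_u eqn domain blowup no_limit
    by (intro exI[of _ f] exI[of _ T] exI[of _ u] exI[of _ u1] exI[of _ u2]) blast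
qed

end
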